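(* The compact convex set $\mathcal{S}^{\mathcal{U}(\mathcal{H})}(\mathfrak{B})$ of all $\mathcal{U}(\mathcal{H})$-invariant states on $\mathfrak{B}=\mathrm{CCR}(\mathcal{H},\sigma)$ is a Bauer simplex whose set of extreme points is $\{\omega_{\sigma^2}:\sigma^2\in[1,+\infty]\}$. Explicitly, if $\omega$ is a $\mathcal{U}(\mathcal{H})$-invariant state on $\mathfrak{B}$, then there exists a unique Borel probability measure $\mu$ on $[1,+\infty]$ such that $$\omega=\int_{[1,+\infty]}\omega_{\sigma^2}\,d\mu(\sigma^2),$$ that is, $\omega(a)=\int_{[1,+\infty]}\omega_{\sigma^2}(a)\,d\mu(\sigma^2)$ for all $a\in\mathfrak{B}$.
   Context: $\mathcal{H}$ is an infinite-dimensional separable complex Hilbert space, with inner product linear in the first variable, regarded as a real symplectic space with symplectic form $\sigma(x,y)=\mathrm{Im}\langle x,y\rangle$. $\mathfrak{B}=\mathrm{CCR}(\mathcal{H},\sigma)$ is the universal $C^*$-algebra generated by elements $W(x)$, $x\in\mathcal{H}$, subject to $W(x)^*=W(-x)$ and $W(x)W(y)=e^{i\sigma(x,y)}W(x+y)$ for all $x,y\in\mathcal{H}$; it is unital with unit $W(0)$. $\mathcal{U}(\mathcal{H})$ is the group of all unitary operators on $\mathcal{H}$; it acts on $\mathfrak{B}$ by the automorphisms $\rho_U$ determined by $\rho_U(W(x))=W(Ux)$. A state $\omega$ is $\mathcal{U}(\mathcal{H})$-invariant if $\omega\circ\rho_U=\omega$ for all $U\in\mathcal{U}(\mathcal{H})$.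 The set of states carries the weak$^*$ topology. For $1\le\sigma^2<+\infty$, $\omega_{\sigma^2}$ is the state on $\mathfrak{B}$ uniquely determined by $\omega_{\sigma^2}(W(x))=e^{-\sigma^2\|x\|^2/2}$, $x\in\mathcal{H}$; $\omega_\infty$ is the canonical trace, determined by $\omega_\infty(W(x))=0$ for all $x\neq0$ (and $\omega_\infty(W(0))=1$). The space $[1,+\infty]$ is the one-point compactification of $[1,+\infty)$. A Bauer simplex is a Choquet simplex whose set of extreme points is compact. *)

theory Defs
  imports "HOL-Analysis.Analysis" "HOL-Probability.Probability"
begin

section \<open>Complex Hilbert spaces\<close>

class scaleC =
  fixes scaleC :: "complex \<Rightarrow> 'a \<Rightarrow> 'a"  (infixr \<open>*\<^sub>C\<close> 75)

class complex_vector = real_vector + scaleC +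
  assumes scaleC_add_right: "c *\<^sub>C (x + y) = c *\<^sub>C x + c *\<^sub>C y"
    and scaleC_add_left: "(c + d) *\<^sub>C x = c *\<^sub>C x + d *\<^sub>C x"
    and scaleC_scaleC: "c *\<^sub>C d *\<^sub>C x = (c * d) *\<^sub>C x"
    and scaleR_scaleC: "r *\<^sub>R x = complex_of_real r *\<^sub>C x"

global_interpretation complex_vector: vector_space "scaleC :: complex \<Rightarrow> 'a \<Rightarrow> 'a::complex_vector"
  defines cspan = complex_vector.span
  by unfold_locales
    (simp_all add: scaleC_add_right scaleC_add_left scaleC_scaleC,
     metis of_real_1 scaleR_one scaleR_scaleC)

lemmas scaleC_simps =
  complex_vector.scale_zero_left complex_vector.scale_zero_right complex_vector.scale_one
  complex_vector.scale_minus_left complex_vector.scale_minus_right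
  complex_vector.scale_left_diff_distrib complex_vector.scale_right_diff_distrib

definition clinear :: "('a::complex_vector \<Rightarrow> 'b::complex_vector) \<Rightarrow> bool" where
  "clinear f \<longleftrightarrow> (\<forall>x y. f (x + y) = f x + f y) \<and> (\<forall>c x. f (c *\<^sub>C x) = c *\<^sub>C f x)"

lemma clinearI:
  assumes "\<And>x y. f (x + y) = f x + f y" "\<And>c x. f (c *\<^sub>C x) = c *\<^sub>C f x"
  shows "clinear f"
  using assms by (simp add: clinear_def)

lemma clinear_add: "clinear f \<Longrightarrow> f (x + y) = f x + f y"
  and clinear_scaleC: "clinear f \<Longrightarrow> f (c *\<^sub>C x) = c *\<^sub>C f x"
  by (simp_all add: clinear_def)

lemma clinear_imp_linear: "clinear f \<Longrightarrow> linear f"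
  by (intro linearI) (simp_all add: clinear_def scaleR_scaleC)

class complex_normed_vector = complex_vector + real_normed_vector +
  assumes norm_scaleC: "norm (c *\<^sub>C x) = cmod c * norm x"

instantiation complex :: complex_normed_vector
begin
definition scaleC_complex :: "complex \<Rightarrow> complex \<Rightarrow> complex" where
  "scaleC_complex c x = c * x"
instance
  by standard (simp_all add: scaleC_complex_def algebra_simps norm_mult scaleR_conv_of_real)
end

text \<open>
  The complex inner product \<open>cinner\<close> is linear in its first argument.  The underlying real inner
  product is its real part, so that \<open>norm x = sqrt (Re (cinner x x))\<close> and definiteness come from
  \<^class>\<open>real_inner\<close>.
\<close>

class complex_inner = complex_vector + real_inner +
  fixes cinner :: "'a \<Rightarrow> 'a \<Rightarrow> complex"
  assumes cinner_add_left: "cinner (x + y) z = cinner x z + cinner y z"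
    and cinner_scaleC_left: "cinner (c *\<^sub>C x) y = c * cinner x y"
    and cinner_commute: "cinner x y = cnj (cinner y x)"
    and inner_eq_Re_cinner: "inner x y = Re (cinner x y)"

class chilbert_space = complex_inner + complete_space

lemma cinner_self: "cinner x x = complex_of_real ((norm (x::'a::complex_inner))\<^sup>2)"
proof -
  have "Im (cinner x x) = 0"
    using arg_cong[OF cinner_commute[of x x], of Im] by simp
  moreover have "Re (cinner x x) = (norm x)\<^sup>2"
    by (simp add: power2_norm_eq_inner inner_eq_Re_cinner)
  ultimately show ?thesis by (simp add: complex_eq_iff)
qed

text \<open>Unitary operators: surjective linear isometries.\<close>

definition unitary_group :: "('h::complex_inner \<Rightarrow> 'h) set" where
  "unitary_group = {U. clinear U \<and> surj U \<and> (\<forall>x y. cinner (U x) (U y) = cinner x y)}"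

definition symp_form :: "'h::complex_inner \<Rightarrow> 'h \<Rightarrow> real" where
  "symp_form x y = Im (cinner x y)"

lemma symp_form_add_left: "symp_form (x + y) z = symp_form x z + symp_form y z"
  by (simp add: symp_form_def cinner_add_left)

lemma symp_form_commute: "symp_form x y = - symp_form y x"
  using arg_cong[OF cinner_commute[of x y], of Im] by (simp add: symp_form_def)

lemma symp_form_add_right: "symp_form z (x + y) = symp_form z x + symp_form z y"
  using symp_form_commute symp_form_add_left by (metis minus_add_distrib)

lemma symp_form_zero_left [simp]: "symp_form 0 x = 0"
  using symp_form_add_left[of 0 0 x] by simp

lemma symp_form_zero_right [simp]: "symp_form x 0 = 0"
  using symp_form_commute[of x 0] by simp

lemma symp_form_minus_left [simp]: "symp_form (- x) y = - symp_form x y"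
  using symp_form_add_left[of x "- x" y] by simp

lemma symp_form_minus_right [simp]: "symp_form x (- y) = - symp_form x y"
  using symp_form_commute[of x "- y"] symp_form_commute[of x y] by simp

lemma symp_form_self [simp]: "symp_form x x = 0"
  using symp_form_commute[of x x] by simp


section \<open>C*-algebras\<close>

class star =
  fixes star :: "'a \<Rightarrow> 'a"

class star_algebra = complex_vector + real_algebra + star +
  assumes mult_scaleC_left: "(c *\<^sub>C x) * y = c *\<^sub>C (x * y)"
    and mult_scaleC_right: "x * (c *\<^sub>C y) = c *\<^sub>C (x * y)"
    and star_add: "star (x + y) = star x + star y"
    and star_scaleC: "star (c *\<^sub>C x) = cnj c *\<^sub>C star x"
    and star_mult: "star (x * y) = star y * star x"
    and star_star: "star (star x) = x"

class pre_cstar_algebra = star_algebra + complex_normed_vector + real_normed_algebra +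
  assumes cstar_identity: "norm (star x * x) = (norm x)\<^sup>2"

class pre_cstar_algebra_1 = pre_cstar_algebra + real_normed_algebra_1

class cstar_algebra = pre_cstar_algebra + banach

class cstar_algebra_1 = cstar_algebra + real_normed_algebra_1

instance cstar_algebra_1 \<subseteq> pre_cstar_algebra_1 ..

lemma star_zero [simp]: "star (0::'a::star_algebra) = 0"
  using star_add[of "0::'a" 0] by simp

lemma star_minus: "star (- x :: 'a::star_algebra) = - star x"
  using star_add[of x "- x"] by (simp add: add.commute eq_neg_iff_add_eq_0 minus_equation_iff)

lemma star_diff: "star (x - y :: 'a::star_algebra) = star x - star y"
  using star_add[of x "- y"] by (simp add: star_minus)

lemma star_sum: "star (sum f A :: 'a::star_algebra) = (\<Sum>x\<in>A. star (f x))"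
  by (induction A rule: infinite_finite_induct) (simp_all add: star_add)

text \<open>Between C*-algebras the boundedness requirement is automatic.\<close>

definition star_hom :: "('a::pre_cstar_algebra \<Rightarrow> 'b::pre_cstar_algebra) \<Rightarrow> bool" where
  "star_hom f \<longleftrightarrow> clinear f \<and> bounded_linear f \<and> (\<forall>x y. f (x * y) = f x * f y) \<and>
     (\<forall>x. f (star x) = star (f x))"

definition cstar_seminorm :: "('a::star_algebra \<Rightarrow> real) \<Rightarrow> bool" where
  "cstar_seminorm p \<longleftrightarrow>
     (\<forall>x y. p (x + y) \<le> p x + p y) \<and> (\<forall>c x. p (c *\<^sub>C x) = cmod c * p x) \<and>
     (\<forall>x y. p (x * y) \<le> p x * p y) \<and> (\<forall>x. p (star x * x) = (p x)\<^sup>2)"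

lemma cstar_seminormD:
  assumes "cstar_seminorm p"
  shows "p (x + y) \<le> p x + p y" "p (c *\<^sub>C x) = cmod c * p x" "p (x * y) \<le> p x * p y"
    "p (star x * x) = (p x)\<^sup>2" "p 0 = 0" "p (- x) = p x" "0 \<le> p x"
proof -
  show *: "p (x + y) \<le> p x + p y" "p (c *\<^sub>C x) = cmod c * p x" "p (x * y) \<le> p x * p y"
    "p (star x * x) = (p x)\<^sup>2" for c x y
    using assms by (simp_all add: cstar_seminorm_def)
  show 0: "p 0 = 0" using *(2)[of 0 0] by simp
  show m: "p (- x) = p x" for x using *(2)[of "-1" x] by (simp add: scaleC_simps)
  show "0 \<le> p x" using *(1)[of x "- x"] by (simp add: 0 m)
qed

lemma cstar_seminorm_sum:
  assumes "cstar_seminorm p"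
  shows "p (sum f A) \<le> (\<Sum>x\<in>A. p (f x))"
proof (induction A rule: infinite_finite_induct)
  case (insert x F)
  then show ?case using cstar_seminormD(1)[OF assms, of "f x" "sum f F"] by simp
qed (simp_all add: cstar_seminormD(5)[OF assms])


section \<open>The *-algebra of the Weyl relations\<close>

text \<open>
  Modulo the Weyl relations, the free *-algebra on symbols \<open>W(x)\<close> is the vector space of finite
  formal linear combinations of the \<open>W(x)\<close>, i.e. of finitely supported functions, with the product
  \<open>W(x) W(y) = exp(i symp_form(x,y)) W(x+y)\<close> extended bilinearly.
\<close>

typedef 'h weyl = "{f :: 'h \<Rightarrow> complex. finite {x. f x \<noteq> 0}}"
  morphisms wcoeff Abs_weyl
  by (rule exI[of _ "\<lambda>_. 0"]) simp

setup_lifting type_definition_weyl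

definition wsupp :: "'h weyl \<Rightarrow> 'h set" where
  "wsupp f = {x. wcoeff f x \<noteq> 0}"

lemma finite_wsupp [simp]: "finite (wsupp f)"
  using wcoeff[of f] by (simp add: wsupp_def)

lemma weyl_eqI: "(\<And>x. wcoeff f x = wcoeff g x) \<Longrightarrow> f = g"
  by (simp add: wcoeff_inject[symmetric] fun_eq_iff)

instantiation weyl :: (type) complex_vector
begin

lift_definition zero_weyl :: "'a weyl" is "\<lambda>_. 0" by simp
lift_definition plus_weyl :: "'a weyl \<Rightarrow> 'a weyl \<Rightarrow> 'a weyl" is "\<lambda>f g x. f x + g x"
  by (rule finite_subset[rotated], erule (1) finite_UnI) auto
lift_definition uminus_weyl :: "'a weyl \<Rightarrow> 'a weyl" is "\<lambda>f x. - f x" by simp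
lift_definition minus_weyl :: "'a weyl \<Rightarrow> 'a weyl \<Rightarrow> 'a weyl" is "\<lambda>f g x. f x - g x"
  by (rule finite_subset[rotated], erule (1) finite_UnI) auto
lift_definition scaleC_weyl :: "complex \<Rightarrow> 'a weyl \<Rightarrow> 'a weyl" is "\<lambda>c f x. c * f x"
  by (erule finite_subset[rotated]) auto
definition scaleR_weyl :: "real \<Rightarrow> 'a weyl \<Rightarrow> 'a weyl" where
  "scaleR_weyl r f = complex_of_real r *\<^sub>C f"

instance
  by standard
    (simp_all add: scaleR_weyl_def, (transfer, simp add: fun_eq_iff algebra_simps)+)

end

lemma wcoeff_simps [simp]:
  "wcoeff 0 x = 0" "wcoeff (f + g) x = wcoeff f x + wcoeff g x" "wcoeff (- f) x = - wcoeff f x"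
  "wcoeff (f - g) x = wcoeff f x - wcoeff g x" "wcoeff (c *\<^sub>C f) x = c * wcoeff f x"
  by (transfer, simp)+

lemma wcoeff_sum [simp]: "wcoeff (sum F A) x = (\<Sum>i\<in>A. wcoeff (F i) x)"
  by (induction A rule: infinite_finite_induct) simp_all

lift_definition weyl_gen :: "'h \<Rightarrow> 'h weyl" is "\<lambda>x y. if y = x then 1 else 0" by simp

lemma wcoeff_gen [simp]: "wcoeff (weyl_gen x) y = (if y = x then 1 else 0)"
  by transfer simp

text \<open>Linear extension of a function on the generators.\<close>

definition wlift :: "('h \<Rightarrow> 'v::complex_vector) \<Rightarrow> 'h weyl \<Rightarrow> 'v" where
  "wlift V f = (\<Sum>x\<in>wsupp f. wcoeff f x *\<^sub>C V x)"

lemma wlift_superset: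
  assumes "finite A" "wsupp f \<subseteq> A"
  shows "wlift V f = (\<Sum>x\<in>A. wcoeff f x *\<^sub>C V x)"
  unfolding wlift_def
  by (rule sum.mono_neutral_left[OF assms]) (auto simp: wsupp_def scaleC_simps)

lemma wlift_add [simp]: "wlift V (f + g) = wlift V f + wlift V g"
proof -
  let ?A = "wsupp f \<union> wsupp g"
  have "wsupp (f + g) \<subseteq> ?A" by (auto simp: wsupp_def)
  then show ?thesis
    by (simp add: wlift_superset[of ?A] scaleC_add_left sum.distrib)
qed

lemma wlift_scaleC [simp]: "wlift V (c *\<^sub>C f) = c *\<^sub>C wlift V f"
proof -
  have "wsupp (c *\<^sub>C f) \<subseteq> wsupp f" by (auto simp: wsupp_def)
  then show ?thesis
    by (simp add: wlift_superset[of "wsupp f"] complex_vector.scale_sum_right scaleC_scaleC)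
qed

lemma clinear_wlift: "clinear (wlift V)"
  by (simp add: clinear_def)

lemma wlift_gen [simp]: "wlift V (weyl_gen x) = V x"
  by (subst wlift_superset[of "{x}"]) (auto simp: wsupp_def scaleC_simps split: if_splits)

lemma wlift_weyl_gen: "wlift weyl_gen f = f"
proof (rule weyl_eqI)
  fix x
  have "(\<Sum>y\<in>wsupp f. wcoeff f y * (if x = y then 1 else 0)) =
      (\<Sum>y\<in>wsupp f. if x = y then wcoeff f y else 0)"
    by (intro sum.cong) auto
  also have "\<dots> = (if x \<in> wsupp f then wcoeff f x else 0)"
    by simp
  also have "\<dots> = wcoeff f x"
    by (simp add: wsupp_def)
  finally show "wcoeff (wlift weyl_gen f) x = wcoeff f x"
    by (simp add: wlift_def)
qed

lemma weyl_induct [case_names zero add scale gen]: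
  assumes "P 0" "\<And>f g. P f \<Longrightarrow> P g \<Longrightarrow> P (f + g)" "\<And>c f. P f \<Longrightarrow> P (c *\<^sub>C f)"
    "\<And>x. P (weyl_gen x)"
  shows "P f"
proof -
  have "P (\<Sum>x\<in>A. wcoeff f x *\<^sub>C weyl_gen x)" if "finite A" for A
    using that by (induction A rule: finite_induct) (auto intro: assms)
  then show ?thesis
    using wlift_weyl_gen[of f] finite_wsupp[of f] by (metis wlift_def)
qed

lemma wlift_fun_add: "wlift (\<lambda>x. V x + V' x) f = wlift V f + wlift V' f"
  by (simp add: wlift_def scaleC_add_right sum.distrib)

lemma wlift_fun_scaleC: "wlift (\<lambda>x. c *\<^sub>C V x) f = c *\<^sub>C wlift V f"
  by (simp add: wlift_def complex_vector.scale_sum_right scaleC_scaleC mult.commute)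

instantiation weyl :: (complex_inner) "{star_algebra, ring_1}"
begin

definition times_weyl :: "'a weyl \<Rightarrow> 'a weyl \<Rightarrow> 'a weyl" where
  "f * g = wlift (\<lambda>x. wlift (\<lambda>y. cis (symp_form x y) *\<^sub>C weyl_gen (x + y)) g) f"

definition one_weyl :: "'a weyl" where
  "1 = weyl_gen 0"

lift_definition star_weyl :: "'a weyl \<Rightarrow> 'a weyl" is "\<lambda>f x. cnj (f (- x))"
proof -
  fix f :: "'a \<Rightarrow> complex"
  assume "finite {x. f x \<noteq> 0}"
  then have "finite (uminus ` {x. f x \<noteq> 0})" by simp
  moreover have "{x. cnj (f (- x)) \<noteq> 0} \<subseteq> uminus ` {x. f x \<noteq> 0}" by force
  ultimately show "finite {x. cnj (f (- x)) \<noteq> 0}" by (rule rev_finite_subset)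
qed

lemma weyl_mult_bilin:
  fixes f g h :: "'a weyl"
  shows "(f + g) * h = f * h + g * h" "f * (g + h) = f * g + f * h"
    "(c *\<^sub>C f) * g = c *\<^sub>C (f * g)" "f * (c *\<^sub>C g) = c *\<^sub>C (f * g)"
    "0 * f = 0" "f * 0 = 0"
proof -
  show "(f + g) * h = f * h + g * h" "(c *\<^sub>C f) * g = c *\<^sub>C (f * g)"
    and 1: "f * (g + h) = f * g + f * h" and 2: "f * (c *\<^sub>C g) = c *\<^sub>C (f * g)" for f g h :: "'a weyl" and c
    by (simp_all add: times_weyl_def wlift_fun_add wlift_fun_scaleC)
  then show "0 * f = 0" "f * 0 = 0"
    by (metis complex_vector.scale_zero_left)+
qed

lemma weyl_gen_mult:
  "weyl_gen x * weyl_gen y = cis (symp_form x y) *\<^sub>C weyl_gen (x + y :: 'a)"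
  by (simp add: times_weyl_def)

lemma weyl_star_simps:
  fixes f g :: "'a weyl"
  shows "star (f + g) = star f + star g" "star (c *\<^sub>C f) = cnj c *\<^sub>C star f"
    "star (weyl_gen x) = weyl_gen (- x :: 'a)" "star (0 :: 'a weyl) = 0" "star (star f) = f"
  by (transfer, auto simp: fun_eq_iff)+

instance
proof
  fix f g h :: "'a weyl" and c :: complex and r :: real
  show "f * g * h = f * (g * h)"
  proof (induction f rule: weyl_induct)
    case (gen x)
    show ?case
    proof (induction g rule: weyl_induct)
      case (gen y)
      show ?case
      proof (induction h rule: weyl_induct)
        case (gen z)
        show ?case
          by (simp add: weyl_gen_mult weyl_mult_bilin scaleC_scaleC cis_mult symp_form_add_left
              symp_form_add_right algebra_simps)
      qed (simp_all add: weyl_mult_bilin)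
    qed (simp_all add: weyl_mult_bilin)
  qed (simp_all add: weyl_mult_bilin)
  show "1 * f = f"
    by (induction f rule: weyl_induct)
      (simp_all add: weyl_mult_bilin weyl_gen_mult one_weyl_def scaleC_simps)
  show "f * 1 = f"
    by (induction f rule: weyl_induct)
      (simp_all add: weyl_mult_bilin weyl_gen_mult one_weyl_def scaleC_simps)
  show "(f + g) * h = f * h + g * h" "f * (g + h) = f * g + f * h"
    by (fact weyl_mult_bilin)+
  have "wcoeff (0 :: 'a weyl) 0 \<noteq> wcoeff 1 0" by (simp add: one_weyl_def)
  then show "(0 :: 'a weyl) \<noteq> 1" by metis
  show "(c *\<^sub>C f) * g = c *\<^sub>C (f * g)" "f * (c *\<^sub>C g) = c *\<^sub>C (f * g)"
    "(r *\<^sub>R f) * g = r *\<^sub>R (f * g)" "f * (r *\<^sub>R g) = r *\<^sub>R (f * g)"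
    by (simp_all add: weyl_mult_bilin scaleR_scaleC)
  show "star (f + g) = star f + star g" "star (c *\<^sub>C f) = cnj c *\<^sub>C star f" "star (star f) = f"
    by (fact weyl_star_simps)+
  show "star (f * g) = star g * star f"
  proof (induction f rule: weyl_induct)
    case (gen x)
    show ?case
    proof (induction g rule: weyl_induct)
      case (gen y)
      show ?case
        using symp_form_commute[of x y]
        by (simp add: weyl_gen_mult weyl_star_simps cis_cnj add.commute)
    qed (simp_all add: weyl_mult_bilin weyl_star_simps)
  qed (simp_all add: weyl_mult_bilin weyl_star_simps)
qed

end

text \<open>
  The regular representation on finitely supported functions with the \<open>\<ell>\<^sup>2\<close> norm shows that the
  largest C*-seminorm is a norm.
\<close>

definition wl2 :: "'h weyl \<Rightarrow> real" where
  "wl2 f = L2_set (\<lambda>x. cmod (wcoeff f x)) (wsupp f)"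

definition wl1 :: "'h weyl \<Rightarrow> real" where
  "wl1 f = (\<Sum>x\<in>wsupp f. cmod (wcoeff f x))"

lemma wl2_superset:
  assumes "finite A" "wsupp f \<subseteq> A"
  shows "wl2 f = L2_set (\<lambda>x. cmod (wcoeff f x)) A"
  unfolding wl2_def L2_set_def
  by (rule arg_cong[of _ _ sqrt], rule sum.mono_neutral_left[OF assms]) (auto simp: wsupp_def)

lemma wl2_nonneg [simp]: "0 \<le> wl2 f"
  by (simp add: wl2_def)

lemma wl2_zero [simp]: "wl2 0 = 0"
  by (simp add: wl2_def wsupp_def)

lemma wl2_eq_0_iff: "wl2 f = 0 \<longleftrightarrow> f = 0"
proof
  assume "wl2 f = 0"
  then have "\<forall>x\<in>wsupp f. wcoeff f x = 0"
    by (simp add: wl2_def L2_set_eq_0_iff)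
  then show "f = 0" by (intro weyl_eqI) (auto simp: wsupp_def)
qed simp

lemma wl2_scaleC: "wl2 (c *\<^sub>C f) = cmod c * wl2 f"
proof -
  have "wsupp (c *\<^sub>C f) \<subseteq> wsupp f" by (auto simp: wsupp_def)
  then show ?thesis
    by (simp add: wl2_superset[of "wsupp f"] norm_mult L2_set_right_distrib)
qed

lemma wl2_add: "wl2 (f + g) \<le> wl2 f + wl2 g"
proof -
  let ?A = "wsupp f \<union> wsupp g"
  have *: "wsupp (f + g) \<subseteq> ?A" by (auto simp: wsupp_def)
  have "L2_set (\<lambda>x. cmod (wcoeff f x + wcoeff g x)) ?A
      \<le> L2_set (\<lambda>x. cmod (wcoeff f x) + cmod (wcoeff g x)) ?A"
    by (intro L2_set_mono) (auto intro: norm_triangle_ineq)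
  also have "\<dots> \<le> L2_set (\<lambda>x. cmod (wcoeff f x)) ?A + L2_set (\<lambda>x. cmod (wcoeff g x)) ?A"
    by (rule L2_set_triangle_ineq)
  finally show ?thesis
    using * by (simp add: wl2_superset[of ?A])
qed

lemma wl2_sum: "wl2 (sum F A) \<le> (\<Sum>x\<in>A. wl2 (F x))"
proof (induction A rule: infinite_finite_induct)
  case (insert x A)
  then show ?case using wl2_add[of "F x" "sum F A"] by simp
qed simp_all

lemma wcoeff_gen_mult:
  "wcoeff (weyl_gen x * g) z = cis (symp_form x z) * wcoeff g (z - x :: 'h::complex_inner)"
proof (induction g rule: weyl_induct)
  case (gen y)
  show ?case
    by (auto simp: weyl_gen_mult symp_form_add_right)
qed (simp_all add: weyl_mult_bilin algebra_simps)

lemma wcoeff_star_mult: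
  fixes f g :: "'h::complex_inner weyl"
  assumes "finite A" "wsupp f \<subseteq> A"
  shows "wcoeff (star f * g) 0 = (\<Sum>x\<in>A. cnj (wcoeff f x) * wcoeff g x)"
proof -
  have "f = (\<Sum>x\<in>A. wcoeff f x *\<^sub>C weyl_gen x)"
    using wlift_superset[OF assms, of weyl_gen] wlift_weyl_gen[of f] by simp
  then have "star f = star (\<Sum>x\<in>A. wcoeff f x *\<^sub>C weyl_gen x)" by simp
  then have "star f = (\<Sum>x\<in>A. cnj (wcoeff f x) *\<^sub>C weyl_gen (- x))"
    by (simp add: star_sum weyl_star_simps)
  then show ?thesis
    by (simp add: sum_distrib_right weyl_mult_bilin wcoeff_gen_mult)
qed

lemma wl2_sq: "complex_of_real ((wl2 f)\<^sup>2) = wcoeff (star f * f) (0::'h::complex_inner)"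
  unfolding wcoeff_star_mult[OF finite_wsupp order.refl] wl2_def L2_set_def
  by (simp add: sum_nonneg mult.commute complex_norm_square[symmetric])

lemma wl2_Cauchy_Schwarz:
  fixes f g :: "'h::complex_inner weyl"
  shows "cmod (wcoeff (star f * g) 0) \<le> wl2 f * wl2 g"
proof -
  let ?A = "wsupp f \<union> wsupp g"
  have "cmod (wcoeff (star f * g) 0) \<le> (\<Sum>x\<in>?A. \<bar>cmod (wcoeff f x)\<bar> * \<bar>cmod (wcoeff g x)\<bar>)"
    by (subst wcoeff_star_mult[of ?A]) (auto simp: norm_mult intro!: sum_norm_le)
  also have "\<dots> \<le> wl2 f * wl2 g"
    using L2_set_mult_ineq[of "\<lambda>x. cmod (wcoeff f x)" "\<lambda>x. cmod (wcoeff g x)" ?A]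
    by (simp add: wl2_superset[of ?A])
  finally show ?thesis .
qed

lemma weyl_gen_zero: "weyl_gen 0 = (1 :: 'h::complex_inner weyl)"
  by (simp add: one_weyl_def)

lemma star_gen_mult_gen: "star (weyl_gen x) * weyl_gen x = (1 :: 'h::complex_inner weyl)"
  by (simp add: weyl_star_simps weyl_gen_mult weyl_gen_zero scaleC_simps)

lemma star_one [simp]: "star (1 :: 'h::complex_inner weyl) = 1"
  by (metis mult_1_left mult_1_right star_mult star_star)

lemma wl2_gen_mult: "wl2 (weyl_gen x * g) = wl2 (g :: 'h::complex_inner weyl)"
proof -
  have "star (weyl_gen x * g) * (weyl_gen x * g) = star g * (star (weyl_gen x) * weyl_gen x) * g"
    by (simp add: star_mult mult.assoc)
  then have "complex_of_real ((wl2 (weyl_gen x * g))\<^sup>2) = complex_of_real ((wl2 g)\<^sup>2)"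
    unfolding wl2_sq by (simp add: star_gen_mult_gen)
  then show ?thesis
    by (metis of_real_eq_iff wl2_nonneg power2_eq_imp_eq)
qed

lemma weyl_expand: "f = (\<Sum>x\<in>wsupp f. wcoeff f x *\<^sub>C weyl_gen x)"
  using wlift_weyl_gen[of f] by (simp add: wlift_def)

lemma wl2_mult_le: "wl2 (f * g) \<le> wl1 f * wl2 (g :: 'h::complex_inner weyl)"
proof -
  have "f * g = (\<Sum>x\<in>wsupp f. wcoeff f x *\<^sub>C (weyl_gen x * g))"
    by (subst weyl_expand[of f]) (simp add: sum_distrib_right weyl_mult_bilin)
  then have "wl2 (f * g) \<le> (\<Sum>x\<in>wsupp f. wl2 (wcoeff f x *\<^sub>C (weyl_gen x * g)))"
    by (metis wl2_sum)
  also have "\<dots> = wl1 f * wl2 g"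
    by (simp add: wl1_def wl2_scaleC wl2_gen_mult sum_distrib_right)
  finally show ?thesis .
qed

definition regular_norm :: "'h::complex_inner weyl \<Rightarrow> real" where
  "regular_norm f = (SUP g\<in>{g. wl2 g \<le> 1}. wl2 (f * g))"

lemma bdd_above_regular: "bdd_above ((\<lambda>g. wl2 (f * g)) ` {g :: 'h::complex_inner weyl. wl2 g \<le> 1})"
proof (rule bdd_aboveI2)
  fix g :: "'h weyl" assume "g \<in> {g. wl2 g \<le> 1}"
  then have "wl1 f * wl2 g \<le> wl1 f * 1"
    by (intro mult_left_mono) (auto simp: wl1_def intro: sum_nonneg)
  then show "wl2 (f * g) \<le> wl1 f"
    using wl2_mult_le[of f g] by simp
qed

lemma wl2_le_regular: "wl2 (f * g) \<le> regular_norm f * wl2 (g :: 'h::complex_inner weyl)"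
proof (cases "g = 0")
  case False
  define c where "c = complex_of_real (inverse (wl2 g))"
  have pos: "0 < wl2 g" using False wl2_eq_0_iff[of g] wl2_nonneg[of g] by linarith
  then have "wl2 (c *\<^sub>C g) = 1"
    by (simp add: wl2_scaleC c_def norm_inverse)
  then have "wl2 (f * (c *\<^sub>C g)) \<le> regular_norm f"
    unfolding regular_norm_def by (intro cSUP_upper bdd_above_regular) simp
  then have "inverse (wl2 g) * wl2 (f * g) \<le> regular_norm f"
    using pos by (simp add: weyl_mult_bilin wl2_scaleC c_def norm_inverse)
  then show ?thesis using pos by (simp add: field_simps)
qed (simp add: weyl_mult_bilin)

lemma regular_leI:
  assumes "0 \<le> B" "\<And>g. wl2 (f * g) \<le> B * wl2 (g :: 'h::complex_inner weyl)"
  shows "regular_norm f \<le> B"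
  unfolding regular_norm_def
proof (rule cSUP_least)
  have "(0::'h weyl) \<in> {g. wl2 g \<le> 1}" by simp
  then show "{g :: 'h weyl. wl2 g \<le> 1} \<noteq> {}" by blast
  fix g :: "'h weyl" assume "g \<in> {g. wl2 g \<le> 1}"
  then have "B * wl2 g \<le> B" using assms(1) by (simp add: mult_left_le)
  then show "wl2 (f * g) \<le> B" using assms(2)[of g] by linarith
qed

lemma wl2_one [simp]: "wl2 (1 :: 'h::complex_inner weyl) = 1"
proof -
  have "complex_of_real ((wl2 (1 :: 'h weyl))\<^sup>2) = 1"
    unfolding wl2_sq by (simp add: one_weyl_def weyl_star_simps weyl_gen_mult scaleC_simps)
  then have "(wl2 (1 :: 'h weyl))\<^sup>2 = 1\<^sup>2" by (metis of_real_eq_1_iff one_power2)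
  then show ?thesis by (rule power2_eq_imp_eq) simp_all
qed

lemma wl2_le_regular_norm: "wl2 f \<le> regular_norm (f :: 'h::complex_inner weyl)"
  using wl2_le_regular[of f 1] by simp

lemma regular_norm_nonneg [simp]: "0 \<le> regular_norm f"
  using wl2_le_regular_norm[of f] wl2_nonneg[of f] by linarith

lemma regular_star_mult:
  "wl2 (f * g) ^ 2 \<le> regular_norm (star f * f) * (wl2 (g :: 'h::complex_inner weyl))\<^sup>2"
proof -
  have "(wl2 (f * g))\<^sup>2 = cmod (wcoeff (star g * ((star f * f) * g)) 0)"
    using arg_cong[OF wl2_sq[of "f * g"], of cmod]
    by (simp add: star_mult mult.assoc norm_power)
  also have "\<dots> \<le> wl2 g * wl2 ((star f * f) * g)"
    by (rule wl2_Cauchy_Schwarz)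
  also have "\<dots> \<le> wl2 g * (regular_norm (star f * f) * wl2 g)"
    by (intro mult_left_mono wl2_le_regular) simp
  finally show ?thesis by (simp add: power2_eq_square algebra_simps)
qed

lemma regular_norm_mult: "regular_norm (f * g) \<le> regular_norm f * regular_norm g"
proof (rule regular_leI)
  fix h
  have "wl2 (f * g * h) \<le> regular_norm f * wl2 (g * h)"
    by (metis mult.assoc wl2_le_regular)
  also have "\<dots> \<le> regular_norm f * (regular_norm g * wl2 h)"
    by (intro mult_left_mono wl2_le_regular) simp
  finally show "wl2 (f * g * h) \<le> regular_norm f * regular_norm g * wl2 h"
    by (simp add: mult.assoc)
qed simp

lemma regular_norm_sq_le: "(regular_norm f)\<^sup>2 \<le> regular_norm (star f * f)"
proof -
  have "regular_norm f \<le> sqrt (regular_norm (star f * f))"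
  proof (rule regular_leI)
    fix g
    have "wl2 (f * g) \<le> sqrt (regular_norm (star f * f) * (wl2 g)\<^sup>2)"
      by (rule real_le_rsqrt) (rule regular_star_mult)
    then show "wl2 (f * g) \<le> sqrt (regular_norm (star f * f)) * wl2 g"
      by (simp add: real_sqrt_mult)
  qed simp
  then show ?thesis
    by (simp add: real_le_rsqrt sqrt_ge_absD)
qed

lemma regular_norm_star_le: "regular_norm f \<le> regular_norm (star f)"
proof (cases "regular_norm f = 0")
  case False
  have "(regular_norm f)\<^sup>2 \<le> regular_norm (star f) * regular_norm f"
    by (rule order.trans[OF regular_norm_sq_le regular_norm_mult])
  then show ?thesis
    using False regular_norm_nonneg[of f] by (simp add: power2_eq_square)
qed simp

lemma regular_norm_scaleC: "regular_norm (c *\<^sub>C f) = cmod c * regular_norm f"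
proof (rule antisym)
  have le: "regular_norm (c *\<^sub>C f) \<le> cmod c * regular_norm f" for c and f :: "'a weyl"
    by (rule regular_leI)
      (simp_all add: weyl_mult_bilin wl2_scaleC mult.assoc mult_left_mono wl2_le_regular)
  show "regular_norm (c *\<^sub>C f) \<le> cmod c * regular_norm f" by (rule le)
  show "cmod c * regular_norm f \<le> regular_norm (c *\<^sub>C f)"
  proof (cases "c = 0")
    case False
    then have "regular_norm f \<le> cmod (inverse c) * regular_norm (c *\<^sub>C f)"
      using le[of "inverse c" "c *\<^sub>C f"] by (simp add: scaleC_scaleC scaleC_simps)
    then show ?thesis using False by (simp add: norm_inverse norm_divide field_simps)
  qed simp
qed

lemma cstar_seminorm_regular: "cstar_seminorm (regular_norm :: 'h::complex_inner weyl \<Rightarrow> real)"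
proof -
  have "regular_norm (f + g) \<le> regular_norm f + regular_norm g" for f g :: "'h weyl"
  proof (rule regular_leI)
    fix h
    have "wl2 ((f + g) * h) \<le> wl2 (f * h) + wl2 (g * h)"
      by (simp add: weyl_mult_bilin wl2_add)
    also have "\<dots> \<le> regular_norm f * wl2 h + regular_norm g * wl2 h"
      by (intro add_mono wl2_le_regular)
    finally show "wl2 ((f + g) * h) \<le> (regular_norm f + regular_norm g) * wl2 h"
      by (simp add: algebra_simps)
  qed simp
  moreover have "regular_norm (star f * f) = (regular_norm f)\<^sup>2" for f :: "'h weyl"
  proof (rule antisym)
    have "regular_norm (star f * f) \<le> regular_norm (star f) * regular_norm f"
      by (rule regular_norm_mult)
    also have "\<dots> \<le> regular_norm f * regular_norm f"
      using regular_norm_star_le[of "star f"] by (intro mult_right_mono) (simp_all add: star_star)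
    finally show "regular_norm (star f * f) \<le> (regular_norm f)\<^sup>2"
      by (simp add: power2_eq_square)
  qed (rule regular_norm_sq_le)
  ultimately show ?thesis
    by (simp add: cstar_seminorm_def regular_norm_scaleC regular_norm_mult)
qed

lemma cstar_seminorm_gen_le:
  assumes "cstar_seminorm (p :: 'h::complex_inner weyl \<Rightarrow> real)"
  shows "p (weyl_gen x) \<le> 1"
proof -
  have "p 1 = (p 1)\<^sup>2" using cstar_seminormD(4)[OF assms, of 1] by simp
  then have "p 1 \<le> 1" by (auto simp: power2_eq_square)
  moreover have "(p (weyl_gen x))\<^sup>2 = p 1"
    using cstar_seminormD(4)[OF assms, of "weyl_gen x"] by (simp add: star_gen_mult_gen)
  ultimately have "(p (weyl_gen x))\<^sup>2 \<le> 1\<^sup>2" by simp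
  then show ?thesis by (rule power2_le_imp_le) simp
qed

lemma cstar_seminorm_le_wl1:
  assumes "cstar_seminorm (p :: 'h::complex_inner weyl \<Rightarrow> real)"
  shows "p f \<le> wl1 f"
proof -
  have "p f \<le> (\<Sum>x\<in>wsupp f. p (wcoeff f x *\<^sub>C weyl_gen x))"
    using cstar_seminorm_sum[OF assms] weyl_expand[of f] by metis
  also have "\<dots> \<le> wl1 f"
    unfolding wl1_def
    by (intro sum_mono) (simp add: cstar_seminormD(2)[OF assms] mult_left_le cstar_seminorm_gen_le[OF assms])
  finally show ?thesis .
qed

text \<open>The norm of the universal C*-algebra: the largest C*-seminorm.\<close>

instantiation weyl :: (complex_inner) pre_cstar_algebra_1
begin

definition norm_weyl :: "'a weyl \<Rightarrow> real" where
  "norm_weyl f = (SUP p\<in>{p. cstar_seminorm p}. p f)"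
definition dist_weyl :: "'a weyl \<Rightarrow> 'a weyl \<Rightarrow> real" where
  "dist_weyl f g = norm (f - g)"
definition sgn_weyl :: "'a weyl \<Rightarrow> 'a weyl" where
  "sgn_weyl f = f /\<^sub>R norm f"
definition uniformity_weyl :: "('a weyl \<times> 'a weyl) filter" where
  "uniformity_weyl = (INF e\<in>{0<..}. principal {(x, y). dist x y < e})"
definition open_weyl :: "'a weyl set \<Rightarrow> bool" where
  "open_weyl U \<longleftrightarrow> (\<forall>x\<in>U. eventually (\<lambda>(x', y). x' = x \<longrightarrow> y \<in> U) uniformity)"

lemma cstar_seminorm_le_norm:
  assumes "cstar_seminorm p"
  shows "p f \<le> norm (f :: 'a weyl)"
  unfolding norm_weyl_def
  by (rule cSUP_upper) (use assms in \<open>auto intro!: bdd_aboveI2[of _ _ "wl1 f"] cstar_seminorm_le_wl1\<close>)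

lemma norm_weyl_leI:
  assumes "\<And>p. cstar_seminorm p \<Longrightarrow> p f \<le> B"
  shows "norm (f :: 'a weyl) \<le> B"
  unfolding norm_weyl_def
  by (rule cSUP_least) (use assms cstar_seminorm_regular in auto)

lemma norm_weyl_nonneg: "0 \<le> norm (f :: 'a weyl)"
  using cstar_seminorm_le_norm[OF cstar_seminorm_regular, of f] regular_norm_nonneg[of f]
  by linarith

lemma cstar_seminorm_norm_weyl: "cstar_seminorm (norm :: 'a weyl \<Rightarrow> real)"
  unfolding cstar_seminorm_def
proof (intro conjI allI)
  fix f g :: "'a weyl" and c
  show "norm (f + g) \<le> norm f + norm g"
    by (rule norm_weyl_leI)
      (meson add_mono cstar_seminormD(1) cstar_seminorm_le_norm order.trans)
  show "norm (f * g) \<le> norm f * norm g"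
    by (rule norm_weyl_leI)
      (meson cstar_seminormD(3,7) cstar_seminorm_le_norm order.trans mult_mono norm_weyl_nonneg)
  have le: "norm (c *\<^sub>C f) \<le> cmod c * norm f" for c and f :: "'a weyl"
    by (rule norm_weyl_leI) (simp add: cstar_seminormD(2) cstar_seminorm_le_norm mult_left_mono)
  show "norm (c *\<^sub>C f) = cmod c * norm f"
  proof (rule antisym[OF le])
    show "cmod c * norm f \<le> norm (c *\<^sub>C f)"
    proof (cases "c = 0")
      case False
      then have "norm f \<le> cmod (inverse c) * norm (c *\<^sub>C f)"
        using le[of "inverse c" "c *\<^sub>C f"] by (simp add: scaleC_scaleC scaleC_simps)
      then show ?thesis using False by (simp add: norm_inverse norm_divide field_simps)
    qed (simp add: norm_weyl_nonneg)
  qed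
  show "norm (star f * f) = (norm f)\<^sup>2"
  proof (rule antisym)
    show "norm (star f * f) \<le> (norm f)\<^sup>2"
      by (rule norm_weyl_leI)
        (simp add: cstar_seminormD(4) cstar_seminormD(7) cstar_seminorm_le_norm power_mono)
    have "norm f \<le> sqrt (norm (star f * f))"
      by (rule norm_weyl_leI)
        (metis cstar_seminormD(4) cstar_seminorm_le_norm real_le_rsqrt)
    then show "(norm f)\<^sup>2 \<le> norm (star f * f)"
      by (simp add: norm_weyl_nonneg real_le_rsqrt sqrt_ge_absD)
  qed
qed

instance
proof
  fix f g :: "'a weyl" and c :: complex and r :: real
  note N = cstar_seminormD[OF cstar_seminorm_norm_weyl]
  have "wl2 f \<le> norm f"
    using cstar_seminorm_le_norm[OF cstar_seminorm_regular] wl2_le_regular_norm by (rule order.trans[rotated])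
  then show "norm f = 0 \<longleftrightarrow> f = 0"
    using wl2_eq_0_iff[of f] wl2_nonneg[of f] N(5) by (metis order.antisym)
  show "norm (f + g) \<le> norm f + norm g" "norm (f * g) \<le> norm f * norm g"
    "norm (c *\<^sub>C f) = cmod c * norm f" "norm (star f * f) = (norm f)\<^sup>2"
    by (fact N)+
  show "norm (r *\<^sub>R f) = \<bar>r\<bar> * norm f"
    by (simp add: scaleR_scaleC N(2))
  have "norm (1 :: 'a weyl) \<ge> 1"
    using cstar_seminorm_le_norm[OF cstar_seminorm_regular, of 1] wl2_le_regular_norm[of 1]
    by (metis order.trans wl2_one)
  moreover have "norm (1 :: 'a weyl) \<le> 1"
    using cstar_seminorm_gen_le[OF cstar_seminorm_norm_weyl, of 0] by (simp add: weyl_gen_zero)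
  ultimately show "norm (1 :: 'a weyl) = 1" by simp
qed (simp_all add: dist_weyl_def sgn_weyl_def uniformity_weyl_def open_weyl_def)

end


section \<open>Completion of a pre-C*-algebra\<close>

definition completion_rel :: "(nat \<Rightarrow> 'a::real_normed_vector) \<Rightarrow> (nat \<Rightarrow> 'a) \<Rightarrow> bool" where
  "completion_rel X Y \<longleftrightarrow> Cauchy X \<and> Cauchy Y \<and> (\<lambda>n. X n - Y n) \<longlonglongrightarrow> 0"

lemma Cauchy_const [simp]: "Cauchy (\<lambda>_. c :: 'a::real_normed_vector)"
  by (rule convergent_Cauchy[OF convergent_const])

lemma part_equivp_completion_rel:
  "part_equivp (completion_rel :: (nat \<Rightarrow> 'a::real_normed_vector) \<Rightarrow> (nat \<Rightarrow> 'a) \<Rightarrow> bool)"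
proof (rule part_equivpI)
  show "\<exists>X :: nat \<Rightarrow> 'a. completion_rel X X"
    by (rule exI[of _ "\<lambda>_. 0"]) (simp add: completion_rel_def)
  show "symp (completion_rel :: (nat \<Rightarrow> 'a) \<Rightarrow> (nat \<Rightarrow> 'a) \<Rightarrow> bool)"
  proof (rule sympI)
    fix X Y :: "nat \<Rightarrow> 'a"
    assume "completion_rel X Y"
    then show "completion_rel Y X"
      using tendsto_minus[of "\<lambda>n. X n - Y n" 0 sequentially] by (simp add: completion_rel_def)
  qed
  show "transp (completion_rel :: (nat \<Rightarrow> 'a) \<Rightarrow> (nat \<Rightarrow> 'a) \<Rightarrow> bool)"
  proof (rule transpI)
    fix X Y Z :: "nat \<Rightarrow> 'a"
    assume "completion_rel X Y" "completion_rel Y Z"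
    then show "completion_rel X Z"
      using tendsto_add[of "\<lambda>n. X n - Y n" 0 sequentially "\<lambda>n. Y n - Z n" 0]
      by (simp add: completion_rel_def)
  qed
qed

quotient_type (overloaded) 'a cstar_completion = "nat \<Rightarrow> 'a::pre_cstar_algebra_1" / partial: completion_rel
  by (rule part_equivp_completion_rel)

lemma completion_rel_refl: "Cauchy X \<Longrightarrow> completion_rel X X"
  by (simp add: completion_rel_def)

lemma Cauchy_dominated:
  assumes "Cauchy X" "Cauchy Y" "0 \<le> K" "0 \<le> L"
    and "\<And>m n. norm (Z m - Z n) \<le> K * norm (X m - X n) + L * norm (Y m - Y n)"
  shows "Cauchy Z"
proof (rule CauchyI)
  fix e :: real assume e: "0 < e"
  define d where "d = e / (2 * (K + L + 1))"
  have d: "0 < d" using e assms by (simp add: d_def)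
  obtain M where M: "\<And>m n. M \<le> m \<Longrightarrow> M \<le> n \<Longrightarrow> norm (X m - X n) < d"
    using CauchyD[OF assms(1) d] by blast
  obtain N where N: "\<And>m n. N \<le> m \<Longrightarrow> N \<le> n \<Longrightarrow> norm (Y m - Y n) < d"
    using CauchyD[OF assms(2) d] by blast
  have "norm (Z m - Z n) < e" if mn: "max M N \<le> m" "max M N \<le> n" for m n
  proof -
    have "norm (Z m - Z n) \<le> K * d + L * d"
      using M[of m n] N[of m n] mn assms(3,4)
      by (intro order.trans[OF assms(5)] add_mono mult_left_mono) auto
    also have "\<dots> \<le> (K + L + 1) * d" using d by (simp add: algebra_simps)
    also have "\<dots> = e / 2" using assms(3,4) by (simp add: d_def field_simps)
    also have "\<dots> < e" using e by simp
    finally show ?thesis .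
  qed
  then show "\<exists>M. \<forall>m\<ge>M. \<forall>n\<ge>M. norm (Z m - Z n) < e" by blast
qed

lemma Cauchy_add':
  "Cauchy X \<Longrightarrow> Cauchy Y \<Longrightarrow> Cauchy (\<lambda>n. X n + Y n :: 'a::real_normed_vector)"
  by (rule Cauchy_dominated[of X Y 1 1])
    (simp_all add: add_diff_add norm_triangle_ineq)

lemma Cauchy_minus': "Cauchy X \<Longrightarrow> Cauchy (\<lambda>n. - X n :: 'a::real_normed_vector)"
  by (rule bounded_linear.Cauchy[OF bounded_linear_minus[OF bounded_linear_ident]])

lemma Cauchy_diff':
  "Cauchy X \<Longrightarrow> Cauchy Y \<Longrightarrow> Cauchy (\<lambda>n. X n - Y n :: 'a::real_normed_vector)"
  using Cauchy_add'[OF _ Cauchy_minus'] by auto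

lemma Cauchy_mult':
  fixes X Y :: "nat \<Rightarrow> 'a::real_normed_algebra"
  assumes "Cauchy X" "Cauchy Y"
  shows "Cauchy (\<lambda>n. X n * Y n)"
proof -
  obtain K where K: "0 < K" "\<And>n. norm (X n) \<le> K"
    using Cauchy_Bseq[OF assms(1)] by (auto simp: Bseq_def)
  obtain L where L: "0 < L" "\<And>n. norm (Y n) \<le> L"
    using Cauchy_Bseq[OF assms(2)] by (auto simp: Bseq_def)
  show ?thesis
  proof (rule Cauchy_dominated[OF assms])
    show "0 \<le> L" "0 \<le> K" using K L by simp_all
    fix m n
    have "X m * Y m - X n * Y n = (X m - X n) * Y m + X n * (Y m - Y n)"
      by (simp add: algebra_simps)
    then have "norm (X m * Y m - X n * Y n)
        \<le> norm (X m - X n) * norm (Y m) + norm (X n) * norm (Y m - Y n)"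
      by (metis norm_triangle_mono norm_mult_ineq)
    also have "\<dots> \<le> L * norm (X m - X n) + K * norm (Y m - Y n)"
      using K(2)[of n] L(2)[of m]
      by (intro add_mono) (simp_all add: mult.commute mult_left_mono mult_right_mono)
    finally show "norm (X m * Y m - X n * Y n) \<le> L * norm (X m - X n) + K * norm (Y m - Y n)" .
  qed
qed

lemma bounded_linear_scaleC: "bounded_linear (\<lambda>x. c *\<^sub>C x :: 'a::complex_normed_vector)"
  by (rule bounded_linear_intro[of _ "cmod c"])
    (simp_all add: scaleC_add_right scaleR_scaleC scaleC_scaleC norm_scaleC mult.commute)

lemma norm_star [simp]: "norm (star x) = norm (x :: 'a::pre_cstar_algebra)"
proof -
  have le: "norm x \<le> norm (star x)" for x :: 'a
  proof (cases "norm x = 0")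
    case False
    have "norm x * norm x \<le> norm (star x) * norm x"
      using norm_mult_ineq[of "star x" x] by (simp add: cstar_identity power2_eq_square)
    then show ?thesis using False by simp
  qed simp
  show ?thesis
    using le[of x] le[of "star x"] by (simp add: star_star)
qed

lemma bounded_linear_star: "bounded_linear (star :: 'a::pre_cstar_algebra \<Rightarrow> 'a)"
  by (rule bounded_linear_intro[of _ 1]) (simp_all add: star_add scaleR_scaleC star_scaleC)

lemma completion_rel_map:
  assumes "bounded_linear f" "completion_rel X Y"
  shows "completion_rel (\<lambda>n. f (X n)) (\<lambda>n. f (Y n))"
  using assms bounded_linear.tendsto[OF assms(1), of "\<lambda>n. X n - Y n" 0]
  by (simp add: completion_rel_def bounded_linear.Cauchy linear_simps)

lemma completion_rel_add:
  "completion_rel X X' \<Longrightarrow> completion_rel Y Y' \<Longrightarrow>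
    completion_rel (\<lambda>n. X n + Y n) (\<lambda>n. X' n + Y' n)"
  using tendsto_add[of "\<lambda>n. X n - X' n" 0 sequentially "\<lambda>n. Y n - Y' n" 0]
  by (simp add: completion_rel_def Cauchy_add' add_diff_add)

lemma completion_rel_mult:
  fixes X :: "nat \<Rightarrow> 'a::real_normed_algebra"
  assumes "completion_rel X X'" "completion_rel Y Y'"
  shows "completion_rel (\<lambda>n. X n * Y n) (\<lambda>n. X' n * Y' n)"
proof -
  have *: "Cauchy X" "Cauchy X'" "Cauchy Y" "Cauchy Y'"
    "(\<lambda>n. X n - X' n) \<longlonglongrightarrow> 0" "(\<lambda>n. Y n - Y' n) \<longlonglongrightarrow> 0"
    using assms by (simp_all add: completion_rel_def)
  have "(\<lambda>n. (X n - X' n) * Y n + X' n * (Y n - Y' n)) \<longlonglongrightarrow> 0"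
    using *(5,6) Cauchy_Bseq[OF *(2)] Cauchy_Bseq[OF *(3)]
    by (intro tendsto_add_zero)
      (simp_all add: tendsto_Zfun_iff Bfun_def bounded_bilinear.Zfun_prod_Bfun[OF bounded_bilinear_mult]
        bounded_bilinear.Bfun_prod_Zfun[OF bounded_bilinear_mult])
  then show ?thesis
    using * by (simp add: completion_rel_def Cauchy_mult' algebra_simps)
qed

lemma completion_norm_convergent: "Cauchy X \<Longrightarrow> convergent (\<lambda>n. norm (X n :: 'a::real_normed_vector))"
  by (intro real_Cauchy_convergent Cauchy_dominated[of X X 1 0 "\<lambda>n. norm (X n)"])
    (simp_all add: norm_triangle_ineq3)

instantiation cstar_completion :: (pre_cstar_algebra_1) "{star_algebra, ring_1}"
begin

lift_definition zero_cstar_completion :: "'a cstar_completion" is "\<lambda>_. 0"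
  by (simp add: completion_rel_refl)
lift_definition one_cstar_completion :: "'a cstar_completion" is "\<lambda>_. 1"
  by (simp add: completion_rel_refl)
lift_definition plus_cstar_completion :: "'a cstar_completion \<Rightarrow> 'a cstar_completion \<Rightarrow> 'a cstar_completion"
  is "\<lambda>X Y n. X n + Y n" by (rule completion_rel_add)
lift_definition uminus_cstar_completion :: "'a cstar_completion \<Rightarrow> 'a cstar_completion"
  is "\<lambda>X n. - X n" by (rule completion_rel_map[OF bounded_linear_minus[OF bounded_linear_ident]])
lift_definition times_cstar_completion :: "'a cstar_completion \<Rightarrow> 'a cstar_completion \<Rightarrow> 'a cstar_completion"
  is "\<lambda>X Y n. X n * Y n" by (rule completion_rel_mult)
lift_definition scaleC_cstar_completion :: "complex \<Rightarrow> 'a cstar_completion \<Rightarrow> 'a cstar_completion"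
  is "\<lambda>c X n. c *\<^sub>C X n" by (rule completion_rel_map[OF bounded_linear_scaleC])
lift_definition star_cstar_completion :: "'a cstar_completion \<Rightarrow> 'a cstar_completion"
  is "\<lambda>X n. star (X n)" by (rule completion_rel_map[OF bounded_linear_star])
definition minus_cstar_completion :: "'a cstar_completion \<Rightarrow> 'a cstar_completion \<Rightarrow> 'a cstar_completion" where
  "minus_cstar_completion x y = x + - y"
definition scaleR_cstar_completion :: "real \<Rightarrow> 'a cstar_completion \<Rightarrow> 'a cstar_completion" where
  "scaleR_cstar_completion r x = complex_of_real r *\<^sub>C x"

lemma completion_rel_eqI: "Cauchy X \<Longrightarrow> (\<And>n. X n = Y n) \<Longrightarrow> completion_rel X Y"
proof -
  assume "Cauchy X" "\<And>n. X n = Y n"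
  then have "X = Y" "Cauchy X" by (simp_all add: fun_eq_iff)
  then show ?thesis by (simp add: completion_rel_refl)
qed

lemmas completion_Cauchy_intros =
  Cauchy_add' Cauchy_minus' Cauchy_mult' Cauchy_const
  bounded_linear.Cauchy[OF bounded_linear_scaleC] bounded_linear.Cauchy[OF bounded_linear_star]

instance
proof
  fix x y z :: "'a cstar_completion" and c d :: complex and r s :: real
  have D: "completion_rel X X \<Longrightarrow> Cauchy X" for X :: "nat \<Rightarrow> 'a"
    by (simp add: completion_rel_def)
  show "x + y + z = x + (y + z)" "x + y = y + x" "0 + x = x"
    "x * y * z = x * (y * z)" "1 * x = x" "x * 1 = x"
    "(x + y) * z = x * z + y * z" "x * (y + z) = x * y + x * z"
    by (transfer, rule completion_rel_eqI; auto dest!: D intro!: completion_Cauchy_intros simp: algebra_simps)+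
  show "- x + x = 0" "x - y = x + - y"
    by (simp_all add: minus_cstar_completion_def)
       (transfer, rule completion_rel_eqI; auto dest!: D intro!: completion_Cauchy_intros simp: algebra_simps)
  show "(0 :: 'a cstar_completion) \<noteq> 1"
    by transfer (simp add: completion_rel_def tendsto_const_iff)
  have scale: "c *\<^sub>C (x + y) = c *\<^sub>C x + c *\<^sub>C y" "(c + d) *\<^sub>C x = c *\<^sub>C x + d *\<^sub>C x"
    "c *\<^sub>C d *\<^sub>C x = (c * d) *\<^sub>C x" "1 *\<^sub>C x = x"
    "(c *\<^sub>C x) * y = c *\<^sub>C (x * y)" "x * (c *\<^sub>C y) = c *\<^sub>C (x * y)"
    for c d and x y :: "'a cstar_completion"
    by (transfer, rule completion_rel_eqI;
        auto dest!: D intro!: completion_Cauchy_intros simp: scaleC_add_right scaleC_add_left scaleC_scaleC scaleC_simps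
          mult_scaleC_left mult_scaleC_right)+
  show "c *\<^sub>C (x + y) = c *\<^sub>C x + c *\<^sub>C y" "(c + d) *\<^sub>C x = c *\<^sub>C x + d *\<^sub>C x"
    "c *\<^sub>C d *\<^sub>C x = (c * d) *\<^sub>C x"
    "(c *\<^sub>C x) * y = c *\<^sub>C (x * y)" "x * (c *\<^sub>C y) = c *\<^sub>C (x * y)"
    by (fact scale)+
  show "r *\<^sub>R (x + y) = r *\<^sub>R x + r *\<^sub>R y" "(r + s) *\<^sub>R x = r *\<^sub>R x + s *\<^sub>R x"
    "r *\<^sub>R s *\<^sub>R x = (r * s) *\<^sub>R x" "1 *\<^sub>R x = x" "r *\<^sub>R x = complex_of_real r *\<^sub>C x"
    "(r *\<^sub>R x) * y = r *\<^sub>R (x * y)" "x * (r *\<^sub>R y) = r *\<^sub>R (x * y)"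
    by (simp_all add: scaleR_cstar_completion_def scale)
  show "star (x + y) = star x + star y" "star (c *\<^sub>C x) = cnj c *\<^sub>C star x"
    "star (x * y) = star y * star x" "star (star x) = x"
    by (transfer, rule completion_rel_eqI;
        auto dest!: D intro!: completion_Cauchy_intros simp: star_add star_scaleC star_mult star_star)+
qed

end

lemma LIMSEQ_norm_eq:
  fixes X Y :: "nat \<Rightarrow> 'a::real_normed_vector"
  assumes "completion_rel X Y"
  shows "lim (\<lambda>n. norm (X n)) = lim (\<lambda>n. norm (Y n))"
proof -
  have X: "(\<lambda>n. norm (X n)) \<longlonglongrightarrow> lim (\<lambda>n. norm (X n))"
    and Y: "(\<lambda>n. norm (Y n)) \<longlonglongrightarrow> lim (\<lambda>n. norm (Y n))"
    using assms by (auto simp: completion_rel_def convergent_LIMSEQ_iff[symmetric]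
        intro!: completion_norm_convergent)
  have "(\<lambda>n. norm (X n - Y n)) \<longlonglongrightarrow> 0"
    using assms tendsto_norm_zero by (auto simp: completion_rel_def)
  then have "(\<lambda>n. norm (X n) - norm (Y n)) \<longlonglongrightarrow> 0"
    by (rule Lim_null_comparison[rotated]) (simp add: norm_triangle_ineq3)
  moreover have "(\<lambda>n. norm (X n) - norm (Y n)) \<longlonglongrightarrow> lim (\<lambda>n. norm (X n)) - lim (\<lambda>n. norm (Y n))"
    by (rule tendsto_diff[OF X Y])
  ultimately show ?thesis using LIMSEQ_unique by fastforce
qed

instantiation cstar_completion :: (pre_cstar_algebra_1) pre_cstar_algebra_1
begin

lift_definition norm_cstar_completion :: "'a cstar_completion \<Rightarrow> real"
  is "\<lambda>X. lim (\<lambda>n. norm (X n))" by (rule LIMSEQ_norm_eq)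
definition dist_cstar_completion :: "'a cstar_completion \<Rightarrow> 'a cstar_completion \<Rightarrow> real" where
  "dist_cstar_completion x y = norm (x - y)"
definition sgn_cstar_completion :: "'a cstar_completion \<Rightarrow> 'a cstar_completion" where
  "sgn_cstar_completion x = x /\<^sub>R norm x"
definition uniformity_cstar_completion :: "('a cstar_completion \<times> 'a cstar_completion) filter" where
  "uniformity_cstar_completion = (INF e\<in>{0<..}. principal {(x, y). dist x y < e})"
definition open_cstar_completion :: "'a cstar_completion set \<Rightarrow> bool" where
  "open_cstar_completion U \<longleftrightarrow> (\<forall>x\<in>U. eventually (\<lambda>(x', y). x' = x \<longrightarrow> y \<in> U) uniformity)"

lemma completion_norm_lim:
  assumes "completion_rel X X"
  shows "(\<lambda>n. norm (X n :: 'a)) \<longlonglongrightarrow> lim (\<lambda>n. norm (X n))"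
  using assms by (auto simp: completion_rel_def convergent_LIMSEQ_iff[symmetric]
      intro!: completion_norm_convergent)

instance
proof
  fix x y :: "'a cstar_completion" and c :: complex and r :: real
  show "norm x = 0 \<longleftrightarrow> x = 0"
  proof transfer
    fix X :: "nat \<Rightarrow> 'a" assume X: "completion_rel X X"
    show "lim (\<lambda>n. norm (X n)) = 0 \<longleftrightarrow> completion_rel X (\<lambda>_. 0)"
    proof
      assume "lim (\<lambda>n. norm (X n)) = 0"
      then have "(\<lambda>n. norm (X n)) \<longlonglongrightarrow> 0" using completion_norm_lim[OF X] by simp
      then show "completion_rel X (\<lambda>_. 0)"
        using X by (simp add: completion_rel_def tendsto_norm_zero_iff)
    next
      assume "completion_rel X (\<lambda>_. 0)"
      then show "lim (\<lambda>n. norm (X n)) = 0" using LIMSEQ_norm_eq by fastforce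
    qed
  qed
  show "norm (x + y) \<le> norm x + norm y"
  proof transfer
    fix X Y :: "nat \<Rightarrow> 'a" assume *: "completion_rel X X" "completion_rel Y Y"
    show "lim (\<lambda>n. norm (X n + Y n)) \<le> lim (\<lambda>n. norm (X n)) + lim (\<lambda>n. norm (Y n))"
      by (rule LIMSEQ_le[OF completion_norm_lim[OF completion_rel_add[OF *]]
            tendsto_add[OF completion_norm_lim[OF *(1)] completion_norm_lim[OF *(2)]]])
        (simp add: norm_triangle_ineq)
  qed
  show "norm (x * y) \<le> norm x * norm y"
  proof transfer
    fix X Y :: "nat \<Rightarrow> 'a" assume *: "completion_rel X X" "completion_rel Y Y"
    show "lim (\<lambda>n. norm (X n * Y n)) \<le> lim (\<lambda>n. norm (X n)) * lim (\<lambda>n. norm (Y n))"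
      by (rule LIMSEQ_le[OF completion_norm_lim[OF completion_rel_mult[OF *]]
            tendsto_mult[OF completion_norm_lim[OF *(1)] completion_norm_lim[OF *(2)]]])
        (simp add: norm_mult_ineq)
  qed
  have C: "norm (c *\<^sub>C x) = cmod c * norm x" for c and x :: "'a cstar_completion"
  proof transfer
    fix c and X :: "nat \<Rightarrow> 'a" assume *: "completion_rel X X"
    show "lim (\<lambda>n. norm (c *\<^sub>C X n)) = cmod c * lim (\<lambda>n. norm (X n))"
      using tendsto_mult_left[OF completion_norm_lim[OF *], of "cmod c"]
      by (simp add: norm_scaleC limI)
  qed
  show "norm (c *\<^sub>C x) = cmod c * norm x" by (fact C)
  show "norm (r *\<^sub>R x) = \<bar>r\<bar> * norm x" by (simp add: scaleR_scaleC C)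
  show "norm (star x * x) = (norm x)\<^sup>2"
  proof transfer
    fix X :: "nat \<Rightarrow> 'a" assume *: "completion_rel X X"
    show "lim (\<lambda>n. norm (star (X n) * X n)) = (lim (\<lambda>n. norm (X n)))\<^sup>2"
      using tendsto_power[OF completion_norm_lim[OF *], of 2]
      by (simp add: cstar_identity limI)
  qed
  show "norm (1 :: 'a cstar_completion) = 1"
    by transfer (simp add: limI)
qed (simp_all add: dist_cstar_completion_def sgn_cstar_completion_def
    uniformity_cstar_completion_def open_cstar_completion_def)

end

lift_definition completion_embed :: "'a::pre_cstar_algebra_1 \<Rightarrow> 'a cstar_completion" is "\<lambda>x _. x"
  by (simp add: completion_rel_refl)

lemma completion_embed_simps:
  "completion_embed (x + y) = completion_embed x + completion_embed y"
  "completion_embed (c *\<^sub>C x) = c *\<^sub>C completion_embed x"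
  "completion_embed (x * y) = completion_embed x * completion_embed y"
  "completion_embed (star x) = star (completion_embed x)"
  "completion_embed 1 = 1" "completion_embed 0 = 0"
  by (transfer, simp add: completion_rel_refl)+

lemma norm_completion_embed [simp]: "norm (completion_embed x) = norm x"
  by transfer (simp add: limI)

lemma completion_embed_diff: "completion_embed (x - y) = completion_embed x - completion_embed y"
  by (metis add_diff_cancel_right' completion_embed_simps(1) diff_add_cancel)

lemma completion_embed_LIMSEQ:
  assumes "Cauchy X"
  shows "(\<lambda>n. completion_embed (X n)) \<longlonglongrightarrow> abs_cstar_completion X"
proof (rule LIMSEQ_I)
  fix e :: real assume e: "0 < e"
  then obtain M where M: "\<And>m n. M \<le> m \<Longrightarrow> M \<le> n \<Longrightarrow> norm (X m - X n) < e / 2"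
    using CauchyD[OF assms, of "e / 2"] by auto
  have "norm (completion_embed (X m) - abs_cstar_completion X) < e" if "M \<le> m" for m
  proof -
    have R: "completion_rel X X" "completion_rel (\<lambda>_. X m) (\<lambda>_. X m)"
      using assms by (simp_all add: completion_rel_refl)
    have R': "completion_rel (\<lambda>n. X m + - X n) (\<lambda>n. X m + - X n)"
      using assms by (intro completion_rel_refl completion_Cauchy_intros)
    have "completion_embed (X m) - abs_cstar_completion X = abs_cstar_completion (\<lambda>n. X m + - X n)"
      unfolding minus_cstar_completion_def completion_embed.abs_eq
      using R by (simp add: uminus_cstar_completion.abs_eq plus_cstar_completion.abs_eq
          completion_rel_map[OF bounded_linear_minus[OF bounded_linear_ident]])
    then have "norm (completion_embed (X m) - abs_cstar_completion X) = lim (\<lambda>n. norm (X m + - X n))"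
      using R' by (simp add: norm_cstar_completion.abs_eq)
    also have "\<dots> \<le> e / 2"
      using M[OF that] by (intro LIMSEQ_le_const2[OF completion_norm_lim[OF R']]) (auto intro!: exI[of _ M] less_imp_le)
    finally show ?thesis using e by simp
  qed
  then show "\<exists>no. \<forall>n\<ge>no. norm (completion_embed (X n) - abs_cstar_completion X) < e" by blast
qed

lemma completion_cases:
  obtains X where "Cauchy X" "(\<lambda>n. completion_embed (X n)) \<longlonglongrightarrow> x"
proof -
  obtain X where "completion_rel X X" "x = abs_cstar_completion X"
    by (metis Quotient_cstar_completion Quotient_abs_rep Quotient_rep_reflp)
  then show ?thesis
    using that[of X] completion_embed_LIMSEQ[of X] by (simp add: completion_rel_def)
qed

instance cstar_completion :: (pre_cstar_algebra_1) cstar_algebra_1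
proof
  fix Z :: "nat \<Rightarrow> 'a cstar_completion"
  assume Z: "Cauchy Z"
  have "\<exists>x. norm (completion_embed x - Z k) < inverse (real (Suc k))" for k
  proof -
    obtain X where "(\<lambda>n. completion_embed (X n)) \<longlonglongrightarrow> Z k" by (rule completion_cases)
    from LIMSEQ_D[OF this, of "inverse (real (Suc k))"] show ?thesis by auto
  qed
  then obtain x where x: "\<And>k. norm (completion_embed (x k) - Z k) < inverse (real (Suc k))"
    by metis
  have diff: "(\<lambda>k. completion_embed (x k) - Z k) \<longlonglongrightarrow> 0"
    by (rule Lim_null_comparison[OF _ LIMSEQ_inverse_real_of_nat])
      (use x in \<open>auto intro!: always_eventually less_imp_le\<close>)
  have "Cauchy (\<lambda>k. (completion_embed (x k) - Z k) + Z k)"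
    by (rule Cauchy_add'[OF LIMSEQ_imp_Cauchy[OF diff] Z])
  then have "Cauchy (\<lambda>k. completion_embed (x k))" by simp
  then have "Cauchy x"
    by (simp add: Cauchy_iff completion_embed_diff[symmetric])
  from tendsto_diff[OF completion_embed_LIMSEQ[OF this] diff]
  show "convergent Z" by (auto simp: convergent_def)
qed


section \<open>The CCR algebra\<close>

text \<open>
  The universal C*-algebra of the Weyl relations, as the completion of the *-algebra they define in
  its largest C*-seminorm; \<open>ccr_universal\<close> is its universal property.
\<close>

type_synonym 'h ccr = "'h weyl cstar_completion"

definition ccr_W :: "'h::complex_inner \<Rightarrow> 'h ccr" where
  "ccr_W x = completion_embed (weyl_gen x)"

lemma star_ccr_W: "star (ccr_W x) = ccr_W (- x)"
  by (simp add: ccr_W_def completion_embed_simps(4)[symmetric] weyl_star_simps)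

lemma ccr_W_mult: "ccr_W x * ccr_W y = cis (symp_form x y) *\<^sub>C ccr_W (x + y)"
  by (simp add: ccr_W_def completion_embed_simps(2,3)[symmetric] weyl_gen_mult)

lemma ccr_W_zero: "ccr_W 0 = 1"
  by (simp add: ccr_W_def weyl_gen_zero completion_embed_simps)

lemma completion_embed_weyl:
  "completion_embed f = (\<Sum>x\<in>wsupp f. wcoeff f x *\<^sub>C ccr_W x)"
proof -
  have "completion_embed (sum F A) = (\<Sum>x\<in>A. completion_embed (F x))"
    for F :: "'a \<Rightarrow> 'a weyl" and A
    by (induction A rule: infinite_finite_induct) (simp_all add: completion_embed_simps)
  then show ?thesis
    by (subst weyl_expand[of f]) (simp add: completion_embed_simps ccr_W_def)
qed

lemma closure_cspan_ccr_W: "closure (cspan (range ccr_W)) = UNIV"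
proof -
  have "x \<in> closure (cspan (range ccr_W))" for x :: "'a ccr"
  proof -
    obtain X where "(\<lambda>n. completion_embed (X n)) \<longlonglongrightarrow> x" by (rule completion_cases)
    moreover have "completion_embed f \<in> cspan (range ccr_W)" for f :: "'a weyl"
      unfolding completion_embed_weyl
      by (intro complex_vector.span_sum complex_vector.span_scale complex_vector.span_base) auto
    ultimately show ?thesis
      unfolding closure_sequential by (intro exI[of _ "\<lambda>n. completion_embed (X n)"]) simp
  qed
  then show ?thesis by blast
qed

lemma ccr_map_eqI:
  fixes f g :: "'h::complex_inner ccr \<Rightarrow> 'b::complex_normed_vector"
  assumes "clinear f" "bounded_linear f" "clinear g" "bounded_linear g"
    and "\<And>x. f (ccr_W x) = g (ccr_W x)"
  shows "f = g"
proof
  fix a :: "'h ccr"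
  have *: "f (completion_embed h) = g (completion_embed h)" for h
    unfolding completion_embed_weyl
    by (simp add: linear_sum clinear_imp_linear assms(1,3,5) clinear_scaleC)
  obtain X where X: "(\<lambda>n. completion_embed (X n)) \<longlonglongrightarrow> a" by (rule completion_cases)
  from bounded_linear.tendsto[OF assms(2) X] bounded_linear.tendsto[OF assms(4) X]
  show "f a = g a" using LIMSEQ_unique by (simp add: *) blast
qed

theorem ccr_universal:
  fixes V :: "'h::complex_inner \<Rightarrow> 'b::cstar_algebra"
  assumes star_V: "\<And>x. star (V x) = V (- x)"
    and V_mult: "\<And>x y. V x * V y = cis (symp_form x y) *\<^sub>C V (x + y)"
  shows "\<exists>!\<pi>. star_hom \<pi> \<and> (\<forall>x. \<pi> (ccr_W x) = V x)"
proof (rule ex_ex1I)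
  let ?L = "wlift V"
  have L_mult: "?L (f * g) = ?L f * ?L g" for f g
  proof (induction f rule: weyl_induct)
    case (gen x)
    show ?case
    proof (induction g rule: weyl_induct)
      case (gen y)
      show ?case by (simp add: weyl_gen_mult V_mult)
    qed (simp_all add: weyl_mult_bilin mult_scaleC_right distrib_left wlift_def[of _ 0] wsupp_def)
  qed (simp_all add: weyl_mult_bilin mult_scaleC_left distrib_right wlift_def[of _ 0] wsupp_def)
  have L_star: "?L (star f) = star (?L f)" for f
    by (induction f rule: weyl_induct)
      (simp_all add: weyl_star_simps star_add star_scaleC star_V wlift_def[of _ 0] wsupp_def)
  have "cstar_seminorm (\<lambda>f. norm (?L f))"
    by (simp add: cstar_seminorm_def norm_triangle_ineq norm_scaleC L_mult norm_mult_ineq L_star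
        cstar_identity)
  then have L_le: "norm (?L f) \<le> norm f" for f
    by (rule cstar_seminorm_le_norm)
  have L_diff: "?L (f - g) = ?L f - ?L g" for f g
    using wlift_add[of V "f - g" g] by simp
  have "\<exists>b. \<forall>X. (\<lambda>n. completion_embed (X n)) \<longlonglongrightarrow> a \<longrightarrow> (\<lambda>n. ?L (X n)) \<longlonglongrightarrow> b" for a
  proof -
    obtain Y where Y: "Cauchy Y" "(\<lambda>n. completion_embed (Y n)) \<longlonglongrightarrow> a" by (rule completion_cases)
    have "Cauchy (\<lambda>n. ?L (Y n))"
      by (rule Cauchy_dominated[of Y Y 1 0]) (simp_all add: Y L_diff[symmetric] L_le)
    then obtain b where b: "(\<lambda>n. ?L (Y n)) \<longlonglongrightarrow> b"
      using Cauchy_convergent convergent_def by blast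
    have "(\<lambda>n. ?L (X n)) \<longlonglongrightarrow> b" if X: "(\<lambda>n. completion_embed (X n)) \<longlonglongrightarrow> a" for X
    proof -
      have "(\<lambda>n. completion_embed (X n) - completion_embed (Y n)) \<longlonglongrightarrow> 0"
        using tendsto_diff[OF X Y(2)] by simp
      then have "(\<lambda>n. norm (X n - Y n)) \<longlonglongrightarrow> 0"
        by (simp add: completion_embed_diff[symmetric] tendsto_norm_zero_iff[symmetric,
              where f = "\<lambda>n. completion_embed (X n - Y n)"])
      then have "(\<lambda>n. ?L (X n) - ?L (Y n)) \<longlonglongrightarrow> 0"
        by (rule Lim_null_comparison[rotated]) (simp add: L_diff[symmetric] L_le)
      from tendsto_add[OF this b] show ?thesis by simp
    qed
    then show ?thesis by blast
  qed
  then obtain \<pi> where \<pi>: "\<And>a X. (\<lambda>n. completion_embed (X n)) \<longlonglongrightarrow> a \<Longrightarrow> (\<lambda>n. ?L (X n)) \<longlonglongrightarrow> \<pi> a"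
    by metis
  have \<pi>_embed: "\<pi> (completion_embed f) = ?L f" for f
    using \<pi>[of "\<lambda>_. f" "completion_embed f"] by (simp add: tendsto_const_iff)
  have ex: "\<exists>X. (\<lambda>n. completion_embed (X n)) \<longlonglongrightarrow> a" for a :: "'h ccr"
    by (metis completion_cases)
  have add: "\<pi> (a + b) = \<pi> a + \<pi> b" and mult: "\<pi> (a * b) = \<pi> a * \<pi> b" for a b
  proof -
    obtain X Y where X: "(\<lambda>n. completion_embed (X n)) \<longlonglongrightarrow> a"
      and Y: "(\<lambda>n. completion_embed (Y n)) \<longlonglongrightarrow> b" using ex by metis
    have "(\<lambda>n. completion_embed (X n + Y n)) \<longlonglongrightarrow> a + b"
      using tendsto_add[OF X Y] by (simp add: completion_embed_simps)
    from \<pi>[OF this] tendsto_add[OF \<pi>[OF X] \<pi>[OF Y]]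
    show "\<pi> (a + b) = \<pi> a + \<pi> b" by (simp add: LIMSEQ_unique)
    have "(\<lambda>n. completion_embed (X n * Y n)) \<longlonglongrightarrow> a * b"
      using tendsto_mult[OF X Y] by (simp add: completion_embed_simps)
    from \<pi>[OF this] tendsto_mult[OF \<pi>[OF X] \<pi>[OF Y]]
    show "\<pi> (a * b) = \<pi> a * \<pi> b" by (simp add: LIMSEQ_unique L_mult)
  qed
  have scale: "\<pi> (c *\<^sub>C a) = c *\<^sub>C \<pi> a" and star: "\<pi> (star a) = star (\<pi> a)"
    and le: "norm (\<pi> a) \<le> norm a" for a c
  proof -
    obtain X where X: "(\<lambda>n. completion_embed (X n)) \<longlonglongrightarrow> a" using ex by metis
    have "(\<lambda>n. completion_embed (c *\<^sub>C X n)) \<longlonglongrightarrow> c *\<^sub>C a"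
      using bounded_linear.tendsto[OF bounded_linear_scaleC X] by (simp add: completion_embed_simps)
    from \<pi>[OF this] bounded_linear.tendsto[OF bounded_linear_scaleC \<pi>[OF X]]
    show "\<pi> (c *\<^sub>C a) = c *\<^sub>C \<pi> a" by (auto intro: LIMSEQ_unique)
    have "(\<lambda>n. completion_embed (star (X n))) \<longlonglongrightarrow> star a"
      using bounded_linear.tendsto[OF bounded_linear_star X] by (simp add: completion_embed_simps)
    from \<pi>[OF this] bounded_linear.tendsto[OF bounded_linear_star \<pi>[OF X]]
    show "\<pi> (star a) = star (\<pi> a)" by (auto intro: LIMSEQ_unique simp: L_star)
    show "norm (\<pi> a) \<le> norm a"
      using tendsto_norm[OF X] by (intro LIMSEQ_le[OF tendsto_norm[OF \<pi>[OF X]]]) (auto simp: L_le)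
  qed
  have "bounded_linear \<pi>"
    by (rule bounded_linear_intro[of _ 1]) (simp_all add: add scaleR_scaleC scale le)
  then have "star_hom \<pi>"
    by (simp add: star_hom_def clinear_def add mult scale star)
  moreover have "\<forall>x. \<pi> (ccr_W x) = V x"
    by (simp add: ccr_W_def \<pi>_embed)
  ultimately show "\<exists>\<pi>. star_hom \<pi> \<and> (\<forall>x. \<pi> (ccr_W x) = V x)" by blast
next
  fix \<pi> \<pi>' :: "'h ccr \<Rightarrow> 'b"
  assume "star_hom \<pi> \<and> (\<forall>x. \<pi> (ccr_W x) = V x)" "star_hom \<pi>' \<and> (\<forall>x. \<pi>' (ccr_W x) = V x)"
  then show "\<pi> = \<pi>'"
    by (intro ccr_map_eqI) (simp_all add: star_hom_def)
qed

definition ccr_rho :: "('h::complex_inner \<Rightarrow> 'h) \<Rightarrow> 'h ccr \<Rightarrow> 'h ccr" where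
  "ccr_rho U = (THE \<rho>. star_hom \<rho> \<and> (\<forall>x. \<rho> (ccr_W x) = ccr_W (U x)))"

lemma ccr_rho:
  assumes "U \<in> unitary_group"
  shows "star_hom (ccr_rho U)" "ccr_rho U (ccr_W x) = ccr_W (U x)"
proof -
  have U: "U (x + y) = U x + U y" "U (- x) = - U x" "symp_form (U x) (U y) = symp_form x y" for x y
    using assms clinear_imp_linear[of U]
    by (simp_all add: unitary_group_def symp_form_def linear_add linear_neg)
  have "\<exists>!\<rho>. star_hom \<rho> \<and> (\<forall>x. \<rho> (ccr_W x) = ccr_W (U x))"
    by (rule ccr_universal) (simp_all add: star_ccr_W ccr_W_mult U)
  from theI'[OF this]
  show "star_hom (ccr_rho U)" "ccr_rho U (ccr_W x) = ccr_W (U x)"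
    by (simp_all add: ccr_rho_def)
qed


section \<open>States and the weak* topology\<close>

text \<open>
  The space of bounded complex-linear functionals, carrying the weak* topology, i.e. the topology
  induced by the product topology on functions.
\<close>

typedef (overloaded) 'a cdual = "{f :: 'a::complex_normed_vector \<Rightarrow> complex. clinear f \<and> bounded_linear f}"
  morphisms cdual_apply Abs_cdual
  by (rule exI[of _ "\<lambda>_. 0"]) (simp add: clinear_def scaleC_complex_def)

setup_lifting type_definition_cdual

lemma cdual_eqI: "(\<And>a. cdual_apply \<omega> a = cdual_apply \<psi> a) \<Longrightarrow> \<omega> = \<psi>"
  by (simp add: cdual_apply_inject[symmetric] fun_eq_iff)

instantiation cdual :: (complex_normed_vector) real_vector
begin

lift_definition zero_cdual :: "'a cdual" is "\<lambda>_. 0"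
  by (simp add: clinear_def scaleC_complex_def)
lift_definition plus_cdual :: "'a cdual \<Rightarrow> 'a cdual \<Rightarrow> 'a cdual" is "\<lambda>f g a. f a + g a"
  by (auto simp: clinear_def scaleC_complex_def algebra_simps intro: bounded_linear_add)
lift_definition uminus_cdual :: "'a cdual \<Rightarrow> 'a cdual" is "\<lambda>f a. - f a"
  by (auto simp: clinear_def scaleC_complex_def intro: bounded_linear_minus)
lift_definition minus_cdual :: "'a cdual \<Rightarrow> 'a cdual \<Rightarrow> 'a cdual" is "\<lambda>f g a. f a - g a"
  by (auto simp: clinear_def scaleC_complex_def algebra_simps intro: bounded_linear_sub)
lift_definition scaleR_cdual :: "real \<Rightarrow> 'a cdual \<Rightarrow> 'a cdual" is "\<lambda>r f a. r *\<^sub>R f a"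
  by (auto simp: clinear_def scaleC_complex_def algebra_simps
      intro: bounded_linear_compose[OF bounded_linear_scaleR_right])

instance
  by standard (transfer, simp add: fun_eq_iff algebra_simps)+

end

instantiation cdual :: (complex_normed_vector) t2_space
begin

definition open_cdual :: "'a cdual set \<Rightarrow> bool" where
  "open_cdual U \<longleftrightarrow> (\<exists>V. open V \<and> U = cdual_apply -` V)"

instance
proof
  show "open (UNIV :: 'a cdual set)"
    unfolding open_cdual_def by (rule exI[of _ UNIV]) simp
  show "open (S \<inter> T)" if "open S" "open T" for S T :: "'a cdual set"
    using that unfolding open_cdual_def by (metis open_Int vimage_Int)
  show "open (\<Union>K)" if "\<forall>S\<in>K. open S" for K :: "'a cdual set set"
  proof -
    from that obtain V where V: "\<And>S. S \<in> K \<Longrightarrow> open (V S) \<and> S = cdual_apply -` V S"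
      unfolding open_cdual_def by metis
    then have "\<Union>K = cdual_apply -` (\<Union>S\<in>K. V S)" by blast
    moreover have "open (\<Union>S\<in>K. V S)" using V by blast
    ultimately show ?thesis unfolding open_cdual_def by blast
  qed
  fix \<omega> \<psi> :: "'a cdual" assume "\<omega> \<noteq> \<psi>"
  then obtain a where "cdual_apply \<omega> a \<noteq> cdual_apply \<psi> a" using cdual_eqI by blast
  then obtain A B where AB: "open A" "open B" "cdual_apply \<omega> a \<in> A" "cdual_apply \<psi> a \<in> B" "A \<inter> B = {}"
    by (metis hausdorff)
  have "open ((\<lambda>\<phi>. cdual_apply \<phi> a) -` S)" if "open S" for S
  proof -
    have "open {f :: 'a \<Rightarrow> complex. f a \<in> S}"
      using product_topology_basis'[of "{a}" "\<lambda>_. S" "\<lambda>x. x"] that by simp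
    moreover have "(\<lambda>\<phi>. cdual_apply \<phi> a) -` S = cdual_apply -` {f. f a \<in> S}" by auto
    ultimately show ?thesis unfolding open_cdual_def by blast
  qed
  then show "\<exists>U V. open U \<and> open V \<and> \<omega> \<in> U \<and> \<psi> \<in> V \<and> U \<inter> V = {}"
    using AB by (intro exI[of _ "(\<lambda>\<phi>. cdual_apply \<phi> a) -` A"] exI[of _ "(\<lambda>\<phi>. cdual_apply \<phi> a) -` B"]) auto
qed

end

text \<open>Boundedness of a state, here part of the type, is automatic.\<close>

definition states :: "'a::cstar_algebra_1 cdual set" where
  "states = {\<omega>. (\<forall>a. cdual_apply \<omega> (star a * a) \<in> \<real>\<^sub>\<ge>\<^sub>0) \<and> cdual_apply \<omega> 1 = 1}"

definition invariant_states :: "'h::complex_inner ccr cdual set" where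
  "invariant_states =
     {\<omega> \<in> states. \<forall>U\<in>unitary_group. cdual_apply \<omega> \<circ> ccr_rho U = cdual_apply \<omega>}"

definition gauss_value :: "ereal \<Rightarrow> 'h::complex_inner \<Rightarrow> complex" where
  "gauss_value s x =
     (if s = \<infinity> then (if x = 0 then 1 else 0)
      else complex_of_real (exp (- (real_of_ereal s * (norm x)\<^sup>2 / 2))))"

definition gauss_state :: "ereal \<Rightarrow> 'h::complex_inner ccr cdual" where
  "gauss_state s =
     (THE \<omega>. \<omega> \<in> states \<and> (\<forall>x. cdual_apply \<omega> (ccr_W x) = gauss_value s x))"

lemma ccr_functional_eqI:
  assumes "\<And>x. cdual_apply \<omega> (ccr_W x) = cdual_apply \<psi> (ccr_W x)"
  shows "\<omega> = \<psi>"
  using ccr_map_eqI[of "cdual_apply \<omega>" "cdual_apply \<psi>"] cdual_apply[of \<omega>] cdual_apply[of \<psi>] assms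
  by (simp add: cdual_apply_inject)


section \<open>Simplices\<close>

text \<open>The vector space \<open>P - P\<close>, ordered by the cone \<open>P\<close>, is a lattice.\<close>

definition lattice_cone :: "'v::real_vector set \<Rightarrow> bool" where
  "lattice_cone P \<longleftrightarrow>
     (let E = {p - q |p q. p \<in> P \<and> q \<in> P}; le = (\<lambda>u v. v - u \<in> P) in
      \<forall>u\<in>E. \<forall>v\<in>E.
        (\<exists>w\<in>E. le u w \<and> le v w \<and> (\<forall>z\<in>E. le u z \<and> le v z \<longrightarrow> le w z)) \<and>
        (\<exists>w\<in>E. le w u \<and> le w v \<and> (\<forall>z\<in>E. le z u \<and> le z v \<longrightarrow> le z w)))"

text \<open>
  The cone over \<open>K\<close> is formed after moving \<open>K\<close> to the hyperplane of height \<open>1\<close>, so that it has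
  \<open>K\<close> as a base.
\<close>

definition choquet_simplex :: "'v::{real_vector,t2_space} set \<Rightarrow> bool" where
  "choquet_simplex K \<longleftrightarrow> compact K \<and> convex K \<and> lattice_cone (cone hull (K \<times> {1::real}))"

definition bauer_simplex :: "'v::{real_vector,t2_space} set \<Rightarrow> bool" where
  "bauer_simplex K \<longleftrightarrow> choquet_simplex K \<and> compact {x. x extreme_point_of K}"

end

theory Submission
  imports Defs "HOL-Real_Asymp.Real_Asymp"
begin

text \<open>
  An invariant state is radial, \<open>\<omega>(W(x)) = f(\<parallel>x\<parallel>\<^sup>2)\<close> with \<open>f\<close> real, because the unitary group is transitive
  on spheres.  Averaging Weyl unitaries over many orthogonal directions turns positivity of \<open>\<omega>\<close> into
  positive definiteness of \<open>f\<close> on the semigroup \<open>[0, \<infinity>)\<close>, and, with one mode left quantum, into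
  \<open>f(t) - 2 sin u f(t + 2u) - f(t + 4u) \<ge> 0\<close>.  With log-convexity this recursion gives \<open>f(t) \<le> exp(-t/2)\<close>,
  so \<open>exp(t/2) f(t)\<close> is bounded and positive definite, hence completely monotone, and the Hausdorff moment
  problem represents it as a mixture of the functions \<open>y powr (t/2)\<close>, \<open>0 \<le> y \<le> 1\<close> (the mass at
  \<open>y = 0\<close> is the weight of the trace, a jump of \<open>f\<close> at 0).  This is the measure, with \<open>s = 1 - ln y\<close>.  Conversely the
  Gaussian kernels are positive because exponentials of Gram kernels are, and a positive functional on the
  Weyl *-algebra is dominated by the universal C*-norm, as its GNS operator norm is a C*-seminorm.  Moments
  determine the measure, so the cone over the invariant states is the lattice cone of finite measures.
\<close>

section \<open>Positive definite functions on the half line\<close>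

text \<open>No continuity of f is available: a state of the CCR algebra need not be regular.
  Monotonicity takes its place; it follows from bounded positive definiteness and carries the
  representation from rational to real arguments. The classical part alone would represent the
  bounded function f by Gaussians with s in [0, \<infinity>]. The quantum inequality raises the
  lower end to 1: the rate 1/2 in the decay estimate is its limit under repetition on ever smaller
  steps, so boundedness of the compensated function must be proved before any integral
  representation. In the coordinate y = exp (1 - s) the interval [1, \<infinity>] becomes [0, 1],
  and vectors of squared norm 2 k yield the k-th moments. The first two moments also give the
  variance of y, and its vanishing singles out the point masses, hence the extreme points. Suprema
  in the cone of measures come from a Hahn decomposition.\<close>

definition pos_def :: "(real \<Rightarrow> real) \<Rightarrow> bool" where
  "pos_def g \<longleftrightarrow> (\<forall>n (c :: nat \<Rightarrow> real) t. (\<forall>i<n. 0 \<le> t i) \<longrightarrow>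
     0 \<le> (\<Sum>i<n. \<Sum>j<n. c i * c j * g (t i + t j)))"

lemma pos_defD:
  fixes c t :: "nat \<Rightarrow> real"
  assumes "pos_def g" "\<And>i. i < n \<Longrightarrow> 0 \<le> t i"
  shows "0 \<le> (\<Sum>i<n. \<Sum>j<n. c i * c j * g (t i + t j))"
  using assms(1)[unfolded pos_def_def, THEN spec, of n, THEN spec, of c, THEN spec, of t] assms(2) by blast

lemma pos_def_nonneg:
  assumes "pos_def g" "0 \<le> t"
  shows "0 \<le> g t"
  using pos_defD[OF assms(1), of "Suc 0" "\<lambda>_. t / 2" "\<lambda>_. 1"] assms(2) by simp

lemma sum_lessThan_add:
  fixes F :: "nat \<Rightarrow> 'a::comm_monoid_add"
  shows "(\<Sum>i<n + m. F i) = (\<Sum>i<n. F i) + (\<Sum>i<m. F (n + i))"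
  by (induction m) (auto simp: add.assoc)

lemma nonneg_quadratic_discriminant:
  fixes a b c :: real
  assumes "\<And>x. 0 \<le> a + 2 * x * b + x\<^sup>2 * c"
  shows "b\<^sup>2 \<le> a * c"
proof (cases "c = 0")
  case True
  have "b = 0"
  proof (rule ccontr)
    assume "b \<noteq> 0"
    then have "a + 2 * (- (a + 1) / (2 * b)) * b = -1" by (simp add: field_simps)
    with assms[of "- (a + 1) / (2 * b)"] True show False by simp
  qed
  then show ?thesis using True by simp
next
  case False
  have "0 \<le> c"
  proof (rule ccontr)
    assume "\<not> 0 \<le> c"
    \<comment> \<open>The bounds at x and -x add up to \<open>a + x\<^sup>2 * c >= 0\<close>. This x
      is at least 1 and so large that already \<open>a + x * c\<close> is negative.\<close>
    define x where "x = (\<bar>a\<bar> + 1) / \<bar>c\<bar> + 1"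
    have x: "x \<ge> 1" by (simp add: x_def)
    have "0 \<le> a + x\<^sup>2 * c" using assms[of x] assms[of "- x"] by simp
    also have "x\<^sup>2 * c \<le> x * c"
      using x \<open>\<not> 0 \<le> c\<close> by (intro mult_right_mono_neg) (auto simp: power2_eq_square)
    also have "x * c = - (\<bar>a\<bar> + 1) + c"
      using \<open>\<not> 0 \<le> c\<close> by (simp add: x_def field_simps)
    finally show False using \<open>\<not> 0 \<le> c\<close> by linarith
  qed
  then have c: "0 < c" using False by simp
  have "a + 2 * (- b / c) * b + (- b / c)\<^sup>2 * c = a - b\<^sup>2 / c"
    using c by (simp add: field_simps power2_eq_square)
  with assms[of "- b / c"] have "b\<^sup>2 / c \<le> a" by simp
  then show ?thesis using c by (simp add: field_simps)
qed

text \<open>The quadratic form of the kernel translated by s. For fixed c and t it depends on s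
  alone, so a growth argument for one real function applies to every form and yields positive
  definiteness of differences of g.\<close>

definition pd_form :: "(real \<Rightarrow> real) \<Rightarrow> nat \<Rightarrow> (nat \<Rightarrow> real) \<Rightarrow> (nat \<Rightarrow> real) \<Rightarrow> real \<Rightarrow> real" where
  "pd_form g n c t s = (\<Sum>i<n. \<Sum>j<n. c i * c j * g (t i + t j + s))"

lemma pd_form_nonneg:
  assumes "pos_def g" "\<And>i. i < n \<Longrightarrow> 0 \<le> t i" "0 \<le> s"
  shows "0 \<le> pd_form g n c t s"
proof -
  have "pd_form g n c t s = (\<Sum>i<n. \<Sum>j<n. c i * c j * g ((t i + s / 2) + (t j + s / 2)))"
    unfolding pd_form_def by (simp add: algebra_simps)
  also have "\<dots> \<ge> 0" using assms by (intro pos_defD) auto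
  finally show ?thesis .
qed

text \<open>Cauchy-Schwarz between the points t and their translates t + h: weights c on the former
  and x c on the latter make a system of n + n points, whose form is a nonnegative quadratic
  polynomial in x.\<close>

lemma pd_form_shift:
  assumes "pos_def g" "\<And>i. i < n \<Longrightarrow> 0 \<le> t i" "0 \<le> h"
  shows "(pd_form g n c t h)\<^sup>2 \<le> pd_form g n c t 0 * pd_form g n c t (2 * h)"
proof (rule nonneg_quadratic_discriminant)
  fix x :: real
  define c' where "c' i = (if i < n then c i else x * c (i - n))" for i
  define t' where "t' i = (if i < n then t i else t (i - n) + h)" for i
  have "0 \<le> (\<Sum>i<n+n. \<Sum>j<n+n. c' i * c' j * g (t' i + t' j))"
    using assms by (intro pos_defD) (auto simp: t'_def)
  also have "\<dots> = pd_form g n c t 0 + 2 * x * pd_form g n c t h + x\<^sup>2 * pd_form g n c t (2 * h)"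
    unfolding sum_lessThan_add pd_form_def
    by (simp add: c'_def t'_def sum.distrib sum_distrib_left algebra_simps power2_eq_square)
  finally show "0 \<le> pd_form g n c t 0 + 2 * x * pd_form g n c t h + x\<^sup>2 * pd_form g n c t (2 * h)" .
qed

lemma pos_def_log_convex:
  assumes "pos_def g" "0 \<le> t" "0 \<le> h"
  shows "(g (t + h))\<^sup>2 \<le> g t * g (t + 2 * h)"
  using pd_form_shift[OF assms(1), of "Suc 0" "\<lambda>_. t / 2" h "\<lambda>_. 1"] assms(2,3)
  by (simp add: pd_form_def)

text \<open>
  If \<open>q h > q 0\<close> for the form \<open>q s = pd_form g n c t s\<close>, then log-convexity makes \<open>q (2^k * h)\<close>
  grow exponentially in \<open>2^k\<close>, against boundedness.
\<close>

lemma pos_def_shift_le: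
  assumes "pos_def g" and bound: "\<And>s. 0 \<le> s \<Longrightarrow> \<bar>g s\<bar> \<le> B"
    and "\<And>i. i < n \<Longrightarrow> 0 \<le> t i" "0 \<le> h"
  shows "pd_form g n c t h \<le> pd_form g n c t 0"
proof (rule ccontr)
  let ?q = "pd_form g n c t"
  assume "\<not> ?q h \<le> ?q 0"
  then have less: "?q 0 < ?q h" by simp
  have q0: "0 \<le> ?q s" if "0 \<le> s" for s using pd_form_nonneg[OF assms(1,3) that] .
  have CS: "(?q s)\<^sup>2 \<le> ?q 0 * ?q (2 * s)" if "0 \<le> s" for s
    using pd_form_shift[OF assms(1,3) that] .
  have pos: "0 < ?q 0"
  proof (rule ccontr)
    assume "\<not> 0 < ?q 0"
    then have "?q 0 = 0" using q0[of 0] by simp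
    then show False using CS[of h] less assms(4) by simp
  qed
  define r where "r = ?q h / ?q 0"
  have r: "1 < r" using less pos by (simp add: r_def)
  have grow: "?q 0 * r ^ (2 ^ k) \<le> ?q (2 ^ k * h)" for k
  proof (induction k)
    case 0
    then show ?case using pos by (simp add: r_def)
  next
    case (Suc k)
    have "?q 0 * (?q 0 * r ^ (2 ^ Suc k)) = (?q 0 * r ^ (2 ^ k))\<^sup>2"
      by (simp add: power2_eq_square power_add[symmetric] mult_2)
    also have "\<dots> \<le> (?q (2 ^ k * h))\<^sup>2"
      using Suc pos r by (intro power_mono) auto
    also have "\<dots> \<le> ?q 0 * ?q (2 ^ Suc k * h)"
      using CS[of "2 ^ k * h"] assms(4) by (simp add: mult.assoc)
    finally show ?case using pos by simp
  qed
  define C where "C = (\<Sum>i<n. \<Sum>j<n. \<bar>c i * c j\<bar> * B)"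
  have up: "?q s \<le> C" if "0 \<le> s" for s
    unfolding pd_form_def C_def
  proof (intro sum_mono)
    fix i j assume "i \<in> {..<n}" "j \<in> {..<n}"
    then have "\<bar>c i * c j\<bar> * \<bar>g (t i + t j + s)\<bar> \<le> \<bar>c i * c j\<bar> * B"
      using assms(3) that by (intro mult_left_mono bound) auto
    then show "c i * c j * g (t i + t j + s) \<le> \<bar>c i * c j\<bar> * B"
      by (metis abs_mult abs_ge_self order.trans)
  qed
  obtain k where k: "C / ?q 0 < r ^ k" using real_arch_pow[OF r] by blast
  also have "r ^ k \<le> r ^ (2 ^ k)" using r by (intro power_increasing) (auto simp: less_imp_le)
  finally have "C < ?q 0 * r ^ (2 ^ k)" using pos by (simp add: field_simps)
  also have "\<dots> \<le> C" using grow[of k] up[of "2 ^ k * h"] assms(4) by simp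
  finally show False by simp
qed

text \<open>Bounded positive definite functions are closed under these differences, so the step can
  be iterated to complete monotonicity. The bound doubles each time, which is harmless because
  \<open>pos_def_shift_le\<close> asks only for some bound.\<close>

lemma pos_def_diff:
  assumes "pos_def g" "\<And>s. 0 \<le> s \<Longrightarrow> \<bar>g s\<bar> \<le> B" "0 \<le> h"
  shows "pos_def (\<lambda>s. g s - g (s + h))" "0 \<le> s \<Longrightarrow> \<bar>g s - g (s + h)\<bar> \<le> 2 * B"
proof -
  show "pos_def (\<lambda>s. g s - g (s + h))"
    unfolding pos_def_def
  proof (intro allI impI)
    fix n and c t :: "nat \<Rightarrow> real"
    assume "\<forall>i<n. 0 \<le> t i"
    then have "pd_form g n c t h \<le> pd_form g n c t 0"
      using assms(2,3) by (intro pos_def_shift_le[OF assms(1)]) auto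
    then show "0 \<le> (\<Sum>i<n. \<Sum>j<n. c i * c j * (g (t i + t j) - g (t i + t j + h)))"
      by (simp add: pd_form_def right_diff_distrib sum_subtractf)
  qed
  show "\<bar>g s - g (s + h)\<bar> \<le> 2 * B" if "0 \<le> s"
    using assms(2)[of s] assms(2)[of "s + h"] assms(3) that by linarith
qed


section \<open>The Hausdorff moment problem\<close>

text \<open>If m k is the integral of x^k for a measure on [0, 1], this is the integral of x^k (1 -
  x)^n; its nonnegativity is Hausdorff's condition.\<close>

fun back_diff :: "(nat \<Rightarrow> real) \<Rightarrow> nat \<Rightarrow> nat \<Rightarrow> real" where
  "back_diff m 0 k = m k"
| "back_diff m (Suc n) k = back_diff m n k - back_diff m n (Suc k)"

text \<open>Moves the outermost difference to the innermost place, so that the induction in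
  \<open>pos_def_back_diff\<close> can replace g by its difference.\<close>

lemma back_diff_Suc: "back_diff m (Suc n) k = back_diff (\<lambda>k. m k - m (Suc k)) n k"
proof (induction n arbitrary: k)
  case (Suc n)
  show ?case
    unfolding back_diff.simps(2)[of m "Suc n"] Suc.IH by simp
qed simp

lemma pos_def_back_diff:
  assumes "pos_def g" "\<And>s. 0 \<le> s \<Longrightarrow> \<bar>g s\<bar> \<le> B" "0 \<le> h"
  shows "0 \<le> back_diff (\<lambda>k. g (real k * h)) n k"
  using assms(1,2)
proof (induction n arbitrary: g B)
  case 0
  then show ?case using assms(3) by (simp add: pos_def_nonneg)
next
  case (Suc n)
  have "0 \<le> back_diff (\<lambda>k. g (real k * h) - g (real k * h + h)) n k"
    by (rule Suc.IH[OF pos_def_diff[OF Suc.prems assms(3)]])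
  then show ?case
    unfolding back_diff_Suc by (simp add: algebra_simps)
qed

lemma sum_choose_Suc:
  fixes F :: "nat \<Rightarrow> real"
  shows "(\<Sum>i\<le>Suc n. real (Suc n choose i) * F i) = (\<Sum>i\<le>n. real (n choose i) * (F i + F (Suc i)))"
proof -
  have "(\<Sum>i\<le>Suc n. real (Suc n choose i) * F i)
      = F 0 + (\<Sum>i\<le>n. real (Suc n choose Suc i) * F (Suc i))"
    by (subst sum.atMost_Suc_shift) simp
  also have "\<dots> = (F 0 + (\<Sum>i\<le>n. real (n choose Suc i) * F (Suc i))) + (\<Sum>i\<le>n. real (n choose i) * F (Suc i))"
    by (simp add: sum.distrib algebra_simps)
  also have "F 0 + (\<Sum>i\<le>n. real (n choose Suc i) * F (Suc i)) = (\<Sum>i\<le>Suc n. real (n choose i) * F i)"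
    by (subst sum.atMost_Suc_shift) simp
  finally show ?thesis by (simp add: sum.distrib algebra_simps)
qed

text \<open>On moments this is the identity x^j (x + (1 - x))^n = x^j under the integral.\<close>

lemma sum_choose_back_diff:
  "(\<Sum>i\<le>n. real (n choose i) * back_diff m (n - i) (j + i)) = m j"
proof -
  have "(\<Sum>i\<le>n. real (n choose i) * back_diff m (n - i + r) (j + i)) = back_diff m r j" for r
  proof (induction n)
    case (Suc n)
    have "(\<Sum>i\<le>Suc n. real (Suc n choose i) * back_diff m (Suc n - i + r) (j + i))
        = (\<Sum>i\<le>n. real (n choose i) * back_diff m (n - i + r) (j + i))"
      unfolding sum_choose_Suc by (rule sum.cong) (auto simp: Suc_diff_le)
    then show ?case using Suc by simp
  qed simp
  from this[of 0] show ?thesis by simp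
qed

lemma binomial_ratio_prod:
  assumes "j \<le> N"
  shows "real (k choose j) / real (N choose j) = (\<Prod>i<j. (real k - real i) / (real N - real i))"
  using assms
  by (simp add: binomial_gbinomial gbinomial_prod_rev atLeast0LessThan prod_dividef)

text \<open>A product of factors of modulus at most 1 changes by at most the sum of the changes of
  its factors. The hypothesis \<open>2 * j < N\<close> keeps the factors with i > k above -1 and
  makes each denominator N - i at least N / 2.\<close>

lemma binomial_ratio_power:
  assumes "k \<le> N" "2 * j < N"
  shows "\<bar>real (k choose j) / real (N choose j) - (real k / real N) ^ j\<bar> \<le> 2 * real j * real j / real N"
proof -
  have "\<bar>(\<Prod>i<j. (real k - real i) / (real N - real i)) - (\<Prod>i<j. real k / real N)\<bar>
      \<le> (\<Sum>i<j. \<bar>(real k - real i) / (real N - real i) - real k / real N\<bar>)"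
    using assms
    by (intro norm_prod_diff[where 'a = real, unfolded real_norm_def]) (auto simp: field_simps abs_le_iff)
  also have "\<dots> \<le> (\<Sum>i<j. 2 * real j / real N)"
  proof (intro sum_mono)
    fix i assume "i \<in> {..<j}"
    then have i: "i < j" "2 * i < N" "2 * j < N" using assms by auto
    have "(real k - real i) / (real N - real i) - real k / real N
        = - (real i * (real N - real k) / (real N * (real N - real i)))"
      using i by (simp add: field_simps)
    then have "\<bar>(real k - real i) / (real N - real i) - real k / real N\<bar>
        = (real i / (real N - real i)) * ((real N - real k) / real N)"
      using i assms(1) by (simp add: abs_mult mult.commute)
    also have "\<dots> \<le> (real i / (real N - real i)) * 1"
      using i assms(1) by (intro mult_left_mono) auto
    also have "real i / (real N - real i) \<le> 2 * real j / real N"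
    proof -
      have "real i * real N \<le> real j * (2 * (real N - real i))"
        using i by (intro mult_mono) auto
      then show ?thesis using i by (simp add: field_simps)
    qed
    finally show "\<bar>(real k - real i) / (real N - real i) - real k / real N\<bar> \<le> 2 * real j / real N" by simp
  qed
  finally show ?thesis
    using assms by (simp add: binomial_ratio_prod algebra_simps)
qed

text \<open>Discrete measures at the points k / N carry the masses that the Bernstein polynomials
  would receive from the unknown measure. Their normalised factorial moments are exactly m j, the
  power moments differ from these by O(1 / N), and Helly selection supplies the limit.\<close>

theorem Hausdorff_moment:
  fixes m :: "nat \<Rightarrow> real"
  assumes nonneg: "\<And>n k. 0 \<le> back_diff m n k" and m0: "m 0 = 1"
  obtains M where "real_distribution M" "AE x in M. 0 \<le> x \<and> x \<le> 1" "\<And>k. (\<integral>x. x ^ k \<partial>M) = m k"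
proof -
  define w where "w N k = real (N choose k) * back_diff m (N - k) k" for N k
  have w_nonneg: "0 \<le> w N k" for N k using nonneg by (simp add: w_def)
  have w_sum: "(\<Sum>k\<le>N. w N k * (real (k choose j) / real (N choose j))) = m j" if "j \<le> N" for N j
  proof -
    have "(\<Sum>k\<le>N. w N k * (real (k choose j) / real (N choose j)))
        = (\<Sum>k\<in>{j..N}. w N k * (real (k choose j) / real (N choose j)))"
      by (rule sum.mono_neutral_right) auto
    \<comment> \<open>The identity C(N,k) C(k,j) = C(N,j) C(N-j,k-j) cancels the denominator and
      leaves the sum of \<open>sum_choose_back_diff\<close> for N - j.\<close>
    also have "\<dots> = (\<Sum>k\<in>{j..N}. real ((N - j) choose (k - j)) * back_diff m (N - k) k)"
    proof (rule sum.cong)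
      fix k assume k: "k \<in> {j..N}"
      then have "real (N choose k) * real (k choose j) = real (N choose j) * real ((N - j) choose (k - j))"
        by (simp only: of_nat_mult[symmetric]) (simp add: choose_mult)
      moreover have "real (N choose j) \<noteq> 0" using that by simp
      ultimately show "w N k * (real (k choose j) / real (N choose j))
          = real ((N - j) choose (k - j)) * back_diff m (N - k) k"
        by (simp add: w_def field_simps)
    qed simp
    also have "\<dots> = (\<Sum>i\<le>N - j. real ((N - j) choose i) * back_diff m (N - j - i) (j + i))"
      by (rule sum.reindex_bij_witness[of _ "\<lambda>i. j + i" "\<lambda>k. k - j"]) (use that in auto)
    also have "\<dots> = m j" by (rule sum_choose_back_diff)
    finally show ?thesis .
  qed
  have w_sum0: "(\<Sum>k\<le>N. w N k) = 1" for N using w_sum[of 0 N] m0 by simp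
  define \<mu> where "\<mu> n = distr (point_measure {..Suc n} (\<lambda>k. ennreal (w (Suc n) k))) borel
    (\<lambda>k. real k / real (Suc n))" for n
  have prob: "prob_space (point_measure {..Suc n} (\<lambda>k. ennreal (w (Suc n) k)))" for n
    by (rule prob_spaceI)
      (simp only: space_point_measure emeasure_point_measure_finite[OF finite_atMost order.refl]
        sum_ennreal[OF w_nonneg] w_sum0 ennreal_1)
  have dist: "real_distribution (\<mu> n)" for n
    unfolding \<mu>_def by (intro prob_space.real_distribution_distr[OF prob]) simp
  have int: "integral\<^sup>L (\<mu> n) F = (\<Sum>k\<le>Suc n. w (Suc n) k * F (real k / real (Suc n)))"
    if "F \<in> borel_measurable borel" for F :: "real \<Rightarrow> real" and n
    unfolding \<mu>_def using that
    by (subst integral_distr) (simp_all add: lebesgue_integral_point_measure_finite w_nonneg del: sum.atMost_Suc)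
  have frac: "0 \<le> real k / real (Suc n)" "real k / real (Suc n) \<le> 1" if "k \<le> Suc n" for k n
    using that by (auto simp: field_simps)
  \<comment> \<open>Tightness is phrased with intervals open on the left, so the left end lies below
    0 to catch an atom there.\<close>
  have "measure (\<mu> n) {-1<..1} = 1" for n
  proof -
    interpret real_distribution "\<mu> n" by (rule dist)
    have "measure (\<mu> n) {-1<..1} = integral\<^sup>L (\<mu> n) (indicator {-1<..1})" by simp
    also have "\<dots> = (\<Sum>k\<le>Suc n. w (Suc n) k * indicator {-1<..1} (real k / real (Suc n)))"
      by (rule int) simp
    also have "\<dots> = (\<Sum>k\<le>Suc n. w (Suc n) k)"
    proof (rule sum.cong)
      fix k assume "k \<in> {..Suc n}"
      then have "real k / real (Suc n) \<in> {-1<..1}"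
        using frac[of k n] less_le_trans[of "-1" 0 "real k / real (Suc n)"] by (simp del: of_nat_Suc)
      then show "w (Suc n) k * indicator {-1<..1} (real k / real (Suc n)) = w (Suc n) k"
        by (simp only: indicator_simps mult_1_right)
    qed simp
    finally show ?thesis by (simp only: w_sum0)
  qed
  then have "tight \<mu>"
    unfolding tight_def using dist
    by (intro conjI allI impI exI[of _ "-1"] exI[of _ 1]) auto
  then obtain r M where r: "strict_mono (r :: nat \<Rightarrow> nat)" and M: "real_distribution M"
    and conv: "weak_conv_m (\<mu> \<circ> id \<circ> r) M"
    using tight_imp_convergent_subsubsequence[of \<mu> id] by (auto simp: strict_mono_id)
  interpret M: real_distribution M by (rule M)
  have lim: "(\<lambda>n. integral\<^sup>L (\<mu> (r n)) F) \<longlonglongrightarrow> integral\<^sup>L M F"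
    if "\<And>x. isCont F x" "\<And>x. norm (F x) \<le> B" for F :: "real \<Rightarrow> real" and B
    using weak_conv_imp_integral_bdd_continuous_conv[OF _ M conv that] dist by (simp add: o_def)
  \<comment> \<open>Weak convergence tests only bounded continuous functions on the whole line, so
    powers are composed with the retraction onto [0, 1].\<close>
  define cl :: "real \<Rightarrow> real" where "cl x = max 0 (min 1 x)" for x
  have cl: "0 \<le> cl x" "cl x \<le> 1" "isCont cl x" for x
    unfolding cl_def by (auto intro!: continuous_intros)
  have cl_id: "cl (real k / real (Suc n)) = real k / real (Suc n)" if "k \<le> Suc n" for k n
    using frac[OF that] by (simp add: cl_def del: of_nat_Suc)
  have cl_meas [measurable]: "cl \<in> borel_measurable borel"
    by (intro borel_measurable_continuous_onI continuous_at_imp_continuous_on ballI cl)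
  \<comment> \<open>Continuous, bounded and zero exactly on [0, 1]: its integral vanishes along the
    sequence, so the limit measure is concentrated on [0, 1].\<close>
  define G where "G x = min 1 \<bar>x - cl x\<bar>" for x
  have G_int: "integral\<^sup>L (\<mu> n) G = 0" for n
  proof -
    have "integral\<^sup>L (\<mu> n) G = (\<Sum>k\<le>Suc n. w (Suc n) k * G (real k / real (Suc n)))"
      by (rule int) (simp add: G_def[abs_def])
    also have "\<dots> = 0"
      by (rule sum.neutral) (auto simp: G_def cl_id simp del: of_nat_Suc)
    finally show ?thesis .
  qed
  have "isCont G x" for x
    unfolding G_def by (intro continuous_intros cl)
  then have "(\<lambda>n. integral\<^sup>L (\<mu> (r n)) G) \<longlonglongrightarrow> integral\<^sup>L M G"
    by (rule lim[of G 1]) (simp add: G_def)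
  then have "integral\<^sup>L M G = 0"
    by (simp add: G_int LIMSEQ_const_iff)
  moreover have "integrable M G"
    by (rule M.integrable_const_bound[of _ 1]) (simp_all add: G_def[abs_def])
  ultimately have "AE x in M. G x = 0"
    by (subst (asm) integral_nonneg_eq_0_iff_AE) (auto simp: G_def)
  then have AE: "AE x in M. 0 \<le> x \<and> x \<le> 1"
    by eventually_elim (auto simp: G_def cl_def split: if_splits)
  have "(\<integral>x. x ^ j \<partial>M) = m j" for j
  proof -
    have "(\<lambda>n. integral\<^sup>L (\<mu> (r n)) (\<lambda>x. cl x ^ j)) \<longlonglongrightarrow> integral\<^sup>L M (\<lambda>x. cl x ^ j)"
      using cl by (intro lim[of _ 1]) (auto intro!: continuous_intros simp: power_le_one norm_power)
    moreover have "(\<lambda>n. integral\<^sup>L (\<mu> (r n)) (\<lambda>x. cl x ^ j)) \<longlonglongrightarrow> m j"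
    proof -
      \<comment> \<open>The factorial moment is evaluated exactly by \<open>w_sum\<close>; only
        replacing the binomial ratio by (k / N)^j costs an error, averaged over weights of total
        mass 1.\<close>
      have close: "\<bar>integral\<^sup>L (\<mu> n) (\<lambda>x. cl x ^ j) - m j\<bar> \<le> 2 * real j * real j / real (Suc n)"
        if "2 * j < Suc n" for n
      proof -
        have "integral\<^sup>L (\<mu> n) (\<lambda>x. cl x ^ j) = (\<Sum>k\<le>Suc n. w (Suc n) k * cl (real k / real (Suc n)) ^ j)"
          using int[of "\<lambda>x. cl x ^ j" n] by (simp only: borel_measurable_power cl_meas)
        also have "\<dots> = (\<Sum>k\<le>Suc n. w (Suc n) k * (real k / real (Suc n)) ^ j)"
          by (rule sum.cong[OF refl]) (metis cl_id atMost_iff)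
        finally have dev: "integral\<^sup>L (\<mu> n) (\<lambda>x. cl x ^ j) - m j = (\<Sum>k\<le>Suc n. w (Suc n) k *
            ((real k / real (Suc n)) ^ j - real (k choose j) / real (Suc n choose j)))"
          using w_sum[of j "Suc n"] that by (simp only: right_diff_distrib sum_subtractf)
        have "\<bar>integral\<^sup>L (\<mu> n) (\<lambda>x. cl x ^ j) - m j\<bar> \<le> (\<Sum>k\<le>Suc n. \<bar>w (Suc n) k *
            ((real k / real (Suc n)) ^ j - real (k choose j) / real (Suc n choose j))\<bar>)"
          unfolding dev by (rule sum_abs)
        also have "\<dots> \<le> (\<Sum>k\<le>Suc n. w (Suc n) k * (2 * real j * real j / real (Suc n)))"
        proof (rule sum_mono)
          fix k assume "k \<in> {..Suc n}"
          then have "k \<le> Suc n" by simp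
          have "\<bar>(real k / real (Suc n)) ^ j - real (k choose j) / real (Suc n choose j)\<bar>
              \<le> 2 * real j * real j / real (Suc n)"
            by (subst abs_minus_commute) (rule binomial_ratio_power[OF \<open>k \<le> Suc n\<close> that])
          from mult_left_mono[OF this w_nonneg]
          show "\<bar>w (Suc n) k * ((real k / real (Suc n)) ^ j - real (k choose j) / real (Suc n choose j))\<bar>
              \<le> w (Suc n) k * (2 * real j * real j / real (Suc n))"
            by (simp only: abs_mult abs_of_nonneg[OF w_nonneg])
        qed
        also have "\<dots> = 2 * real j * real j / real (Suc n)"
          by (simp only: sum_distrib_right[symmetric] w_sum0 mult_1_left)
        finally show ?thesis .
      qed
      have "eventually (\<lambda>n. norm (integral\<^sup>L (\<mu> n) (\<lambda>x. cl x ^ j) - m j)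
          \<le> 2 * real j * real j / real (Suc n)) sequentially"
        using eventually_ge_at_top[of "2 * j"]
        by eventually_elim (unfold real_norm_def, rule close, simp)
      moreover have "(\<lambda>n. 2 * real j * real j / real (Suc n)) \<longlonglongrightarrow> 0"
        by real_asymp
      ultimately have "(\<lambda>n. integral\<^sup>L (\<mu> n) (\<lambda>x. cl x ^ j) - m j) \<longlonglongrightarrow> 0"
        by (rule Lim_null_comparison)
      then have "(\<lambda>n. integral\<^sup>L (\<mu> n) (\<lambda>x. cl x ^ j)) \<longlonglongrightarrow> m j"
        by (simp add: LIM_zero_iff)
      from LIMSEQ_subseq_LIMSEQ[OF this r] show ?thesis by (simp add: o_def)
    qed
    ultimately have "integral\<^sup>L M (\<lambda>x. cl x ^ j) = m j" by (rule LIMSEQ_unique)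
    moreover have "integral\<^sup>L M (\<lambda>x. cl x ^ j) = integral\<^sup>L M (\<lambda>x. x ^ j)"
      by (rule integral_cong_AE) (auto intro!: eventually_mono[OF AE] simp: cl_def)
    ultimately show ?thesis by simp
  qed
  with M AE show ?thesis by (rule that)
qed

section \<open>Uniqueness of moments, and representation of bounded positive definite
  functions\<close>

lemma unit_interval_moments_eqI:
  assumes M: "real_distribution M" "AE x in M. 0 \<le> x \<and> x \<le> 1"
    and N: "real_distribution N" "AE x in N. 0 \<le> x \<and> x \<le> 1"
    and eq: "\<And>k. (\<integral>x. x ^ k \<partial>M) = (\<integral>x. x ^ k \<partial>N)"
  shows "M = N"
proof -
  have bd: "integrable L F" if L: "real_distribution L" "AE x in L. 0 \<le> x \<and> x \<le> 1"
    and F: "continuous_on UNIV F" for L and F :: "real \<Rightarrow> real"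
  proof -
    interpret real_distribution L by (rule L(1))
    have "bounded (F ` {0..1})"
      by (intro compact_imp_bounded compact_continuous_image continuous_on_subset[OF F]) auto
    then obtain B where "\<forall>x\<in>{0..1}. norm (F x) \<le> B" by (auto simp only: bounded_iff ball_simps)
    moreover have "F \<in> borel_measurable borel" using F by (rule borel_measurable_continuous_onI)
    ultimately show ?thesis
      by (intro integrable_const_bound[of _ B] eventually_mono[OF L(2)]) auto
  qed
  \<comment> \<open>Moments fix the integrals of polynomials, and Stone-Weierstrass on [0, 1] passes
    to continuous functions: one error of at most e for each measure cannot fill a gap of 3
    e.\<close>
  have *: "integral\<^sup>L M F = integral\<^sup>L N F" if F: "continuous_on UNIV F" for F :: "real \<Rightarrow> real"
  proof (rule ccontr)
    assume "integral\<^sup>L M F \<noteq> integral\<^sup>L N F"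
    then obtain e where e: "0 < e" "\<bar>integral\<^sup>L M F - integral\<^sup>L N F\<bar> = 3 * e"
      using that[of "\<bar>integral\<^sup>L M F - integral\<^sup>L N F\<bar> / 3"] by simp
    obtain p where p: "real_polynomial_function p" "\<And>x. x \<in> {0..1} \<Longrightarrow> \<bar>F x - p x\<bar> < e"
      using Stone_Weierstrass_real_polynomial_function[of "{0..1}" F e]
        continuous_on_subset[OF F, of "{0..1}"] e(1) by auto
    obtain a n where pa: "p = (\<lambda>x. \<Sum>i\<le>n. a i * x ^ i)"
      using p(1) by (auto simp: real_polynomial_function_iff_sum)
    have near: "\<bar>integral\<^sup>L L F - (\<Sum>i\<le>n. a i * (\<integral>x. x ^ i \<partial>L))\<bar> \<le> e"
      if L: "real_distribution L" "AE x in L. 0 \<le> x \<and> x \<le> 1" for L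
    proof -
      interpret real_distribution L by (rule L(1))
      have iF: "integrable L F" by (rule bd[OF L F])
      have ip: "integrable L (\<lambda>x. x ^ i)" for i by (rule bd[OF L]) (intro continuous_intros)
      then have ip': "integrable L p" unfolding pa by (intro Bochner_Integration.integrable_sum) simp
      have "(\<Sum>i\<le>n. a i * (\<integral>x. x ^ i \<partial>L)) = integral\<^sup>L L p"
        unfolding pa using ip by (subst Bochner_Integration.integral_sum) simp_all
      then have "\<bar>integral\<^sup>L L F - (\<Sum>i\<le>n. a i * (\<integral>x. x ^ i \<partial>L))\<bar> = \<bar>\<integral>x. F x - p x \<partial>L\<bar>"
        using iF ip' by simp
      also have "\<dots> \<le> (\<integral>x. \<bar>F x - p x\<bar> \<partial>L)" by simp
      also have "\<dots> \<le> (\<integral>x. e \<partial>L)"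
      proof (rule integral_mono_AE)
        show "AE x in L. \<bar>F x - p x\<bar> \<le> e"
          using L(2) by eventually_elim (auto intro!: less_imp_le p(2))
      qed (use iF ip' in auto)
      also have "\<dots> = e" by (simp add: prob_space[unfolded space_eq_univ])
      finally show ?thesis .
    qed
    from near[OF M] near[OF N] have "\<bar>integral\<^sup>L M F - integral\<^sup>L N F\<bar> \<le> 2 * e"
      unfolding eq by linarith
    then show False using e by linarith
  qed
  \<comment> \<open>Cosine and sine are admissible test functions, which brings in uniqueness of
    characteristic functions.\<close>
  have "char M t = char N t" for t
  proof -
    have I: "integrable L (\<lambda>x. iexp (t * x))" if "real_distribution L" for L
    proof -
      interpret real_distribution L by (rule that)
      show ?thesis by (rule integrable_const_bound[of _ 1]) simp_all
    qed
    have "Re (char L t) = (\<integral>x. cos (t * x) \<partial>L)" "Im (char L t) = (\<integral>x. sin (t * x) \<partial>L)"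
      if "real_distribution L" for L
      unfolding char_def integral_Re[OF I[OF that], symmetric] integral_Im[OF I[OF that], symmetric]
      by (simp_all add: Re_exp Im_exp)
    then have "Re (char M t) = Re (char N t)" "Im (char M t) = Im (char N t)"
      using M(1) N(1) *[of "\<lambda>x. cos (t * x)"] *[of "\<lambda>x. sin (t * x)"]
      by (simp_all add: continuous_intros)
    then show ?thesis by (simp add: complex_eq_iff)
  qed
  then show ?thesis by (intro Levy_uniqueness M N) auto
qed


text \<open>Each mesh 1 / (n + 1) has its own solution of the moment problem. Pushed forward under
  x^(n+1), all of them have the moments g 0, g 1, g 2, ... and hence coincide, so one measure serves
  every positive rational. The case t = 0 is left out because \<open>0 powr 0\<close> is 0, while an
  atom at 0 counts towards g 0.\<close>

theorem pos_def_bounded_representation: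
  assumes g: "pos_def g" "\<And>s. 0 \<le> s \<Longrightarrow> \<bar>g s\<bar> \<le> B" and g0: "g 0 = 1"
  obtains M where "real_distribution M" "AE x in M. 0 \<le> x \<and> x \<le> 1"
    "\<And>t. 0 < t \<Longrightarrow> (\<integral>x. x powr t \<partial>M) = g t"
proof -
  have *: "\<exists>M. real_distribution M \<and> (AE x in M. 0 \<le> x \<and> x \<le> 1) \<and> (\<forall>k. (\<integral>x. x ^ k \<partial>M) = g (real k * h))"
    if "0 \<le> h" for h
    by (rule Hausdorff_moment[of "\<lambda>k. g (real k * h)"])
      (use pos_def_back_diff[OF g that] g0 in auto)
  have "\<exists>M. \<forall>n. real_distribution (M n) \<and> (AE x in M n. 0 \<le> x \<and> x \<le> 1) \<and>
      (\<forall>k. (\<integral>x. x ^ k \<partial>M n) = g (real k * (1 / real (Suc n))))"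
    by (intro choice allI) (rule *, simp)
  then obtain \<nu> where \<nu>: "\<And>n. real_distribution (\<nu> n)" "\<And>n. AE x in \<nu> n. 0 \<le> x \<and> x \<le> 1"
    "\<And>n k. (\<integral>x. x ^ k \<partial>\<nu> n) = g (real k * (1 / real (Suc n)))"
    by blast
  define M where "M = \<nu> 0"
  have M: "real_distribution M" "AE x in M. 0 \<le> x \<and> x \<le> 1" "\<And>k. (\<integral>x. x ^ k \<partial>M) = g (real k)"
    unfolding M_def by (fact \<nu>(1), fact \<nu>(2), use \<nu>(3)[of 0] in simp)
  interpret real_distribution M by (rule M(1))
  have M_eq: "distr (\<nu> n) borel (\<lambda>x. x ^ Suc n) = M" for n
  proof -
    interpret nu: real_distribution "\<nu> n" by (rule \<nu>(1))
    show ?thesis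
    proof (rule unit_interval_moments_eqI[OF _ _ M(1,2)])
      show "real_distribution (distr (\<nu> n) borel (\<lambda>x. x ^ Suc n))"
        by (rule nu.real_distribution_distr) simp
      show "AE x in distr (\<nu> n) borel (\<lambda>x. x ^ Suc n). 0 \<le> x \<and> x \<le> 1"
        by (subst AE_distr_iff)
          (auto intro!: eventually_mono[OF \<nu>(2)[of n]] simp: power_le_one simp del: power_Suc)
      show "(\<integral>x. x ^ k \<partial>distr (\<nu> n) borel (\<lambda>x. x ^ Suc n)) = (\<integral>x. x ^ k \<partial>M)" for k
        by (subst integral_distr)
          (simp_all add: M(3) power_mult[symmetric] \<nu>(3) of_nat_mult del: power_Suc of_nat_Suc mult_Suc)
    qed
  qed
  define R where "R t = (\<integral>x. x powr t \<partial>M)" for t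
  have R_rat: "R (real k / real (Suc n)) = g (real k / real (Suc n))" if "0 < k" for k n
  proof -
    interpret nu: real_distribution "\<nu> n" by (rule \<nu>(1))
    have "R (real k / real (Suc n)) = (\<integral>x. (x ^ Suc n) powr (real k / real (Suc n)) \<partial>\<nu> n)"
      unfolding R_def M_eq[of n, symmetric] by (subst integral_distr) simp_all
    also have "\<dots> = (\<integral>x. x ^ k \<partial>\<nu> n)"
    proof (rule integral_cong_AE)
      show "AE x in \<nu> n. (x ^ Suc n) powr (real k / real (Suc n)) = x ^ k"
        using \<nu>(2)[of n]
      proof eventually_elim
        case (elim x)
        show ?case
        proof (cases "x = 0")
          case False
          then have "0 < x" using elim by simp
          then have "(x ^ Suc n) powr (real k / real (Suc n)) = x powr (real (Suc n) * (real k / real (Suc n)))"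
            by (simp only: powr_realpow[symmetric] powr_powr)
          also have "\<dots> = x ^ k" using \<open>0 < x\<close> by (simp add: powr_realpow del: of_nat_Suc)
          finally show ?thesis .
        qed (use that in simp)
      qed
    qed simp_all
    finally show ?thesis by (simp add: \<nu>(3))
  qed
  have int: "integrable M (\<lambda>x. x powr t)" if "0 < t" for t
    by (rule integrable_const_bound[of _ 1])
      (use that in \<open>auto intro!: eventually_mono[OF M(2)] simp: powr_le1\<close>)
  have g_anti: "g t \<le> g s" if "0 \<le> s" "s \<le> t" for s t
    using pos_def_nonneg[OF pos_def_diff(1)[OF g, of "t - s"], of s] that by simp
  have R_cont: "(\<lambda>n. R (t n)) \<longlonglongrightarrow> R T" if t: "t \<longlonglongrightarrow> T" "0 < T" "\<And>n. 0 < t n" for t T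
    unfolding R_def
  proof (rule integral_dominated_convergence[where w = "\<lambda>_. 1"])
    show "AE x in M. (\<lambda>n. x powr t n) \<longlonglongrightarrow> x powr T"
    proof (rule AE_I2)
      fix x :: real
      show "(\<lambda>n. x powr t n) \<longlonglongrightarrow> x powr T"
        by (cases "x = 0") (use t in \<open>auto intro!: tendsto_powr\<close>)
    qed
    show "AE x in M. norm (x powr t n) \<le> 1" for n
      using t(3)[of n] by (auto intro!: eventually_mono[OF M(2)] simp: powr_le1)
  qed simp_all
  have "R t = g t" if t: "0 < t" for t
  proof -
    \<comment> \<open>The offset makes every grid fine enough for the lower neighbour
      \<open>a n\<close> of t to be positive, as \<open>R_rat\<close> and \<open>R_cont\<close>
      demand.\<close>
    obtain n0 where n0: "1 < real n0 * t" using reals_Archimedean3[OF t] by blast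
    define k where "k n = nat \<lfloor>real (Suc (n + n0)) * t\<rfloor>" for n
    have big: "1 < real (Suc (n + n0)) * t" for n
    proof -
      have "real n0 * t \<le> real (Suc (n + n0)) * t" using t by (intro mult_right_mono) auto
      then show ?thesis using n0 by linarith
    qed
    have k: "0 < k n" "real (k n) \<le> real (Suc (n + n0)) * t" "real (Suc (n + n0)) * t \<le> real (k n) + 1" for n
      using big[of n] unfolding k_def by (auto simp del: of_nat_Suc)
    define a b where "a n = real (k n) / real (Suc (n + n0))" and "b n = real (Suc (k n)) / real (Suc (n + n0))" for n
    have ab: "0 < a n" "a n \<le> t" "t \<le> b n" "b n = a n + 1 / real (Suc (n + n0))" for n
      using k[of n] unfolding a_def b_def by (auto simp: field_simps simp del: of_nat_Suc)
    have small: "(\<lambda>n. 1 / real (Suc (n + n0))) \<longlonglongrightarrow> 0" by real_asymp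
    have "(\<lambda>n. t - 1 / real (Suc (n + n0))) \<longlonglongrightarrow> t"
      using tendsto_diff[OF tendsto_const small, of t] by simp
    then have a: "a \<longlonglongrightarrow> t"
      by (rule real_tendsto_sandwich[rotated 2, OF _ tendsto_const])
        (use ab in \<open>auto intro!: always_eventually simp: algebra_simps\<close>)
    from tendsto_add[OF a small] have b: "b \<longlonglongrightarrow> t" unfolding ab(4)[symmetric] by simp
    have "R (b n) = g (b n)" "R (a n) = g (a n)" for n
      unfolding a_def b_def by (rule R_rat; use k(1) in simp)+
    moreover have "g (b n) \<le> g t" "g t \<le> g (a n)" for n
      using ab[of n] t by (auto intro!: g_anti)
    ultimately have "R (b n) \<le> g t" "g t \<le> R (a n)" for n by simp_all
    moreover have "(\<lambda>n. R (b n)) \<longlonglongrightarrow> R t" "(\<lambda>n. R (a n)) \<longlonglongrightarrow> R t"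
      by (rule R_cont[OF b t less_le_trans[OF t ab(3)]], rule R_cont[OF a t ab(1)])
    ultimately show ?thesis
      by (meson LIMSEQ_le_const LIMSEQ_le_const2 order.antisym)
  qed
  then show ?thesis using M(1,2) by (intro that[of M]) (auto simp: R_def)
qed

section \<open>Geometry of complex inner product spaces\<close>

lemma cinner_add_right: "cinner x (y + z) = cinner x y + cinner x z"
  by (metis cinner_add_left cinner_commute complex_cnj_add)

lemma cinner_scaleC_right: "cinner x (c *\<^sub>C y) = cnj c * cinner x y"
  by (metis cinner_scaleC_left cinner_commute complex_cnj_mult)

lemma cinner_zero_left [simp]: "cinner 0 x = 0"
  using cinner_add_left[of 0 0 x] by simp

lemma cinner_zero_right [simp]: "cinner x 0 = 0"
  using cinner_add_right[of x 0 0] by simp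

lemma cinner_minus_left: "cinner (- x) y = - cinner x y"
  using cinner_add_left[of x "- x" y] by (simp add: eq_neg_iff_add_eq_0 add.commute)

lemma cinner_minus_right: "cinner x (- y) = - cinner x y"
  using cinner_add_right[of x y "- y"] by (simp add: eq_neg_iff_add_eq_0 add.commute)

lemma cinner_diff_left: "cinner (x - y) z = cinner x z - cinner y z"
  using cinner_add_left[of x "- y" z] by (simp add: cinner_minus_left)

lemma cinner_diff_right: "cinner x (y - z) = cinner x y - cinner x z"
  using cinner_add_right[of x y "- z"] by (simp add: cinner_minus_right)

lemma cinner_sum_left: "cinner (sum F A) y = (\<Sum>i\<in>A. cinner (F i) y)"
  by (induction A rule: infinite_finite_induct) (simp_all add: cinner_add_left)

lemmas cinner_simps = cinner_add_left cinner_add_right cinner_diff_left cinner_diff_right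
  cinner_scaleC_left cinner_scaleC_right

lemma norm_diff_sq:
  fixes x y :: "'h::complex_inner"
  shows "(norm (x - y))\<^sup>2 = (norm x)\<^sup>2 + (norm y)\<^sup>2 - 2 * Re (cinner x y)"
  by (simp add: power2_norm_eq_inner inner_diff inner_commute flip: inner_eq_Re_cinner)

lemma infinite_dim_orthonormal:
  assumes "\<not> (\<exists>B :: 'h::complex_inner set. finite B \<and> cspan B = UNIV)"
  shows "\<exists>b :: nat \<Rightarrow> 'h. \<forall>i<N. \<forall>j<N. cinner (b i) (b j) = (if i = j then 1 else 0)"
proof (induction N)
  case (Suc N)
  then obtain b :: "nat \<Rightarrow> 'h"
    where b: "\<And>i j. i < N \<Longrightarrow> j < N \<Longrightarrow> cinner (b i) (b j) = (if i = j then 1 else 0)" by blast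
  have "cspan (b ` {..<N}) \<noteq> UNIV" using assms by (metis finite_imageI finite_lessThan)
  then obtain x where x: "x \<notin> cspan (b ` {..<N})" by blast
  define y where "y = x - (\<Sum>i<N. cinner x (b i) *\<^sub>C b i)"
  have "(\<Sum>i<N. cinner x (b i) *\<^sub>C b i) \<in> cspan (b ` {..<N})"
    by (intro complex_vector.span_sum complex_vector.span_scale complex_vector.span_base) auto
  then have "y \<noteq> 0" using x by (auto simp: y_def)
  have yb: "cinner y (b j) = 0" if "j < N" for j
  proof -
    have "(\<Sum>i<N. cinner x (b i) * cinner (b i) (b j)) = (\<Sum>i<N. if j = i then cinner x (b j) else 0)"
      using that by (intro sum.cong) (auto simp: b)
    then show ?thesis
      using that by (simp add: y_def cinner_diff_left cinner_sum_left cinner_scaleC_left)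
  qed
  define e where "e = complex_of_real (inverse (norm y)) *\<^sub>C y"
  have "cinner e e = complex_of_real (inverse (norm y) * inverse (norm y) * (norm y)\<^sup>2)"
    unfolding e_def cinner_scaleC_left cinner_scaleC_right cinner_self[of y] by simp
  also have "inverse (norm y) * inverse (norm y) * (norm y)\<^sup>2 = 1"
    using \<open>y \<noteq> 0\<close> by (simp add: field_simps power2_eq_square)
  finally have e: "cinner e e = 1" by simp
  have e0: "cinner e (b j) = 0" "cinner (b j) e = 0" if "j < N" for j
    using yb[OF that] cinner_commute[of "b j" y]
    by (simp_all add: e_def cinner_scaleC_left cinner_scaleC_right)
  have "cinner ((b(N := e)) i) ((b(N := e)) j) = (if i = j then 1 else 0)"
    if "i < Suc N" "j < Suc N" for i j
    using that b[of i j] by (auto simp: less_Suc_eq e e0)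
  then show ?case by blast
qed simp

lemma exists_unit_vector:
  assumes "\<not> (\<exists>B :: 'h::complex_inner set. finite B \<and> cspan B = UNIV)"
  obtains e :: "'h::complex_inner" where "norm e = 1"
proof -
  obtain e :: 'h where e: "cinner e e = 1" using infinite_dim_orthonormal[OF assms, of 1] by auto
  then have "complex_of_real ((norm e)\<^sup>2) = complex_of_real 1" by (simp add: cinner_self)
  then have "(norm e)\<^sup>2 = 1\<^sup>2" by (simp only: of_real_eq_iff one_power2)
  then have "norm e = 1" by (rule power2_eq_imp_eq) simp_all
  then show ?thesis by (rule that)
qed

lemma unitary_groupI:
  assumes "\<And>x y. U (x + y) = U x + U y" "\<And>c x. U (c *\<^sub>C x) = c *\<^sub>C U x"
    "\<And>x. U (V x) = x" "\<And>x y. cinner (U x) (U y) = cinner x y"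
  shows "U \<in> unitary_group"
  unfolding unitary_group_def using assms surjI[of U V] by (simp add: clinear_def)

lemma householder:
  fixes v :: "'h::complex_inner"
  assumes "v \<noteq> 0"
  defines "H \<equiv> \<lambda>z. z - (2 * cinner z v / cinner v v) *\<^sub>C v"
  shows "H (z + w) = H z + H w" "H (c *\<^sub>C z) = c *\<^sub>C H z" "H (H z) = z"
    "cinner (H z) (H w) = cinner z w"
proof -
  have q: "cinner v v \<noteq> 0" "cnj (cinner v v) = cinner v v"
    using assms(1) by (simp_all add: cinner_self)
  show "H (z + w) = H z + H w" "H (c *\<^sub>C z) = c *\<^sub>C H z"
    by (simp_all add: H_def cinner_simps scaleC_add_left scaleC_scaleC scaleC_simps distrib_left
        add_divide_distrib mult.left_commute)
  have "cinner (H z) v = - cinner z v" using q by (simp add: H_def cinner_simps)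
  then have "H (H z) = H z + (2 * cinner z v / cinner v v) *\<^sub>C v"
    by (subst (1) H_def) (simp add: scaleC_simps)
  then show "H (H z) = z" by (simp add: H_def)
  show "cinner (H z) (H w) = cinner z w"
    using q cinner_commute[of v w] by (simp add: H_def cinner_simps)
qed

text \<open>For equal norms, the Householder reflection along x - y sends x to y only if
  \<open>cinner x y\<close> is real. Hence x is first multiplied by a phase \<theta> that turns this
  inner product into its modulus.\<close>

lemma unitary_transitive:
  fixes x y :: "'h::complex_inner"
  assumes "norm x = norm y"
  shows "\<exists>U\<in>unitary_group. U x = y"
proof -
  define \<theta> where "\<theta> = (if cinner x y = 0 then 1 else cnj (cinner x y) / complex_of_real (cmod (cinner x y)))"
  define r where "r = complex_of_real (cmod (cinner x y))"
  have rr: "cinner x y * cnj (cinner x y) = r * r"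
    by (simp only: complex_norm_square[symmetric] power2_eq_square of_real_mult r_def)
  have r: "cnj r = r" "r = 0 \<longleftrightarrow> cinner x y = 0" by (simp_all add: r_def)
  have \<theta>_eq: "\<theta> = cnj (cinner x y) / r" if "cinner x y \<noteq> 0"
    using that by (simp add: \<theta>_def r_def)
  have \<theta>: "\<theta> * cnj \<theta> = 1"
  proof (cases "cinner x y = 0")
    case False
    then have "\<theta> * cnj \<theta> = (cinner x y * cnj (cinner x y)) / (r * r)"
      unfolding \<theta>_eq[OF False] by (simp add: r(1))
    then show ?thesis using False r(2) unfolding rr by simp
  qed (simp add: \<theta>_def)
  have \<theta>0: "\<theta> \<noteq> 0" using \<theta> by auto
  have real: "\<theta> * cinner x y = r"
  proof (cases "cinner x y = 0")
    case False
    then have "\<theta> * cinner x y = (cinner x y * cnj (cinner x y)) / r"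
      unfolding \<theta>_eq[OF False] by simp
    then show ?thesis using False r(2) unfolding rr by simp
  qed (simp add: r_def)
  have real': "cnj \<theta> * cinner y x = r"
    using arg_cong[OF real, of cnj] cinner_commute[of y x] by (simp add: r_def)
  define v where "v = \<theta> *\<^sub>C x - y"
  define H where "H z = z - (2 * cinner z v / cinner v v) *\<^sub>C v" for z
  define U where "U z = (if v = 0 then \<theta> *\<^sub>C z else H (\<theta> *\<^sub>C z))" for z
  note hh = householder[of v, folded H_def]
  have "U \<in> unitary_group"
  proof (rule unitary_groupI[where V = "\<lambda>z. inverse \<theta> *\<^sub>C (if v = 0 then z else H z)"])
    show "U (z + w) = U z + U w" for z w by (simp add: U_def hh scaleC_add_right)
    show "U (c *\<^sub>C z) = c *\<^sub>C U z" for c z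
      by (simp add: U_def hh scaleC_scaleC mult.commute)
    show "U (inverse \<theta> *\<^sub>C (if v = 0 then z else H z)) = z" for z
      by (simp add: U_def hh scaleC_scaleC \<theta>0 scaleC_simps)
    have "cinner (\<theta> *\<^sub>C z) (\<theta> *\<^sub>C w) = cinner z w" for z w
      using \<theta> by (simp add: cinner_simps mult.commute[of "cnj \<theta>"] flip: mult.assoc)
    then show "cinner (U z) (U w) = cinner z w" for z w by (simp add: U_def hh(4))
  qed
  moreover have "U x = y"
  proof (cases "v = 0")
    case False
    define q where "q = complex_of_real ((norm y)\<^sup>2)"
    have xx: "cinner x x = q" "cinner y y = q" by (simp_all only: cinner_self q_def assms)
    have \<theta>q: "\<theta> * (cnj \<theta> * q) = q" using \<theta> by (metis mult.assoc mult_1_left)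
    have v1: "cinner (\<theta> *\<^sub>C x) v = q - r"
      using \<theta>q real by (simp only: v_def cinner_diff_right cinner_scaleC_left cinner_scaleC_right xx mult.left_commute)
    have v2: "cinner y v = r - q"
      using real' by (simp only: v_def cinner_diff_right cinner_scaleC_right xx)
    have "cinner v v = cinner (\<theta> *\<^sub>C x) v - cinner y v"
      by (simp only: cinner_diff_left[symmetric] v_def[symmetric])
    then have vv: "cinner v v = 2 * (q - r)" unfolding v1 v2 by simp
    have "cinner v v \<noteq> 0" using False by (simp add: cinner_self)
    then have "2 * cinner (\<theta> *\<^sub>C x) v / cinner v v = 1"
      unfolding vv v1 by (rule divide_self)
    then have "H (\<theta> *\<^sub>C x) = \<theta> *\<^sub>C x - v" by (simp add: H_def scaleC_simps)
    then show ?thesis using False by (simp add: U_def v_def)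
  qed (simp add: U_def v_def)
  ultimately show ?thesis by blast
qed

section \<open>Positive functionals on the CCR algebra\<close>

lemma cdual_linear: "clinear (cdual_apply \<omega>)" "bounded_linear (cdual_apply \<omega>)"
  using cdual_apply[of \<omega>] by auto

lemma cdual_apply_simps:
  "cdual_apply \<omega> (a + b) = cdual_apply \<omega> a + cdual_apply \<omega> b"
  "cdual_apply \<omega> (c *\<^sub>C a) = c * cdual_apply \<omega> a"
  "cdual_apply \<omega> (a - b) = cdual_apply \<omega> a - cdual_apply \<omega> b"
  "cdual_apply \<omega> (sum F A) = (\<Sum>i\<in>A. cdual_apply \<omega> (F i))"
  using cdual_linear[of \<omega>]
  by (simp_all add: clinear_def scaleC_complex_def linear_simps linear_sum[OF clinear_imp_linear])

lemma star_ccr_sum_mult: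
  "star (\<Sum>i\<in>A. c i *\<^sub>C ccr_W (x i)) * (\<Sum>j\<in>A. c j *\<^sub>C ccr_W (x j))
   = (\<Sum>i\<in>A. \<Sum>j\<in>A. (cnj (c i) * c j * cis (- symp_form (x i) (x j))) *\<^sub>C ccr_W (x j - x i))"
  unfolding star_sum sum_product
  by (intro sum.cong refl)
    (simp add: star_scaleC star_ccr_W mult_scaleC_left mult_scaleC_right scaleC_scaleC ccr_W_mult mult_ac)

lemma state_pos:
  assumes "\<omega> \<in> states"
  shows "0 \<le> Re (\<Sum>i\<in>A. \<Sum>j\<in>A. cnj (c i) * c j * cis (- symp_form (x i) (x j)) *
           cdual_apply \<omega> (ccr_W (x j - x i)))"
proof -
  have "cdual_apply \<omega> (star (\<Sum>i\<in>A. c i *\<^sub>C ccr_W (x i)) * (\<Sum>j\<in>A. c j *\<^sub>C ccr_W (x j))) \<in> \<real>\<^sub>\<ge>\<^sub>0"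
    using assms by (simp add: states_def)
  then show ?thesis
    unfolding star_ccr_sum_mult by (simp add: cdual_apply_simps complex_nonneg_Reals_iff)
qed

lemma state_one: "\<omega> \<in> states \<Longrightarrow> cdual_apply \<omega> 1 = 1"
  by (simp add: states_def)

text \<open>Transitivity on spheres leaves only the norm. As x and -x have equal norm, positivity at
  \<open>1 + ccr_W x\<close> says that 2 + 2 \<omega>(W(x)) is a nonnegative real, so the value is
  real.\<close>

lemma invariant_state_radial:
  fixes \<omega> :: "'h::complex_inner ccr cdual"
  assumes \<omega>: "\<omega> \<in> invariant_states" and e: "norm (e :: 'h) = 1"
  shows "cdual_apply \<omega> (ccr_W x) = complex_of_real (Re (cdual_apply \<omega> (ccr_W (norm x *\<^sub>R e))))"
proof -
  have inv: "cdual_apply \<omega> (ccr_W y) = cdual_apply \<omega> (ccr_W z)" if "norm y = norm z" for y z :: 'h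
  proof -
    obtain U where U: "U \<in> unitary_group" "U y = z" using unitary_transitive[OF \<open>norm y = norm z\<close>] by blast
    then have "cdual_apply \<omega> (ccr_rho U (ccr_W y)) = cdual_apply \<omega> (ccr_W y)"
      using \<omega> by (auto simp: invariant_states_def fun_eq_iff)
    then show ?thesis using U by (simp add: ccr_rho(2))
  qed
  have st: "\<omega> \<in> states" using \<omega> by (simp add: invariant_states_def)
  have "cdual_apply \<omega> (star (1 + ccr_W x) * (1 + ccr_W x)) \<in> \<real>\<^sub>\<ge>\<^sub>0"
    using st by (simp add: states_def)
  also have "star (1 + ccr_W x) * (1 + ccr_W x) = (1 + 1) + (ccr_W x + ccr_W (- x))"
    by (simp add: ccr_W_zero[symmetric] star_add star_ccr_W distrib_left distrib_right ccr_W_mult scaleC_simps)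
  finally have "cdual_apply \<omega> 1 + cdual_apply \<omega> 1 + (cdual_apply \<omega> (ccr_W x) + cdual_apply \<omega> (ccr_W x)) \<in> \<real>\<^sub>\<ge>\<^sub>0"
    using inv[of "- x" x] by (simp only: cdual_apply_simps norm_minus_cancel)
  then have "Im (cdual_apply \<omega> (ccr_W x)) = 0"
    by (simp add: state_one[OF st] complex_nonneg_Reals_iff)
  then show ?thesis using inv[of x "norm x *\<^sub>R e"] e by (simp add: complex_eq_iff)
qed

lemma sum_Times_fst:
  fixes g :: "nat \<Rightarrow> 'a::comm_semiring_1"
  shows "(\<Sum>p\<in>{..<n} \<times> {..<N}. g (fst p)) = of_nat N * (\<Sum>i<n. g i)"
  by (simp add: sum.cartesian_product[symmetric, where g = "\<lambda>i _. g i", unfolded case_prod_beta]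
      sum_distrib_left)

text \<open>
  Each Weyl unitary is replaced by its mean over \<open>N\<close> displacements in mutually orthogonal
  directions.  Distinct directions contribute \<open>f (\<dots> + t i + t j)\<close>; the diagonal terms, which do
  not, have total weight \<open>1 / N\<close>.
\<close>

lemma state_radial_pos:
  fixes \<omega> :: "'h::complex_inner ccr cdual" and z c :: "nat \<Rightarrow> complex"
  assumes \<omega>: "\<omega> \<in> states"
    and rad: "\<And>x. cdual_apply \<omega> (ccr_W x) = complex_of_real (f ((norm x)\<^sup>2))"
    and onb: "\<And>N. \<exists>b :: nat \<Rightarrow> 'h. \<forall>i<N. \<forall>j<N. cinner (b i) (b j) = (if i = j then 1 else 0)"
    and t: "\<And>i. i < n \<Longrightarrow> 0 \<le> t i"
  shows "0 \<le> Re (\<Sum>i<n. \<Sum>j<n. cnj (c i) * c j * cis (- Im (z i * cnj (z j))) *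
           complex_of_real (f ((cmod (z j - z i))\<^sup>2 + t i + t j)))"
proof -
  define K where "K i j = cnj (c i) * c j * cis (- Im (z i * cnj (z j))) *
           complex_of_real (f ((cmod (z j - z i))\<^sup>2 + t i + t j))" for i j
  \<comment> \<open>Diagonal correction: for p = q the difference of the two vectors is 0, so the
    state contributes f 0 in place of f (2 t i).\<close>
  define L where "L i = cnj (c i) * c i * complex_of_real (f 0 - f (2 * t i))" for i
  have fin: "0 \<le> Re (\<Sum>i<n. \<Sum>j<n. K i j) + 1 / real N * Re (\<Sum>i<n. L i)" if N: "0 < N" for N
  proof -
    obtain b :: "nat \<Rightarrow> 'h" where b: "\<And>i j. i < 1 + n * N \<Longrightarrow> j < 1 + n * N \<Longrightarrow>
        cinner (b i) (b j) = (if i = j then 1 else 0)"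
      using onb[of "1 + n * N"] by blast
    define A where "A = {..<n} \<times> {..<N}"
    \<comment> \<open>An injective numbering of the private directions, starting at 1 because
      \<open>b 0\<close> is the common mode.\<close>
    define idx where "idx p = 1 + (fst p * N + snd p)" for p :: "nat \<times> nat"
    have idx: "idx p < 1 + n * N" if "p \<in> A" for p
    proof -
      have "fst p * N + snd p < fst p * N + N" "fst p + 1 \<le> n" using that by (auto simp: A_def)
      moreover from this(2) have "(fst p + 1) * N \<le> n * N" by (rule mult_le_mono1)
      ultimately show ?thesis by (simp add: idx_def)
    qed
    have idx_inj: "idx p = idx q \<longleftrightarrow> p = q" if "p \<in> A" "q \<in> A" for p q
    proof
      assume "idx p = idx q"
      then have eq: "fst p * N + snd p = fst q * N + snd q" by (simp add: idx_def)
      have "snd p < N" "snd q < N" using that by (auto simp: A_def)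
      then have "fst p = fst q" using arg_cong[OF eq, of "\<lambda>k. k div N"] by simp
      then show "p = q" using eq by (simp add: prod_eq_iff)
    qed simp
    \<comment> \<open>The component along \<open>b 0\<close> is the mode left quantum: it alone
      carries the symplectic form between distinct vectors. The private directions merely add t i +
      t j to the squared distance.\<close>
    define x where "x p = z (fst p) *\<^sub>C b 0 + complex_of_real (sqrt (t (fst p))) *\<^sub>C b (idx p)" for p
    have b': "cinner (b 0) (b 0) = 1" "cinner (b (idx p)) (b 0) = 0" "cinner (b 0) (b (idx p)) = 0"
      "cinner (b (idx p)) (b (idx q)) = (if p = q then 1 else 0)" if "p \<in> A" "q \<in> A" for p q
      using that idx[of p] idx[of q] idx_inj[of p q] by (simp_all add: b) (simp_all add: idx_def b)
    have xx: "cinner (x p) (x q) = z (fst p) * cnj (z (fst q)) + (if p = q then complex_of_real (t (fst p)) else 0)"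
      if "p \<in> A" "q \<in> A" for p q
    proof -
      have "complex_of_real (sqrt (t (fst p))) * complex_of_real (sqrt (t (fst p))) = complex_of_real (t (fst p))"
        using t[of "fst p"] that by (auto simp: A_def simp flip: of_real_mult)
      then show ?thesis using b'[OF that] b'[OF that(2,1)]
        by (cases "p = q") (simp_all add: x_def cinner_simps)
    qed
    have norm_x: "(norm (x p))\<^sup>2 = (cmod (z (fst p)))\<^sup>2 + t (fst p)" if "p \<in> A" for p
    proof -
      have "(norm (x p))\<^sup>2 = Re (cinner (x p) (x p))" by (simp add: cinner_self)
      also have "\<dots> = (cmod (z (fst p)))\<^sup>2 + t (fst p)"
        unfolding xx[OF that that] by (simp add: complex_mult_cnj cmod_power2)
      finally show ?thesis .
    qed
    have norm_xx: "(norm (x q - x p))\<^sup>2 = (cmod (z (fst q) - z (fst p)))\<^sup>2 + t (fst p) + t (fst q)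
        - (if p = q then 2 * t (fst p) else 0)" if "p \<in> A" "q \<in> A" for p q
      unfolding norm_diff_sq norm_x[OF that(1)] norm_x[OF that(2)] xx[OF that(2,1)] cmod_power2
      by (auto simp: power2_eq_square algebra_simps)
    have symp: "symp_form (x p) (x q) = Im (z (fst p) * cnj (z (fst q)))" if "p \<in> A" "q \<in> A" for p q
      unfolding symp_form_def xx[OF that] by simp
    define c' where "c' p = c (fst p) / complex_of_real (real N)" for p :: "nat \<times> nat"
    have "0 \<le> Re (\<Sum>p\<in>A. \<Sum>q\<in>A. cnj (c' p) * c' q * cis (- symp_form (x p) (x q)) *
           cdual_apply \<omega> (ccr_W (x q - x p)))"
      by (rule state_pos[OF \<omega>])
    also have "(\<Sum>p\<in>A. \<Sum>q\<in>A. cnj (c' p) * c' q * cis (- symp_form (x p) (x q)) *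
           cdual_apply \<omega> (ccr_W (x q - x p)))
        = (\<Sum>p\<in>A. \<Sum>q\<in>A. K (fst p) (fst q) / (of_nat N)\<^sup>2 + (if p = q then L (fst p) / (of_nat N)\<^sup>2 else 0))"
    proof (intro sum.cong refl)
      fix p q assume pq: "p \<in> A" "q \<in> A"
      show "cnj (c' p) * c' q * cis (- symp_form (x p) (x q)) * cdual_apply \<omega> (ccr_W (x q - x p))
          = K (fst p) (fst q) / (of_nat N)\<^sup>2 + (if p = q then L (fst p) / (of_nat N)\<^sup>2 else 0)"
      proof (cases "p = q")
        case True
        show ?thesis
          unfolding rad True K_def L_def c'_def
          by (simp add: power2_eq_square diff_divide_distrib algebra_simps)
      next
        case False
        then show ?thesis
          unfolding rad norm_xx[OF pq] symp[OF pq] K_def c'_def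
          by (simp add: power2_eq_square field_simps)
      qed
    qed
    also have "\<dots> = (\<Sum>p\<in>A. \<Sum>q\<in>A. K (fst p) (fst q) / (of_nat N)\<^sup>2) + (\<Sum>p\<in>A. L (fst p) / (of_nat N)\<^sup>2)"
      by (simp add: sum.distrib A_def)
    also have "(\<Sum>p\<in>A. \<Sum>q\<in>A. K (fst p) (fst q) / (of_nat N)\<^sup>2) = (\<Sum>i<n. \<Sum>j<n. K i j)"
    proof -
      have "(\<Sum>p\<in>A. \<Sum>q\<in>A. K (fst p) (fst q) / (of_nat N)\<^sup>2)
          = of_nat N * (\<Sum>i<n. of_nat N * (\<Sum>j<n. K i j / (of_nat N)\<^sup>2))"
        unfolding A_def sum_Times_fst[of "\<lambda>j. K i j / (of_nat N)\<^sup>2" for i]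
          sum_Times_fst[of "\<lambda>i. of_nat N * (\<Sum>j<n. K i j / (of_nat N)\<^sup>2)"] ..
      also have "\<dots> = (\<Sum>i<n. \<Sum>j<n. K i j)"
        using N by (simp add: sum_distrib_left power2_eq_square)
      finally show ?thesis .
    qed
    also have "(\<Sum>p\<in>A. L (fst p) / (of_nat N)\<^sup>2) = complex_of_real (1 / real N) * (\<Sum>i<n. L i)"
      using N unfolding A_def sum_Times_fst[of "\<lambda>i. L i / (of_nat N)\<^sup>2"]
      by (simp add: power2_eq_square sum_divide_distrib[symmetric])
    also have "Re (v + complex_of_real r * w) = Re v + r * Re w" for v w r by simp
    finally show ?thesis .
  qed
  define X Y where "X = Re (\<Sum>i<n. \<Sum>j<n. K i j)" and "Y = Re (\<Sum>i<n. L i)"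
  have "(\<lambda>k. X + 1 / real (Suc k) * Y) \<longlonglongrightarrow> X"
    by real_asymp
  then have "0 \<le> X"
    by (rule LIMSEQ_le_const) (use fin in \<open>auto simp: X_def Y_def simp del: of_nat_Suc\<close>)
  then show ?thesis by (simp add: X_def K_def)
qed

text \<open>Combining \<open>step\<close> with log-convexity bounds the ratio x = f (t + 2 u) / f t
  by x^2 + 2 x sin u <= 1, so x is at most the positive root \<open>\<rho> u\<close>, which is 1 - u
  to first order. Covering [0, T] by k + 1 steps of length 2 u and letting k grow turns the product
  of these factors into exp (-T / 2).\<close>

lemma pos_def_decay:
  assumes f: "pos_def f" "f 0 = 1"
    and step: "\<And>t u. 0 \<le> t \<Longrightarrow> 0 < u \<Longrightarrow> f (t + 4 * u) + 2 * sin u * f (t + 2 * u) \<le> f t"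
    and T: "0 \<le> T"
  shows "f T \<le> exp (- T / 2)"
proof (cases "T = 0")
  case False
  then have T: "0 < T" using T by simp
  define \<rho> where "\<rho> u = sqrt (1 + (sin u)\<^sup>2) - sin u" for u :: real
  have \<rho>_pos: "0 \<le> \<rho> u" for u
    using real_sqrt_le_mono[of "(sin u)\<^sup>2" "1 + (sin u)\<^sup>2"] by (simp add: \<rho>_def)
  have one: "f (t + 2 * u) \<le> \<rho> u * f t" if tu: "0 \<le> t" "0 < u" for t u
  proof -
    have a: "0 \<le> f t" using pos_def_nonneg[OF f(1) tu(1)] .
    have "(f (t + 2 * u))\<^sup>2 \<le> f t * f (t + 4 * u)"
      using pos_def_log_convex[OF f(1) tu(1), of "2 * u"] tu by simp
    moreover have "f t * (f (t + 4 * u) + 2 * sin u * f (t + 2 * u)) \<le> f t * f t"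
      by (intro mult_left_mono step tu a)
    moreover have "(b + r * a)\<^sup>2 \<le> (1 + r\<^sup>2) * a\<^sup>2"
      if "b\<^sup>2 \<le> a * d" "a * (d + 2 * r * b) \<le> a * a" for a b d r :: real
      using that by (simp add: power2_eq_square algebra_simps)
    ultimately have "(f (t + 2 * u) + sin u * f t)\<^sup>2 \<le> (1 + (sin u)\<^sup>2) * (f t)\<^sup>2"
      by blast
    then have "f (t + 2 * u) + sin u * f t \<le> sqrt ((1 + (sin u)\<^sup>2) * (f t)\<^sup>2)"
      by (rule real_le_rsqrt)
    also have "\<dots> = sqrt (1 + (sin u)\<^sup>2) * f t" using a by (simp add: real_sqrt_mult)
    finally show ?thesis by (simp add: \<rho>_def left_diff_distrib)
  qed
  have iter: "f (2 * u * real k) \<le> \<rho> u ^ k" if "0 < u" for u k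
  proof (induction k)
    case (Suc k)
    have "f (2 * u * real (Suc k)) \<le> \<rho> u * f (2 * u * real k)"
      using one[of "2 * u * real k" u] that by (simp add: algebra_simps)
    also have "\<dots> \<le> \<rho> u * \<rho> u ^ k" by (intro mult_left_mono Suc \<rho>_pos)
    finally show ?case by simp
  qed (simp add: f)
  have "f T \<le> \<rho> (T / (2 * real (Suc k))) ^ Suc k" for k
    using iter[of "T / (2 * real (Suc k))" "Suc k"] T by (simp del: of_nat_Suc power_Suc)
  moreover have "(\<lambda>k. \<rho> (T / (2 * real (Suc k))) ^ Suc k) \<longlonglongrightarrow> exp (- T / 2)"
    unfolding \<rho>_def using T by real_asymp
  ultimately show ?thesis by (auto intro!: LIMSEQ_le_const)
qed (simp add: f)

lemma invariant_state_representation: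
  fixes \<omega> :: "'h::complex_inner ccr cdual"
  assumes \<omega>: "\<omega> \<in> invariant_states"
    and dim: "\<not> (\<exists>B :: 'h set. finite B \<and> cspan B = UNIV)"
  obtains M where "real_distribution M" "AE y in M. 0 \<le> y \<and> y \<le> 1"
    "\<And>x. x \<noteq> 0 \<Longrightarrow> cdual_apply \<omega> (ccr_W x) =
       complex_of_real (exp (- (norm x)\<^sup>2 / 2) * (\<integral>y. y powr ((norm x)\<^sup>2 / 2) \<partial>M))"
proof -
  note onb = infinite_dim_orthonormal[OF dim]
  obtain e :: 'h where e: "norm e = 1" using exists_unit_vector[OF dim] .
  have st: "\<omega> \<in> states" using \<omega> by (simp add: invariant_states_def)
  define f where "f t = Re (cdual_apply \<omega> (ccr_W (sqrt t *\<^sub>R e)))" for t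
  have rad: "cdual_apply \<omega> (ccr_W x) = complex_of_real (f ((norm x)\<^sup>2))" for x
    using invariant_state_radial[OF \<omega> e, of x] by (simp add: f_def)
  have f0: "f 0 = 1" by (simp add: f_def ccr_W_zero state_one[OF st])
  have f: "pos_def f"
    unfolding pos_def_def
  proof (intro allI impI)
    fix n and c t :: "nat \<Rightarrow> real"
    assume "\<forall>i<n. 0 \<le> t i"
    then show "0 \<le> (\<Sum>i<n. \<Sum>j<n. c i * c j * f (t i + t j))"
      using state_radial_pos[OF st rad onb, of n t "\<lambda>i. complex_of_real (c i)" "\<lambda>_. 0"]
      by simp
  qed
  \<comment> \<open>The uncertainty principle: for small \<open>u\<close> the element
    \<open>\<Sum>k<4. \<i>^k W(\<i>^k \<surd>u e)\<close> approximates a multiple of an annihilation operator.\<close>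
  have step: "f (t + 4 * u) + 2 * sin u * f (t + 2 * u) \<le> f t" if tu: "0 \<le> t" "0 < u" for t u
  proof -
    define s where "s = sqrt u"
    have s: "s * s = u" using tu by (simp add: s_def)
    define w :: "nat \<Rightarrow> complex" where "w i = [1, \<i>, -1, -\<i>] ! i" for i
    define z where "z i = complex_of_real s * w i" for i
    have w: "w 0 = 1" "w (Suc 0) = \<i>" "w (Suc (Suc 0)) = -1" "w (Suc (Suc (Suc 0))) = -\<i>"
      by (simp_all add: w_def)
    have "z i * cnj (z j) = complex_of_real (s * s) * (w i * cnj (w j))"
      "z j - z i = complex_of_real s * (w j - w i)" for i j
      by (simp_all add: z_def right_diff_distrib)
    moreover have "(cmod (complex_of_real s * v))\<^sup>2 = s * s * (cmod v)\<^sup>2" for v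
      by (simp add: norm_mult power_mult_distrib) (simp add: power2_eq_square)
    ultimately have zz: "Im (z i * cnj (z j)) = u * Im (w i * cnj (w j))"
      "(cmod (z j - z i))\<^sup>2 = u * (cmod (w j - w i))\<^sup>2" for i j
      unfolding s by simp_all
    have "0 \<le> Re (\<Sum>i<Suc (Suc (Suc (Suc 0))). \<Sum>j<Suc (Suc (Suc (Suc 0))).
        cnj (w i) * w j * cis (- Im (z i * cnj (z j))) *
        complex_of_real (f ((cmod (z j - z i))\<^sup>2 + t / 2 + t / 2)))"
      by (rule state_radial_pos[OF st rad onb]) (use tu in simp)
    \<comment> \<open>Of the 16 ordered pairs the 4 equal ones give f t each and the 4 opposite ones
      -f (t + 4 u). Each of the 8 adjacent ones has coefficient \<i> or -\<i>, which with its Weyl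
      phase has real part -sin u.\<close>
    also have "\<dots> = 4 * (f t - f (t + 4 * u) - 2 * sin u * f (t + 2 * u))"
      unfolding zz by (simp add: w cmod_power2 algebra_simps)
    finally show ?thesis by simp
  qed
  \<comment> \<open>The factor exp t splits over sums, so positive definiteness survives, and with
    the argument 2 t it cancels the decay rate of \<open>pos_def_decay\<close> exactly, giving the
    bound 1.\<close>
  define g where "g t = exp t * f (2 * t)" for t
  have g: "pos_def g"
    unfolding pos_def_def
  proof (intro allI impI)
    fix n and c t :: "nat \<Rightarrow> real"
    assume "\<forall>i<n. 0 \<le> t i"
    then have "0 \<le> (\<Sum>i<n. \<Sum>j<n. (c i * exp (t i)) * (c j * exp (t j)) * f (2 * t i + 2 * t j))"
      by (intro pos_defD[OF f]) auto
    then show "0 \<le> (\<Sum>i<n. \<Sum>j<n. c i * c j * g (t i + t j))"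
      by (simp add: g_def exp_add algebra_simps)
  qed
  have "\<bar>g t\<bar> \<le> 1" if "0 \<le> t" for t
  proof -
    have "0 \<le> f (2 * t)" "f (2 * t) \<le> exp (- t)"
      using pos_def_nonneg[OF f, of "2 * t"] pos_def_decay[OF f f0 step, of "2 * t"] that by simp_all
    then show ?thesis by (simp add: g_def exp_minus field_simps)
  qed
  from pos_def_bounded_representation[OF g this] obtain M
    where M: "real_distribution M" "AE y in M. 0 \<le> y \<and> y \<le> 1"
      "\<And>t. 0 < t \<Longrightarrow> (\<integral>y. y powr t \<partial>M) = g t"
    by (auto simp: g_def f0)
  show ?thesis
  proof (rule that[OF M(1,2)])
    fix x :: 'h assume "x \<noteq> 0"
    then have "(\<integral>y. y powr ((norm x)\<^sup>2 / 2) \<partial>M) = exp ((norm x)\<^sup>2 / 2) * f ((norm x)\<^sup>2)"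
      by (subst M(3)) (simp_all add: g_def)
    then show "cdual_apply \<omega> (ccr_W x) =
       complex_of_real (exp (- (norm x)\<^sup>2 / 2) * (\<integral>y. y powr ((norm x)\<^sup>2 / 2) \<partial>M))"
      by (simp add: rad exp_minus)
  qed
qed

section \<open>Positive functionals on the algebra of the Weyl relations\<close>

text \<open>Normalised positive functionals on the dense *-algebra, with no continuity assumed;
  continuity for the universal norm is derived in \<open>L_bound\<close>.\<close>

locale weyl_positive =
  fixes L :: "'h::complex_inner weyl \<Rightarrow> complex"
  assumes L_add: "L (f + g) = L f + L g"
    and L_scale: "L (c *\<^sub>C f) = c * L f"
    and L_pos: "L (star f * f) \<in> \<real>\<^sub>\<ge>\<^sub>0"
    and L_one: "L 1 = 1"
begin

lemma L_diff: "L (f - g) = L f - L g"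
  using L_add[of "f - g" g] by simp

definition gns :: "'h weyl \<Rightarrow> real" where
  "gns f = sqrt (Re (L (star f * f)))"

lemma gns_nonneg [simp]: "0 \<le> gns f"
  using L_pos[of f] by (simp add: gns_def complex_nonneg_Reals_iff)

lemma gns_sq: "L (star f * f) = complex_of_real ((gns f)\<^sup>2)"
  using L_pos[of f] by (simp add: gns_def complex_nonneg_Reals_iff complex_eq_iff)

text \<open>Polarisation: reality at f + g controls the imaginary part of the sum of the two mixed
  terms, reality at f + \<i> g the real part of their difference.\<close>

lemma L_star_mult: "L (star g * f) = cnj (L (star f * g))"
proof -
  have "L (star (f + g) * (f + g)) = L (star f * f) + L (star g * g) + (L (star f * g) + L (star g * f))"
    by (simp add: star_add distrib_left distrib_right L_add)
  then have 1: "Im (L (star f * g) + L (star g * f)) = 0"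
    unfolding gns_sq by (metis Im_complex_of_real add_0 plus_complex.sel(2))
  have "L (star (f + \<i> *\<^sub>C g) * (f + \<i> *\<^sub>C g)) = L (star f * f) + L (star g * g) + \<i> * (L (star f * g) - L (star g * f))"
    by (simp add: star_add star_scaleC distrib_left distrib_right L_add L_diff L_scale mult_scaleC_left
        mult_scaleC_right scaleC_scaleC scaleC_simps algebra_simps)
  then have 2: "Im (\<i> * (L (star f * g) - L (star g * f))) = 0"
    unfolding gns_sq by (metis Im_complex_of_real add_0 plus_complex.sel(2))
  show ?thesis using 1 2 by (simp add: complex_eq_iff)
qed

lemma gns_add_sq: "(gns (f + g))\<^sup>2 = (gns f)\<^sup>2 + 2 * Re (L (star f * g)) + (gns g)\<^sup>2"
proof -
  have "complex_of_real ((gns (f + g))\<^sup>2)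
      = complex_of_real ((gns f)\<^sup>2) + (L (star f * g) + L (star g * f)) + complex_of_real ((gns g)\<^sup>2)"
    unfolding gns_sq[symmetric] by (simp add: star_add distrib_left distrib_right L_add)
  then show ?thesis
    unfolding L_star_mult[of g f] by (simp add: complex_eq_iff)
qed

lemma gns_scaleC: "gns (c *\<^sub>C f) = cmod c * gns f"
proof -
  have "complex_of_real ((gns (c *\<^sub>C f))\<^sup>2) = c * cnj c * complex_of_real ((gns f)\<^sup>2)"
    unfolding gns_sq[symmetric]
    by (simp add: star_scaleC L_scale mult_scaleC_left mult_scaleC_right scaleC_scaleC mult.commute)
  also have "\<dots> = complex_of_real ((cmod c * gns f)\<^sup>2)"
    by (simp only: complex_norm_square[symmetric] of_real_mult[symmetric] power_mult_distrib)
  finally have "(gns (c *\<^sub>C f))\<^sup>2 = (cmod c * gns f)\<^sup>2" by (simp only: of_real_eq_iff)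
  then show ?thesis by (rule power2_eq_imp_eq) simp_all
qed

lemma gns_zero [simp]: "gns 0 = 0"
  using gns_scaleC[of 0 0] by simp

lemma gns_Cauchy_Schwarz: "cmod (L (star f * g)) \<le> gns f * gns g"
proof -
  define B where "B = L (star f * g)"
  \<comment> \<open>A phase turning B into its modulus, so that the discriminant bound controls
    \<open>cmod B\<close> and not just the real part of B.\<close>
  define \<theta> where "\<theta> = (if B = 0 then 1 else cnj B / complex_of_real (cmod B))"
  have \<theta>: "cmod \<theta> = 1" by (simp add: \<theta>_def norm_divide)
  have "B * cnj B = complex_of_real (cmod B) * complex_of_real (cmod B)"
    by (simp only: complex_norm_square[symmetric] power2_eq_square of_real_mult)
  then have \<theta>B: "\<theta> * B = complex_of_real (cmod B)"
    by (simp add: \<theta>_def mult.commute)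
  have "(cmod B)\<^sup>2 \<le> (gns f)\<^sup>2 * (gns g)\<^sup>2"
  proof (rule nonneg_quadratic_discriminant)
    fix x :: real
    define c where "c = complex_of_real x * \<theta>"
    have "L (star f * (c *\<^sub>C g)) = complex_of_real (x * cmod B)"
      by (simp add: mult_scaleC_right L_scale c_def B_def[symmetric] mult.assoc \<theta>B)
    moreover have "gns (c *\<^sub>C g) = \<bar>x\<bar> * gns g"
      by (simp add: gns_scaleC c_def norm_mult \<theta>)
    ultimately have "(gns (f + c *\<^sub>C g))\<^sup>2 = (gns f)\<^sup>2 + 2 * x * cmod B + x\<^sup>2 * (gns g)\<^sup>2"
      unfolding gns_add_sq by (simp add: power_mult_distrib)
    then show "0 \<le> (gns f)\<^sup>2 + 2 * x * cmod B + x\<^sup>2 * (gns g)\<^sup>2" by (metis zero_le_power2)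
  qed
  then have "(cmod B)\<^sup>2 \<le> (gns f * gns g)\<^sup>2" by (simp add: power_mult_distrib)
  then show ?thesis unfolding B_def by (rule power2_le_imp_le) simp
qed

lemma gns_add: "gns (f + g) \<le> gns f + gns g"
proof (rule power2_le_imp_le)
  have "Re (L (star f * g)) \<le> gns f * gns g"
    using gns_Cauchy_Schwarz[of f g] complex_Re_le_cmod order.trans by blast
  then show "(gns (f + g))\<^sup>2 \<le> (gns f + gns g)\<^sup>2"
    unfolding gns_add_sq by (simp add: power2_eq_square algebra_simps)
qed simp

lemma gns_gen_mult: "gns (weyl_gen x * g) = gns g"
proof -
  have "star (weyl_gen x * g) * (weyl_gen x * g) = star g * (star (weyl_gen x) * weyl_gen x) * g"
    by (simp add: star_mult mult.assoc)
  then show ?thesis unfolding gns_def by (simp add: star_gen_mult_gen)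
qed

lemma gns_sum: "gns (sum F A) \<le> (\<Sum>x\<in>A. gns (F x))"
proof (induction A rule: infinite_finite_induct)
  case (insert x A)
  then show ?case using gns_add[of "F x" "sum F A"] by simp
qed simp_all

lemma gns_mult_le: "gns (f * g) \<le> wl1 f * gns g"
proof -
  have "f * g = (\<Sum>x\<in>wsupp f. wcoeff f x *\<^sub>C (weyl_gen x * g))"
    by (subst weyl_expand[of f]) (simp add: sum_distrib_right weyl_mult_bilin)
  then have "gns (f * g) \<le> (\<Sum>x\<in>wsupp f. gns (wcoeff f x *\<^sub>C (weyl_gen x * g)))"
    by (metis gns_sum)
  also have "\<dots> = wl1 f * gns g"
    by (simp add: wl1_def gns_scaleC gns_gen_mult sum_distrib_right)
  finally show ?thesis .
qed

section \<open>The GNS operator norm as a C*-seminorm\<close>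

definition gns_bounds :: "'h weyl \<Rightarrow> real set" where
  "gns_bounds f = {B. 0 \<le> B \<and> (\<forall>g. gns (f * g) \<le> B * gns g)}"

definition gns_norm :: "'h weyl \<Rightarrow> real" where
  "gns_norm f = Inf (gns_bounds f)"

lemma gns_bounds_nonempty: "gns_bounds f \<noteq> {}"
proof -
  have "0 \<le> wl1 f" by (simp add: wl1_def sum_nonneg)
  then have "wl1 f \<in> gns_bounds f" by (simp add: gns_bounds_def gns_mult_le)
  then show ?thesis by blast
qed

lemma gns_norm_leI:
  assumes "0 \<le> B" "\<And>g. gns (f * g) \<le> B * gns g"
  shows "gns_norm f \<le> B"
  unfolding gns_norm_def
  by (rule cInf_lower) (use assms in \<open>auto simp: gns_bounds_def intro: bdd_belowI\<close>)

lemma gns_norm_nonneg [simp]: "0 \<le> gns_norm f"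
  unfolding gns_norm_def by (rule cInf_greatest[OF gns_bounds_nonempty]) (simp add: gns_bounds_def)

lemma gns_le_norm: "gns (f * g) \<le> gns_norm f * gns g"
proof (cases "gns g = 0")
  \<comment> \<open>By the l1 bound, left multiplication maps null vectors of the seminorm to null
    vectors, so no quotient is formed.\<close>
  case True
  then show ?thesis using gns_mult_le[of f g] by simp
next
  case False
  then have pos: "0 < gns g" using gns_nonneg[of g] by linarith
  have "gns (f * g) / gns g \<le> gns_norm f"
    unfolding gns_norm_def
    by (rule cInf_greatest[OF gns_bounds_nonempty]) (use pos in \<open>auto simp: gns_bounds_def field_simps\<close>)
  then show ?thesis using pos by (simp add: field_simps)
qed

lemma gns_norm_mult: "gns_norm (f * g) \<le> gns_norm f * gns_norm g"
proof (rule gns_norm_leI)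
  fix h
  have "gns (f * g * h) \<le> gns_norm f * gns (g * h)" by (metis mult.assoc gns_le_norm)
  also have "\<dots> \<le> gns_norm f * (gns_norm g * gns h)" by (intro mult_left_mono gns_le_norm) simp
  finally show "gns (f * g * h) \<le> gns_norm f * gns_norm g * gns h" by (simp add: mult.assoc)
qed simp

lemma gns_norm_sq_le: "(gns_norm f)\<^sup>2 \<le> gns_norm (star f * f)"
proof -
  have "gns_norm f \<le> sqrt (gns_norm (star f * f))"
  proof (rule gns_norm_leI)
    fix g
    have "(gns (f * g))\<^sup>2 = cmod (L (star g * ((star f * f) * g)))"
      using arg_cong[OF gns_sq[of "f * g"], of cmod] by (simp add: star_mult mult.assoc norm_power)
    also have "\<dots> \<le> gns g * gns ((star f * f) * g)" by (rule gns_Cauchy_Schwarz)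
    also have "\<dots> \<le> gns g * (gns_norm (star f * f) * gns g)" by (intro mult_left_mono gns_le_norm) simp
    finally have "gns (f * g) \<le> sqrt (gns_norm (star f * f) * (gns g)\<^sup>2)"
      by (intro real_le_rsqrt) (simp add: power2_eq_square algebra_simps)
    then show "gns (f * g) \<le> sqrt (gns_norm (star f * f)) * gns g" by (simp add: real_sqrt_mult)
  qed simp
  then show ?thesis by (simp add: real_le_rsqrt sqrt_ge_absD)
qed

lemma gns_norm_star_le: "gns_norm f \<le> gns_norm (star f)"
proof (cases "gns_norm f = 0")
  case False
  have "(gns_norm f)\<^sup>2 \<le> gns_norm (star f) * gns_norm f"
    by (rule order.trans[OF gns_norm_sq_le gns_norm_mult])
  then show ?thesis using False gns_norm_nonneg[of f] by (simp add: power2_eq_square)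
qed simp

lemma cstar_seminorm_gns: "cstar_seminorm gns_norm"
proof -
  have "gns_norm (f + g) \<le> gns_norm f + gns_norm g" for f g
  proof (rule gns_norm_leI)
    fix h
    have "gns ((f + g) * h) \<le> gns (f * h) + gns (g * h)" by (simp add: distrib_right gns_add)
    also have "\<dots> \<le> gns_norm f * gns h + gns_norm g * gns h" by (intro add_mono gns_le_norm)
    finally show "gns ((f + g) * h) \<le> (gns_norm f + gns_norm g) * gns h" by (simp add: algebra_simps)
  qed simp
  moreover have "gns_norm (c *\<^sub>C f) = cmod c * gns_norm f" for c f
  proof (rule antisym)
    have le: "gns_norm (c *\<^sub>C f) \<le> cmod c * gns_norm f" for c f
      by (rule gns_norm_leI) (simp_all add: mult_scaleC_left gns_scaleC mult.assoc mult_left_mono gns_le_norm)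
    show "gns_norm (c *\<^sub>C f) \<le> cmod c * gns_norm f" by (rule le)
    show "cmod c * gns_norm f \<le> gns_norm (c *\<^sub>C f)"
    proof (cases "c = 0")
      case False
      then have "gns_norm f \<le> cmod (inverse c) * gns_norm (c *\<^sub>C f)"
        using le[of "inverse c" "c *\<^sub>C f"] by (simp add: scaleC_scaleC scaleC_simps)
      then show ?thesis using False by (simp add: norm_inverse norm_divide field_simps)
    qed simp
  qed
  moreover have "gns_norm (star f * f) = (gns_norm f)\<^sup>2" for f
  proof (rule antisym)
    have "gns_norm (star f * f) \<le> gns_norm (star f) * gns_norm f" by (rule gns_norm_mult)
    also have "\<dots> \<le> gns_norm f * gns_norm f"
      using gns_norm_star_le[of "star f"] by (intro mult_right_mono) (simp_all add: star_star)
    finally show "gns_norm (star f * f) \<le> (gns_norm f)\<^sup>2" by (simp add: power2_eq_square)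
  qed (rule gns_norm_sq_le)
  ultimately show ?thesis by (simp add: cstar_seminorm_def gns_norm_mult)
qed

lemma L_bound: "cmod (L f) \<le> norm f"
proof -
  have "gns 1 = 1" by (simp add: gns_def L_one)
  then have "cmod (L f) \<le> gns f" using gns_Cauchy_Schwarz[of 1 f] by simp
  also have "\<dots> \<le> gns_norm f" using gns_le_norm[of f 1] \<open>gns 1 = 1\<close> by simp
  also have "\<dots> \<le> norm f" by (rule cstar_seminorm_le_norm[OF cstar_seminorm_gns])
  finally show ?thesis .
qed

lemma extends_to_state: "\<exists>\<omega>\<in>states. \<forall>f. cdual_apply \<omega> (completion_embed f) = L f"
proof -
  \<comment> \<open>The limit is asserted for every approximating sequence, so that each algebraic
    property below may be checked on a sequence of its own.\<close>
  have "\<exists>b. \<forall>X. (\<lambda>n. completion_embed (X n)) \<longlonglongrightarrow> a \<longrightarrow> (\<lambda>n. L (X n)) \<longlonglongrightarrow> b" for a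
  proof -
    obtain Y where Y: "Cauchy Y" "(\<lambda>n. completion_embed (Y n)) \<longlonglongrightarrow> a" by (rule completion_cases)
    have "Cauchy (\<lambda>n. L (Y n))"
      by (rule Cauchy_dominated[of Y Y 1 0]) (simp_all add: Y L_diff[symmetric] L_bound)
    then obtain b where b: "(\<lambda>n. L (Y n)) \<longlonglongrightarrow> b"
      using Cauchy_convergent convergent_def by blast
    have "(\<lambda>n. L (X n)) \<longlonglongrightarrow> b" if X: "(\<lambda>n. completion_embed (X n)) \<longlonglongrightarrow> a" for X
    proof -
      have "(\<lambda>n. completion_embed (X n - Y n)) \<longlonglongrightarrow> 0"
        using tendsto_diff[OF X Y(2)] by (simp add: completion_embed_diff)
      from tendsto_norm_zero[OF this] have "(\<lambda>n. norm (X n - Y n)) \<longlonglongrightarrow> 0" by simp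
      then have "(\<lambda>n. L (X n) - L (Y n)) \<longlonglongrightarrow> 0"
        by (rule Lim_null_comparison[rotated]) (simp add: L_diff[symmetric] L_bound)
      from tendsto_add[OF this b] show ?thesis by simp
    qed
    then show ?thesis by blast
  qed
  then obtain \<pi> where \<pi>: "\<And>a X. (\<lambda>n. completion_embed (X n)) \<longlonglongrightarrow> a \<Longrightarrow> (\<lambda>n. L (X n)) \<longlonglongrightarrow> \<pi> a"
    by metis
  have ex: "\<exists>X. (\<lambda>n. completion_embed (X n)) \<longlonglongrightarrow> a" for a :: "'h ccr"
    by (metis completion_cases)
  have \<pi>_embed: "\<pi> (completion_embed f) = L f" for f
    using \<pi>[of "\<lambda>_. f" "completion_embed f"] by (simp add: tendsto_const_iff)
  have add: "\<pi> (a + b) = \<pi> a + \<pi> b" for a b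
  proof -
    obtain X Y where X: "(\<lambda>n. completion_embed (X n)) \<longlonglongrightarrow> a"
      and Y: "(\<lambda>n. completion_embed (Y n)) \<longlonglongrightarrow> b" using ex by metis
    have "(\<lambda>n. completion_embed (X n + Y n)) \<longlonglongrightarrow> a + b"
      using tendsto_add[OF X Y] by (simp add: completion_embed_simps)
    from \<pi>[OF this] tendsto_add[OF \<pi>[OF X] \<pi>[OF Y]]
    show "\<pi> (a + b) = \<pi> a + \<pi> b" by (simp add: LIMSEQ_unique L_add)
  qed
  have scale: "\<pi> (c *\<^sub>C a) = c *\<^sub>C \<pi> a" and le: "norm (\<pi> a) \<le> norm a"
    and pos: "\<pi> (star a * a) \<in> \<real>\<^sub>\<ge>\<^sub>0" for a c
  proof -
    obtain X where X: "(\<lambda>n. completion_embed (X n)) \<longlonglongrightarrow> a" using ex by metis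
    have "(\<lambda>n. completion_embed (c *\<^sub>C X n)) \<longlonglongrightarrow> c *\<^sub>C a"
      using bounded_linear.tendsto[OF bounded_linear_scaleC X] by (simp add: completion_embed_simps)
    from \<pi>[OF this] bounded_linear.tendsto[OF bounded_linear_scaleC \<pi>[OF X]]
    show "\<pi> (c *\<^sub>C a) = c *\<^sub>C \<pi> a" by (auto intro: LIMSEQ_unique simp: L_scale scaleC_complex_def)
    show "norm (\<pi> a) \<le> norm a"
      using tendsto_norm[OF X] by (intro LIMSEQ_le[OF tendsto_norm[OF \<pi>[OF X]]]) (auto simp: L_bound)
    have "(\<lambda>n. completion_embed (star (X n) * X n)) \<longlonglongrightarrow> star a * a"
      using tendsto_mult[OF bounded_linear.tendsto[OF bounded_linear_star X] X]
      by (simp add: completion_embed_simps)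
    then show "\<pi> (star a * a) \<in> \<real>\<^sub>\<ge>\<^sub>0"
      by (intro closed_sequentially[OF closed_nonneg_Reals_complex _ \<pi>]) (auto simp: L_pos)
  qed
  have "bounded_linear \<pi>"
    by (rule bounded_linear_intro[of _ 1]) (simp_all add: add scaleR_scaleC scale le)
  then have "cdual_apply (Abs_cdual \<pi>) = \<pi>"
    by (intro Abs_cdual_inverse) (simp add: clinear_def add scale)
  moreover from this have "Abs_cdual \<pi> \<in> states"
    using pos \<pi>_embed[of 1] by (simp add: states_def completion_embed_simps L_one)
  ultimately show ?thesis using \<pi>_embed by (intro bexI[of _ "Abs_cdual \<pi>"]) auto
qed

end

lemma state_weyl_positive:
  assumes "\<omega> \<in> (states :: 'h::complex_inner ccr cdual set)"
  shows "weyl_positive (\<lambda>f. cdual_apply \<omega> (completion_embed f))"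
  using assms
  by unfold_locales (simp_all add: completion_embed_simps cdual_apply_simps states_def)

text \<open>The type only provides some bound. The constant 1, which compactness and the uniform
  estimates rely on, comes from regarding the state as a positive functional on the dense
  *-algebra.\<close>

lemma state_bound:
  assumes "\<omega> \<in> (states :: 'h::complex_inner ccr cdual set)"
  shows "cmod (cdual_apply \<omega> a) \<le> norm a"
proof -
  interpret weyl_positive "\<lambda>f. cdual_apply \<omega> (completion_embed f)"
    by (rule state_weyl_positive[OF assms])
  obtain X where X: "(\<lambda>n. completion_embed (X n)) \<longlonglongrightarrow> a" by (rule completion_cases)
  have "(\<lambda>n. norm (X n)) \<longlonglongrightarrow> norm a" using tendsto_norm[OF X] by simp
  then show ?thesis
    by (rule LIMSEQ_le[OF tendsto_norm[OF bounded_linear.tendsto[OF cdual_linear(2) X]]]) (simp add: L_bound)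
qed

section \<open>Gaussian states\<close>

text \<open>Finite sums of rank-one kernels: the closure properties below replace the Schur product theorem.\<close>

inductive gram :: "('a \<Rightarrow> 'a \<Rightarrow> complex) \<Rightarrow> bool" where
  gram_zero: "gram (\<lambda>i j. 0)"
| gram_step: "gram K \<Longrightarrow> gram (\<lambda>i j. cnj (v i) * v j + K i j)"

lemma gram_add:
  assumes "gram K" "gram L"
  shows "gram (\<lambda>i j. K i j + L i j)"
  using assms(1)
proof induction
  case (gram_step K v)
  from gram.gram_step[OF this(2), of v] show ?case by (simp add: add.assoc)
qed (simp add: assms(2))

lemma gram_rank_one_mult: "gram K \<Longrightarrow> gram (\<lambda>i j. cnj (v i) * v j * K i j)"
proof (induction rule: gram.induct)
  case (gram_step K w)
  from gram.gram_step[OF this(2), of "\<lambda>i. v i * w i"] show ?case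
    by (simp add: algebra_simps)
qed (simp add: gram_zero)

text \<open>The entrywise product distributes over the rank-one summands of one factor, and
  multiplying by a rank-one kernel only rescales vectors.\<close>

lemma gram_mult:
  assumes "gram K" "gram L"
  shows "gram (\<lambda>i j. K i j * L i j)"
  using assms(1)
proof induction
  case (gram_step K v)
  from gram_add[OF gram_rank_one_mult[OF assms(2), of v] this(2)] show ?case
    by (simp add: distrib_right)
qed (simp add: gram_zero)

lemma gram_rank_one: "gram (\<lambda>i j. cnj (v i) * v j)"
  using gram_step[OF gram_zero, of v] by simp

lemma gram_scale:
  assumes "gram K" "0 \<le> r"
  shows "gram (\<lambda>i j. complex_of_real r * K i j)"
  using gram_rank_one_mult[OF assms(1), of "\<lambda>_. complex_of_real (sqrt r)"] assms(2)
  by (simp flip: of_real_mult)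

lemma gram_cnj: "gram K \<Longrightarrow> gram (\<lambda>i j. cnj (K i j))"
proof (induction rule: gram.induct)
  case (gram_step K v)
  from gram.gram_step[OF this(2), of "\<lambda>i. cnj (v i)"] show ?case by simp
qed (simp add: gram_zero)

lemma gram_power:
  assumes "gram K"
  shows "gram (\<lambda>i j. K i j ^ n)"
proof (induction n)
  case 0
  then show ?case using gram_rank_one[of "\<lambda>_. 1"] by simp
next
  case (Suc n)
  from gram_mult[OF assms this] show ?case by simp
qed

lemma gram_sum: "(\<And>k. k < n \<Longrightarrow> gram (K k)) \<Longrightarrow> gram (\<lambda>i j. \<Sum>k<n::nat. K k i j)"
proof (induction n)
  case (Suc n)
  from gram_add[OF Suc.IH Suc.prems] Suc.prems show ?case by simp
qed (simp add: gram_zero)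

lemma gram_form:
  assumes "gram K"
  shows "(\<Sum>i\<in>A. \<Sum>j\<in>A. cnj (c i) * c j * K i j) \<in> \<real>\<^sub>\<ge>\<^sub>0"
  using assms
proof induction
  case (gram_step K v)
  have "(\<Sum>i\<in>A. \<Sum>j\<in>A. cnj (c i) * c j * (cnj (v i) * v j + K i j))
      = (\<Sum>i\<in>A. \<Sum>j\<in>A. cnj (c i * v i) * (c j * v j)) + (\<Sum>i\<in>A. \<Sum>j\<in>A. cnj (c i) * c j * K i j)"
    by (simp add: sum.distrib algebra_simps)
  also have "(\<Sum>i\<in>A. \<Sum>j\<in>A. cnj (c i * v i) * (c j * v j)) = cnj (\<Sum>i\<in>A. c i * v i) * (\<Sum>i\<in>A. c i * v i)"
    by (simp only: sum_product cnj_sum)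
  also have "\<dots> = complex_of_real ((cmod (\<Sum>i\<in>A. c i * v i))\<^sup>2)"
    by (simp only: complex_norm_square mult.commute)
  finally show ?case using gram_step by (simp add: nonneg_Reals_add_I del: of_real_power)
qed simp

text \<open>Partial sums of the exponential series stay in \<open>gram\<close>. The limit is not a
  finite sum of rank-one kernels by construction, so only nonnegativity of the form, a closed
  condition, is carried over.\<close>

lemma gram_exp_form:
  assumes "gram K"
  shows "(\<Sum>i\<in>A. \<Sum>j\<in>A. cnj (c i) * c j * exp (K i j)) \<in> \<real>\<^sub>\<ge>\<^sub>0"
proof (rule closed_sequentially[OF closed_nonneg_Reals_complex])
  have E: "(\<lambda>n. \<Sum>k<n. complex_of_real (inverse (fact k)) * z ^ k) \<longlonglongrightarrow> exp z" for z :: complex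
    using exp_converges[of z] by (simp add: sums_def scaleR_conv_of_real)
  show "(\<lambda>n. \<Sum>i\<in>A. \<Sum>j\<in>A. cnj (c i) * c j * (\<Sum>k<n. complex_of_real (inverse (fact k)) * K i j ^ k))
      \<longlonglongrightarrow> (\<Sum>i\<in>A. \<Sum>j\<in>A. cnj (c i) * c j * exp (K i j))"
    by (intro tendsto_sum tendsto_mult tendsto_const E)
  show "(\<Sum>i\<in>A. \<Sum>j\<in>A. cnj (c i) * c j * (\<Sum>k<n. complex_of_real (inverse (fact k)) * K i j ^ k)) \<in> \<real>\<^sub>\<ge>\<^sub>0" for n
    by (intro gram_form gram_sum gram_scale gram_power assms) simp
qed

text \<open>Gram-Schmidt along A: removing the direction of \<open>x a\<close> splits off one
  rank-one kernel and makes the residual at a vanish. The transposed arguments fit an inner product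
  that is linear in its first variable.\<close>

lemma cinner_gram:
  fixes x :: "'a \<Rightarrow> 'h::complex_inner"
  assumes "finite A"
  shows "\<exists>K. gram K \<and> (\<forall>i\<in>A. \<forall>j\<in>A. K i j = cinner (x j) (x i))"
  using assms
proof (induction A arbitrary: x)
  case empty
  show ?case using gram_zero by auto
next
  case (insert a A)
  define e where "e = inverse (norm (x a)) *\<^sub>R x a"
  define x' where "x' i = x i - cinner (x i) e *\<^sub>C e" for i
  have e: "cinner e e = 1 \<or> e = 0"
  proof (cases "x a = 0")
    case False
    then have "norm e = 1" by (simp add: e_def)
    then show ?thesis by (simp add: cinner_self)
  qed (simp add: e_def)
  have x'_a: "x' a = 0"
  proof (cases "x a = 0")
    case False
    have "cinner (x a) e = complex_of_real (inverse (norm (x a)) * (norm (x a))\<^sup>2)"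
      unfolding e_def scaleR_scaleC cinner_scaleC_right cinner_self by simp
    also have "inverse (norm (x a)) * (norm (x a))\<^sup>2 = norm (x a)"
      using False by (simp add: power2_eq_square)
    finally show ?thesis using False by (simp add: x'_def e_def flip: scaleR_scaleC)
  qed (simp add: x'_def e_def scaleC_simps)
  have split: "cinner (x j) (x i) = cnj (cinner (x i) e) * cinner (x j) e + cinner (x' j) (x' i)" for i j
    using e cinner_commute[of e "x i"]
    by (auto simp: x'_def cinner_simps algebra_simps)
  obtain K where K: "gram K" "\<And>i j. i \<in> A \<Longrightarrow> j \<in> A \<Longrightarrow> K i j = cinner (x' j) (x' i)"
    using insert.IH[of x'] by blast
  \<comment> \<open>K is controlled on A only, so indicators erase it elsewhere; at a the residual
    kernel is 0 anyway.\<close>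
  define K' where "K' i j = cnj (cinner (x i) e) * cinner (x j) e + cnj (of_bool (i \<in> A)) * of_bool (j \<in> A) * K i j" for i j
  have "gram K'"
    unfolding K'_def by (intro gram_step gram_rank_one_mult K(1))
  moreover have "K' i j = cinner (x j) (x i)" if "i \<in> insert a A" "j \<in> insert a A" for i j
    unfolding K'_def split[of j i] using that insert.hyps(2) by (auto simp: x'_a K(2))
  ultimately show ?case by blast
qed

text \<open>Expanding the square leaves, up to factors in x and y separately, the exponential of s
  Re - \<i> Im of \<open>cinner x y\<close>. That exponent is the Gram kernel K plus (s - 1) / 2
  times K + cnj K, and s >= 1 makes this scalar nonnegative.\<close>

lemma gaussian_kernel_pos:
  fixes A :: "'h::complex_inner set"
  assumes "finite A" "1 \<le> s"
  shows "(\<Sum>x\<in>A. \<Sum>y\<in>A. cnj (c x) * c y * cis (- symp_form x y) *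
           complex_of_real (exp (- (s * (norm (y - x))\<^sup>2 / 2)))) \<in> \<real>\<^sub>\<ge>\<^sub>0"
proof -
  obtain K where K: "gram K" "\<And>x y. x \<in> A \<Longrightarrow> y \<in> A \<Longrightarrow> K x y = cinner y x"
    using cinner_gram[OF assms(1), of "\<lambda>x. x"] by blast
  define P where "P x y = K x y + complex_of_real ((s - 1) / 2) * (K x y + cnj (K x y))" for x y
  have P: "gram P"
    unfolding P_def using assms(2) by (intro gram_add gram_scale gram_cnj K(1)) simp
  define d where "d x = complex_of_real (exp (- (s * (norm x)\<^sup>2 / 2)))" for x :: 'h
  have "cis (- symp_form x y) * complex_of_real (exp (- (s * (norm (y - x))\<^sup>2 / 2)))
      = d x * d y * exp (P x y)" if "x \<in> A" "y \<in> A" for x y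
  proof -
    define a b where "a = Re (cinner x y)" and "b = Im (cinner x y)"
    have yx: "cinner y x = Complex a (- b)"
      using cinner_commute[of y x] by (simp add: a_def b_def complex_eq_iff)
    have "Re (cinner y x) = a" by (simp add: yx)
    then have n: "(norm (y - x))\<^sup>2 = (norm x)\<^sup>2 + (norm y)\<^sup>2 - 2 * a"
      unfolding norm_diff_sq by simp
    have P_eq: "P x y = complex_of_real (s * a) + \<i> * complex_of_real (- b)"
    proof -
      have "Complex a (- b) + cnj (Complex a (- b)) = complex_of_real (2 * a)"
        by (simp add: complex_eq_iff)
      then have "P x y = Complex a (- b) + complex_of_real ((s - 1) / 2 * (2 * a))"
        by (simp only: P_def K(2)[OF that] yx of_real_mult)
      also have "(s - 1) / 2 * (2 * a) = s * a - a" by (simp add: left_diff_distrib)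
      finally show ?thesis by (simp add: complex_eq_iff)
    qed
    have c: "cis (- symp_form x y) = exp (\<i> * complex_of_real (- b))"
      by (simp only: cis_conv_exp symp_form_def b_def)
    have r: "complex_of_real (exp q) = exp (complex_of_real q)" for q by (rule exp_of_real[symmetric])
    have "cis (- symp_form x y) * complex_of_real (exp (- (s * (norm (y - x))\<^sup>2 / 2)))
        = exp (\<i> * complex_of_real (- b) + complex_of_real (- (s * (norm (y - x))\<^sup>2 / 2)))"
      by (simp only: c r exp_add)
    also have "\<i> * complex_of_real (- b) + complex_of_real (- (s * (norm (y - x))\<^sup>2 / 2))
        = complex_of_real (- (s * (norm x)\<^sup>2 / 2)) + complex_of_real (- (s * (norm y)\<^sup>2 / 2)) + P x y"
    proof -
      have "- (s * (p + q - 2 * a) / 2) = - (s * p / 2) + - (s * q / 2) + s * a" for p q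
        by (simp add: algebra_simps diff_divide_distrib add_divide_distrib)
      then show ?thesis unfolding n P_eq by (simp only: of_real_add add_ac)
    qed
    finally show ?thesis
      by (simp only: exp_add r d_def)
  qed
  then have "(\<Sum>x\<in>A. \<Sum>y\<in>A. cnj (c x) * c y * cis (- symp_form x y) *
           complex_of_real (exp (- (s * (norm (y - x))\<^sup>2 / 2))))
      = (\<Sum>x\<in>A. \<Sum>y\<in>A. cnj (c x * d x) * (c y * d y) * exp (P x y))"
    by (intro sum.cong refl) (simp add: mult.assoc, simp add: d_def mult_ac)
  then show ?thesis using gram_exp_form[OF P, of "\<lambda>x. c x * d x" A] by (simp only:)
qed

lemma weyl_star_mult_expand:
  fixes f :: "'h::complex_inner weyl"
  shows "star f * f = (\<Sum>x\<in>wsupp f. \<Sum>y\<in>wsupp f.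
    (cnj (wcoeff f x) * wcoeff f y * cis (- symp_form x y)) *\<^sub>C weyl_gen (y - x))"
proof -
  let ?e = "\<Sum>x\<in>wsupp f. wcoeff f x *\<^sub>C weyl_gen x"
  have "star ?e * ?e = (\<Sum>x\<in>wsupp f. \<Sum>y\<in>wsupp f.
    (cnj (wcoeff f x) * wcoeff f y * cis (- symp_form x y)) *\<^sub>C weyl_gen (y - x))"
    unfolding star_sum sum_product
    by (intro sum.cong refl)
      (simp add: star_scaleC weyl_star_simps mult_scaleC_left mult_scaleC_right scaleC_scaleC
        weyl_gen_mult mult_ac)
  then show ?thesis by (simp only: weyl_expand[symmetric])
qed

section \<open>The Gaussian functionals as invariant states\<close>

lemma weyl_positive_gauss:
  assumes "s \<in> {1..\<infinity>::ereal}"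
  shows "weyl_positive (wlift (gauss_value s :: 'h::complex_inner \<Rightarrow> complex))"
proof
  fix f g :: "'h weyl" and c
  let ?L = "wlift (gauss_value s :: 'h \<Rightarrow> complex)"
  show "?L (f + g) = ?L f + ?L g" by simp
  show "?L (c *\<^sub>C f) = c * ?L f" by (simp add: scaleC_complex_def)
  show "?L 1 = 1" by (simp add: one_weyl_def gauss_value_def)
  have "?L (star f * f) = (\<Sum>x\<in>wsupp f. \<Sum>y\<in>wsupp f. cnj (wcoeff f x) * wcoeff f y *
      cis (- symp_form x y) * gauss_value s (y - x))"
    unfolding weyl_star_mult_expand
    by (simp add: linear_sum[OF clinear_imp_linear[OF clinear_wlift]] scaleC_complex_def)
  also have "\<dots> \<in> \<real>\<^sub>\<ge>\<^sub>0"
  proof (cases "s = \<infinity>")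
    case True
    have "(\<Sum>x\<in>wsupp f. \<Sum>y\<in>wsupp f. cnj (wcoeff f x) * wcoeff f y *
        cis (- symp_form x y) * gauss_value s (y - x))
      = (\<Sum>x\<in>wsupp f. \<Sum>y\<in>wsupp f. if x = y then cnj (wcoeff f x) * wcoeff f x else 0)"
      by (intro sum.cong refl) (auto simp: True gauss_value_def)
    also have "\<dots> = (\<Sum>x\<in>wsupp f. complex_of_real ((cmod (wcoeff f x))\<^sup>2))"
      by (simp add: complex_norm_square mult.commute del: of_real_power)
    also have "\<dots> \<in> \<real>\<^sub>\<ge>\<^sub>0"
      by (simp only: of_real_sum[symmetric] nonneg_Reals_of_real_iff) (simp add: sum_nonneg)
    finally show ?thesis .
  next
    case False
    then obtain r where r: "s = ereal r" "1 \<le> r" using assms by (cases s) auto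
    then show ?thesis
      using gaussian_kernel_pos[OF finite_wsupp r(2), of "wcoeff f" f]
      by (simp add: gauss_value_def)
  qed
  finally show "?L (star f * f) \<in> \<real>\<^sub>\<ge>\<^sub>0" .
qed

lemma gauss_state:
  assumes "s \<in> {1..\<infinity>::ereal}"
  shows "(gauss_state s :: 'h::complex_inner ccr cdual) \<in> states"
    "cdual_apply (gauss_state s) (ccr_W (x :: 'h)) = gauss_value s x"
proof -
  interpret weyl_positive "wlift (gauss_value s :: 'h \<Rightarrow> complex)"
    by (rule weyl_positive_gauss[OF assms])
  obtain \<omega> :: "'h ccr cdual" where "\<omega> \<in> states"
    "\<And>f. cdual_apply \<omega> (completion_embed f) = wlift (gauss_value s) f"
    using extends_to_state by blast
  then have \<omega>: "\<omega> \<in> states \<and> (\<forall>x. cdual_apply \<omega> (ccr_W x) = gauss_value s x)"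
    by (simp add: ccr_W_def)
  have "(gauss_state s :: 'h ccr cdual) \<in> states \<and> (\<forall>x :: 'h. cdual_apply (gauss_state s) (ccr_W x) = gauss_value s x)"
    unfolding gauss_state_def
  proof (rule theI[where P = "\<lambda>\<omega> :: 'h ccr cdual. \<omega> \<in> states \<and> (\<forall>x. cdual_apply \<omega> (ccr_W x) = gauss_value s x)"])
    fix \<psi> :: "'h ccr cdual"
    assume "\<psi> \<in> states \<and> (\<forall>x. cdual_apply \<psi> (ccr_W x) = gauss_value s x)"
    then show "\<psi> = \<omega>" using \<omega> by (intro ccr_functional_eqI) simp
  qed (rule \<omega>)
  then show "(gauss_state s :: 'h ccr cdual) \<in> states"
    "cdual_apply (gauss_state s) (ccr_W x) = gauss_value s x" by auto
qed

text \<open>Bounded functionals agreeing on the Weyl elements are equal, so invariance is checked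
  there, where a unitary only moves x within its sphere.\<close>

lemma invariant_statesI:
  fixes \<omega> :: "'h::complex_inner ccr cdual"
  assumes "\<omega> \<in> states"
    and "\<And>x y. norm x = norm y \<Longrightarrow> cdual_apply \<omega> (ccr_W x) = cdual_apply \<omega> (ccr_W y)"
  shows "\<omega> \<in> invariant_states"
proof -
  have "cdual_apply \<omega> \<circ> ccr_rho U = cdual_apply \<omega>" if U: "U \<in> unitary_group" for U :: "'h \<Rightarrow> 'h"
  proof (rule ccr_map_eqI)
    have h: "clinear (ccr_rho U)" "bounded_linear (ccr_rho U)"
      using ccr_rho(1)[OF U] by (auto simp: star_hom_def)
    then show "clinear (cdual_apply \<omega> \<circ> ccr_rho U)" "bounded_linear (cdual_apply \<omega> \<circ> ccr_rho U)"
      using cdual_linear[of \<omega>]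
      by (auto simp: clinear_def o_def intro: bounded_linear_compose)
    fix x
    have "cinner (U x) (U x) = cinner x x" using U by (simp add: unitary_group_def)
    then have "norm (U x) = norm x"
      by (simp add: norm_eq_sqrt_inner inner_eq_Re_cinner)
    then show "(cdual_apply \<omega> \<circ> ccr_rho U) (ccr_W x) = cdual_apply \<omega> (ccr_W x)"
      using assms(2)[of "U x" x] by (simp only: o_apply ccr_rho(2)[OF U])
  qed (fact cdual_linear)+
  then show ?thesis using assms(1) by (simp add: invariant_states_def)
qed

lemma gauss_state_invariant:
  assumes "s \<in> {1..\<infinity>::ereal}"
  shows "gauss_state s \<in> (invariant_states :: 'h::complex_inner ccr cdual set)"
proof (rule invariant_statesI)
  fix x y :: 'h
  assume n: "norm x = norm y"
  then have "x = 0 \<longleftrightarrow> y = 0" by (metis norm_eq_zero)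
  then show "cdual_apply (gauss_state s) (ccr_W x) = cdual_apply (gauss_state s) (ccr_W y)"
    by (simp add: gauss_state(2)[OF assms] gauss_value_def n)
qed (rule gauss_state(1)[OF assms])

section \<open>Barycenters of measures on the Gaussian states\<close>

abbreviation (input) gauss_space :: "ereal measure" where
  "gauss_space \<equiv> restrict_space borel {1..\<infinity>}"

lemma space_gauss_space: "space gauss_space = {1..\<infinity>}"
  by (simp add: space_restrict_space)

lemma gauss_spaceD:
  assumes "sets \<mu> = sets gauss_space"
  shows "space \<mu> = {1..\<infinity>}" "borel_measurable \<mu> = borel_measurable gauss_space"
  using sets_eq_imp_space_eq[OF assms] measurable_cong_sets[OF assms refl] by (auto simp: space_gauss_space)

lemma measurable_gauss_value: "(\<lambda>s. gauss_value s x) \<in> borel_measurable gauss_space"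
  unfolding gauss_value_def by (rule measurable_restrict_space1) measurable

lemma measurable_gauss_state:
  fixes a :: "'h::complex_inner ccr"
  shows "(\<lambda>s. cdual_apply (gauss_state s) a) \<in> borel_measurable gauss_space"
proof -
  obtain X where X: "(\<lambda>n. completion_embed (X n)) \<longlonglongrightarrow> a" by (rule completion_cases)
  have "(\<lambda>s. cdual_apply (gauss_state s) (completion_embed f)) \<in> borel_measurable gauss_space" for f :: "'h weyl"
  proof (subst measurable_cong)
    fix s assume "s \<in> space gauss_space"
    then show "cdual_apply (gauss_state s) (completion_embed f)
        = (\<Sum>x\<in>wsupp f. wcoeff f x * gauss_value s x)"
      by (simp add: space_gauss_space completion_embed_weyl cdual_apply_simps gauss_state(2))
  qed (intro borel_measurable_sum borel_measurable_times borel_measurable_const measurable_gauss_value)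
  then show ?thesis
    by (rule borel_measurable_LIMSEQ_metric[where f = "\<lambda>n s. cdual_apply (gauss_state s) (completion_embed (X n))"])
      (rule bounded_linear.tendsto[OF cdual_linear(2) X])
qed

lemma integrable_gauss_state:
  assumes "finite_measure \<mu>" and sets: "sets \<mu> = sets gauss_space"
  shows "integrable \<mu> (\<lambda>s. cdual_apply (gauss_state s) (a :: 'h::complex_inner ccr))"
proof -
  interpret finite_measure \<mu> by (rule assms(1))
  show ?thesis
  proof (rule integrable_const_bound)
    show "AE s in \<mu>. norm (cdual_apply (gauss_state s) a) \<le> norm a"
      by (rule AE_I2) (simp add: gauss_spaceD(1)[OF sets] state_bound gauss_state(1))
  qed (simp add: gauss_spaceD(2)[OF sets] measurable_gauss_state)
qed

text \<open>Intended for all finite measures and not only for probability measures, because the cone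
  over the invariant states is parametrised by it.\<close>

definition barycenter :: "ereal measure \<Rightarrow> 'h::complex_inner ccr cdual" where
  "barycenter \<mu> = Abs_cdual (\<lambda>a. \<integral>s. cdual_apply (gauss_state s) a \<partial>\<mu>)"

lemma barycenter_apply:
  assumes fin: "finite_measure \<mu>" and sets: "sets \<mu> = sets gauss_space"
  shows "cdual_apply (barycenter \<mu> :: 'h::complex_inner ccr cdual) a = (\<integral>s. cdual_apply (gauss_state s) a \<partial>\<mu>)"
proof -
  interpret finite_measure \<mu> by (rule fin)
  note int = integrable_gauss_state[OF fin sets]
  let ?F = "\<lambda>a :: 'h ccr. \<integral>s. cdual_apply (gauss_state s) a \<partial>\<mu>"
  have add: "?F (a + b) = ?F a + ?F b" for a b
    by (simp add: cdual_apply_simps int)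
  have scale: "?F (c *\<^sub>C a) = c * ?F a" for c a
    by (simp add: cdual_apply_simps)
  have "norm (?F a) \<le> norm a * measure \<mu> (space \<mu>)" for a
  proof -
    have "norm (?F a) \<le> (\<integral>s. norm (cdual_apply (gauss_state s) a) \<partial>\<mu>)" by (rule integral_norm_bound)
    also have "\<dots> \<le> (\<integral>s. norm a \<partial>\<mu>)"
      by (rule integral_mono) (auto intro: int integrable_norm simp: gauss_spaceD(1)[OF sets] state_bound gauss_state(1))
    finally show ?thesis by (simp add: mult.commute)
  qed
  then have "bounded_linear ?F"
    by (intro bounded_linear_intro[of _ "measure \<mu> (space \<mu>)"])
      (simp_all only: add scale scaleR_scaleC scaleC_complex_def)
  then have "?F \<in> {f. clinear f \<and> bounded_linear f}"
    by (simp only: mem_Collect_eq clinear_def add scale scaleC_complex_def simp_thms)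
  from Abs_cdual_inverse[OF this] show ?thesis unfolding barycenter_def by simp
qed

lemma barycenter_one:
  assumes "finite_measure \<mu>" "sets \<mu> = sets gauss_space"
  shows "cdual_apply (barycenter \<mu> :: 'h::complex_inner ccr cdual) 1 = measure \<mu> (space \<mu>)"
proof -
  interpret finite_measure \<mu> by (rule assms(1))
  have "(\<integral>s. cdual_apply (gauss_state s :: 'h ccr cdual) 1 \<partial>\<mu>) = (\<integral>s. 1 \<partial>\<mu>)"
    by (rule Bochner_Integration.integral_cong)
      (simp_all add: gauss_spaceD(1)[OF assms(2)] state_one gauss_state(1))
  then show ?thesis by (simp add: barycenter_apply[OF assms] scaleR_conv_of_real)
qed

lemma barycenter_W:
  assumes "finite_measure \<mu>" "sets \<mu> = sets gauss_space"
  shows "cdual_apply (barycenter \<mu>) (ccr_W x) = (\<integral>s. gauss_value s x \<partial>\<mu>)"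
  unfolding barycenter_apply[OF assms]
  by (rule Bochner_Integration.integral_cong) (simp_all add: gauss_spaceD(1)[OF assms(2)] gauss_state(2))

lemma barycenter_invariant:
  assumes "prob_space \<mu>" "sets \<mu> = sets gauss_space"
  shows "barycenter \<mu> \<in> (invariant_states :: 'h::complex_inner ccr cdual set)"
proof (rule invariant_statesI)
  interpret prob_space \<mu> by (rule assms(1))
  have fin: "finite_measure \<mu>" by (rule finite_measure_axioms)
  note ap = barycenter_apply[OF fin assms(2)]
  have "cdual_apply (barycenter \<mu>) (star a * a) \<in> \<real>\<^sub>\<ge>\<^sub>0" for a :: "'h ccr"
  proof -
    let ?r = "\<lambda>s. Re (cdual_apply (gauss_state s) (star a * a))"
    have r: "cdual_apply (gauss_state s) (star a * a) = complex_of_real (?r s)" "0 \<le> ?r s" if "s \<in> space \<mu>" for s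
    proof -
      have "cdual_apply (gauss_state s) (star a * a) \<in> \<real>\<^sub>\<ge>\<^sub>0"
        using gauss_state(1)[of s, where 'h = 'h] that by (simp add: gauss_spaceD(1)[OF assms(2)] states_def)
      then show "cdual_apply (gauss_state s) (star a * a) = complex_of_real (?r s)" "0 \<le> ?r s"
        by (auto simp: complex_nonneg_Reals_iff complex_eq_iff)
    qed
    have "cdual_apply (barycenter \<mu>) (star a * a) = (\<integral>s. complex_of_real (?r s) \<partial>\<mu>)"
      unfolding ap by (rule Bochner_Integration.integral_cong[OF refl r(1)])
    also have "\<dots> = complex_of_real (\<integral>s. ?r s \<partial>\<mu>)" by (rule integral_complex_of_real)
    also have "\<dots> \<in> \<real>\<^sub>\<ge>\<^sub>0"
      using r(2) by (simp only: nonneg_Reals_of_real_iff) (rule Bochner_Integration.integral_nonneg)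
    finally show ?thesis .
  qed
  then show "(barycenter \<mu> :: 'h ccr cdual) \<in> states"
    using prob_space by (simp add: states_def barycenter_one[OF fin assms(2)])
  fix x y :: 'h
  assume n: "norm x = norm y"
  then have "x = 0 \<longleftrightarrow> y = 0" by (metis norm_eq_zero)
  then have "gauss_value s x = gauss_value s y" for s by (simp add: gauss_value_def n)
  then show "cdual_apply (barycenter \<mu>) (ccr_W x) = cdual_apply (barycenter \<mu>) (ccr_W y)"
    by (simp add: barycenter_W[OF fin assms(2)])
qed

section \<open>The coordinate y = exp (1 - s) and existence of the representing measure\<close>

definition from_unit :: "real \<Rightarrow> ereal" where
  "from_unit y = (if 0 < y \<and> y \<le> 1 then ereal (1 - ln y) else \<infinity>)"

definition to_unit :: "ereal \<Rightarrow> real" where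
  "to_unit s = (if s = \<infinity> then 0 else exp (1 - real_of_ereal s))"

text \<open>Reals outside (0, 1] go to \<infinity>, so the map lands in [1, \<infinity>] everywhere
  and measures can be pushed forward without a support condition.\<close>

lemma from_unit_range: "from_unit y \<in> {1..\<infinity>}"
  by (auto simp: from_unit_def one_ereal_def)

lemma from_unit_to_unit: "s \<in> {1..\<infinity>} \<Longrightarrow> from_unit (to_unit s) = s"
  by (cases s) (auto simp: from_unit_def to_unit_def one_ereal_def)

lemma to_unit_range: "s \<in> {1..\<infinity>} \<Longrightarrow> 0 \<le> to_unit s \<and> to_unit s \<le> 1"
  by (cases s) (auto simp: to_unit_def one_ereal_def)

lemma measurable_from_unit: "from_unit \<in> measurable borel gauss_space"
  by (rule measurable_restrict_space2) (use from_unit_range in \<open>auto simp: from_unit_def[abs_def]\<close>)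

lemma measurable_to_unit: "to_unit \<in> borel_measurable gauss_space"
  unfolding to_unit_def[abs_def] by (rule measurable_restrict_space1) measurable

lemma gauss_value_from_unit:
  assumes "x \<noteq> 0" "0 \<le> y" "y \<le> 1"
  shows "gauss_value (from_unit y) x = complex_of_real (exp (- (norm x)\<^sup>2 / 2) * y powr ((norm x)\<^sup>2 / 2))"
proof (cases "y = 0")
  case False
  then have "exp (- ((1 - ln y) * (norm x)\<^sup>2 / 2)) = exp (- (norm x)\<^sup>2 / 2) * y powr ((norm x)\<^sup>2 / 2)"
    using assms by (simp add: powr_def exp_add[symmetric] algebra_simps diff_divide_distrib)
  then show ?thesis using False assms by (simp add: gauss_value_def from_unit_def)
qed (simp add: gauss_value_def from_unit_def assms(1))

lemma exists_measure:
  fixes \<omega> :: "'h::complex_inner ccr cdual"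
  assumes \<omega>: "\<omega> \<in> invariant_states"
    and dim: "\<not> (\<exists>B :: 'h set. finite B \<and> cspan B = UNIV)"
  obtains \<mu> where "prob_space \<mu>" "sets \<mu> = sets gauss_space" "\<omega> = barycenter \<mu>"
proof -
  obtain M where M: "real_distribution M" "AE y in M. 0 \<le> y \<and> y \<le> 1"
    and W: "\<And>x. x \<noteq> 0 \<Longrightarrow> cdual_apply \<omega> (ccr_W x) =
       complex_of_real (exp (- (norm x)\<^sup>2 / 2) * (\<integral>y. y powr ((norm x)\<^sup>2 / 2) \<partial>M))"
    using invariant_state_representation[OF \<omega> dim] by blast
  interpret real_distribution M by (rule M(1))
  have meas: "from_unit \<in> measurable M gauss_space"
    using measurable_from_unit by (simp add: measurable_def)
  define \<mu> where "\<mu> = distr M gauss_space from_unit"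
  have prob: "prob_space \<mu>" unfolding \<mu>_def by (rule prob_space_distr[OF meas])
  then have fin: "finite_measure \<mu>" by (simp add: prob_space_def)
  have sets: "sets \<mu> = sets gauss_space" by (simp add: \<mu>_def)
  have "\<omega> = barycenter \<mu>"
  proof (rule ccr_functional_eqI)
    fix x :: 'h
    \<comment> \<open>The integral formula \<open>W\<close> covers nonzero x only; at x = 0 the
      claim is that both functionals have value 1 at the unit.\<close>
    show "cdual_apply \<omega> (ccr_W x) = cdual_apply (barycenter \<mu>) (ccr_W x)"
    proof (cases "x = 0")
      case True
      then show ?thesis
        using \<omega> prob_space.prob_space[OF prob]
        by (simp add: ccr_W_zero barycenter_one[OF fin sets] state_one invariant_states_def)
    next
      case False
      have "cdual_apply (barycenter \<mu>) (ccr_W x) = (\<integral>y. gauss_value (from_unit y) x \<partial>M)"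
        unfolding barycenter_W[OF fin sets]
        unfolding \<mu>_def by (rule integral_distr[OF meas measurable_gauss_value])
      also have "\<dots> = (\<integral>y. complex_of_real (exp (- (norm x)\<^sup>2 / 2) * y powr ((norm x)\<^sup>2 / 2)) \<partial>M)"
      proof (rule integral_cong_AE)
        show "(\<lambda>y. gauss_value (from_unit y) x) \<in> borel_measurable M"
          by (rule measurable_compose[OF meas measurable_gauss_value])
        show "AE y in M. gauss_value (from_unit y) x =
            complex_of_real (exp (- (norm x)\<^sup>2 / 2) * y powr ((norm x)\<^sup>2 / 2))"
          by (rule eventually_mono[OF M(2)]) (simp only: gauss_value_from_unit[OF False])
      qed simp
      also have "\<dots> = complex_of_real (exp (- (norm x)\<^sup>2 / 2) * (\<integral>y. y powr ((norm x)\<^sup>2 / 2) \<partial>M))"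
        by (simp only: integral_complex_of_real integral_mult_right_zero)
      finally show ?thesis using W[OF False] by simp
    qed
  qed
  with prob sets show ?thesis by (rule that)
qed

section \<open>Integer moments of a measure, read off from its barycenter\<close>

lemma to_unit_power:
  fixes e :: "'h::complex_inner"
  assumes "norm e = 1" "s \<in> {1..\<infinity>}"
  shows "complex_of_real (to_unit s ^ k) = complex_of_real (exp (real k)) * gauss_value s (sqrt (2 * real k) *\<^sub>R e)"
proof (cases "k = 0")
  case False
  have n: "(norm (sqrt (2 * real k) *\<^sub>R e))\<^sup>2 = 2 * real k" by (simp add: assms(1))
  have "e \<noteq> 0 \<and> sqrt (2 * real k) \<noteq> 0" using assms(1) False by auto
  then show ?thesis
    unfolding gauss_value_def n using assms(2) False
    by (cases s) (auto simp: to_unit_def exp_of_nat_mult[symmetric] exp_add[symmetric] algebra_simps simp flip: of_real_mult)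
qed (simp add: gauss_value_def)

lemma measurable_to_unit':
  "sets \<mu> = sets gauss_space \<Longrightarrow> to_unit \<in> borel_measurable \<mu>"
  by (subst gauss_spaceD(2)) (auto intro: measurable_to_unit)

lemma barycenter_moment:
  fixes e :: "'h::complex_inner"
  assumes \<mu>: "finite_measure \<mu>" "sets \<mu> = sets gauss_space" and e: "norm e = 1"
  shows "complex_of_real (\<integral>s. to_unit s ^ k \<partial>\<mu>)
    = complex_of_real (exp (real k)) * cdual_apply (barycenter \<mu>) (ccr_W (sqrt (2 * real k) *\<^sub>R e))"
proof -
  let ?x = "sqrt (2 * real k) *\<^sub>R e"
  have "complex_of_real (\<integral>s. to_unit s ^ k \<partial>\<mu>) = (\<integral>s. complex_of_real (to_unit s ^ k) \<partial>\<mu>)"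
    by (simp only: integral_complex_of_real)
  also have "\<dots> = (\<integral>s. complex_of_real (exp (real k)) * gauss_value s ?x \<partial>\<mu>)"
    by (rule Bochner_Integration.integral_cong[OF refl to_unit_power[OF e]]) (simp add: gauss_spaceD(1)[OF \<mu>(2)])
  also have "\<dots> = complex_of_real (exp (real k)) * (\<integral>s. gauss_value s ?x \<partial>\<mu>)"
    by (rule integral_mult_right_zero)
  finally show ?thesis by (simp only: barycenter_W[OF \<mu>])
qed

text \<open>The barycenter determines all moments of the image measure under \<open>to_unit\<close>,
  hence that image; \<open>from_unit\<close> pushes it back to the original measure.\<close>

lemma barycenter_prob_inj:
  fixes e :: "'h::complex_inner"
  assumes \<mu>: "prob_space \<mu>" "sets \<mu> = sets gauss_space"
    and \<nu>: "prob_space \<nu>" "sets \<nu> = sets gauss_space"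
    and e: "norm e = 1"
    and eq: "barycenter \<mu> = (barycenter \<nu> :: 'h ccr cdual)"
  shows "\<mu> = \<nu>"
proof -
  note meas = measurable_to_unit'
  have dist: "real_distribution (distr \<kappa> borel to_unit)"
    if "prob_space \<kappa>" "sets \<kappa> = sets gauss_space" for \<kappa>
    using prob_space.real_distribution_distr[OF that(1) meas[OF that(2)]] .
  have AE: "AE y in distr \<kappa> borel to_unit. 0 \<le> y \<and> y \<le> 1"
    if "sets \<kappa> = sets gauss_space" for \<kappa>
    by (subst AE_distr_iff[OF meas[OF that]])
      (auto intro!: AE_I2 simp: gauss_spaceD(1)[OF that] to_unit_range)
  have mom: "complex_of_real (\<integral>y. y ^ k \<partial>distr \<kappa> borel to_unit)
      = exp (real k) * cdual_apply (barycenter \<kappa> :: 'h ccr cdual) (ccr_W (sqrt (2 * real k) *\<^sub>R e))"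
    if \<kappa>: "prob_space \<kappa>" "sets \<kappa> = sets gauss_space" for \<kappa> k
  proof -
    interpret prob_space \<kappa> by (rule \<kappa>(1))
    have "(\<integral>y. y ^ k \<partial>distr \<kappa> borel to_unit) = (\<integral>s. to_unit s ^ k \<partial>\<kappa>)"
      by (rule integral_distr[OF meas[OF \<kappa>(2)]]) simp
    then show ?thesis by (simp only: barycenter_moment[OF finite_measure_axioms \<kappa>(2) e])
  qed
  have "distr \<mu> borel to_unit = distr \<nu> borel to_unit"
  proof (rule unit_interval_moments_eqI)
    fix k
    have "complex_of_real (\<integral>y. y ^ k \<partial>distr \<mu> borel to_unit) = complex_of_real (\<integral>y. y ^ k \<partial>distr \<nu> borel to_unit)"
      unfolding mom[OF \<mu>] mom[OF \<nu>] eq ..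
    then show "(\<integral>y. y ^ k \<partial>distr \<mu> borel to_unit) = (\<integral>y. y ^ k \<partial>distr \<nu> borel to_unit)"
      by (simp only: of_real_eq_iff)
  qed (intro dist AE \<mu> \<nu>)+
  moreover have "distr (distr \<kappa> borel to_unit) gauss_space from_unit = \<kappa>"
    if "sets \<kappa> = sets gauss_space" for \<kappa>
  proof -
    have "distr (distr \<kappa> borel to_unit) gauss_space from_unit = distr \<kappa> gauss_space (from_unit \<circ> to_unit)"
      by (rule distr_distr[OF measurable_from_unit meas[OF that]])
    also have "\<dots> = distr \<kappa> \<kappa> (\<lambda>s. s)"
      by (rule distr_cong) (simp_all add: that gauss_spaceD(1)[OF that] from_unit_to_unit)
    finally show ?thesis by (simp add: distr_id)
  qed
  ultimately show ?thesis using \<mu>(2) \<nu>(2) by metis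
qed

section \<open>The lattice cone of finite measures\<close>

definition add_measure :: "'a measure \<Rightarrow> 'a measure \<Rightarrow> 'a measure" where
  "add_measure M N = measure_of (space M) (sets M) (\<lambda>A. emeasure M A + emeasure N A)"

lemma sets_add_measure [simp]: "sets (add_measure M N) = sets M"
  and space_add_measure [simp]: "space (add_measure M N) = space M"
  by (simp_all add: add_measure_def)

lemma emeasure_add_measure:
  assumes "sets N = sets M" "A \<in> sets M"
  shows "emeasure (add_measure M N) A = emeasure M A + emeasure N A"
  unfolding add_measure_def
proof (rule emeasure_measure_of_sigma)
  show "sigma_algebra (space M) (sets M)" ..
  show "positive (sets M) (\<lambda>A. emeasure M A + emeasure N A)" by (simp add: positive_def)
  show "countably_additive (sets M) (\<lambda>A. emeasure M A + emeasure N A)"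
  proof (rule countably_additiveI)
    fix A :: "nat \<Rightarrow> 'a set"
    assume A: "range A \<subseteq> sets M" "disjoint_family A"
    then have "(\<Sum>i. emeasure M (A i)) = emeasure M (\<Union>i. A i)" "(\<Sum>i. emeasure N (A i)) = emeasure N (\<Union>i. A i)"
      using assms(1) by (auto intro!: suminf_emeasure)
    then show "(\<Sum>i. emeasure M (A i) + emeasure N (A i)) = emeasure M (\<Union>i. A i) + emeasure N (\<Union>i. A i)"
      by (subst suminf_add[symmetric]) (auto intro: summableI)
  qed
qed (rule assms(2))

lemma finite_measure_add:
  assumes "finite_measure M" "finite_measure N" "sets N = sets M"
  shows "finite_measure (add_measure M N)"
proof (rule finite_measureI)
  have "space N = space M" using sets_eq_imp_space_eq[OF assms(3)] .
  then show "emeasure (add_measure M N) (space (add_measure M N)) \<noteq> \<infinity>"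
    using finite_measure.emeasure_finite[OF assms(1), of "space M"]
      finite_measure.emeasure_finite[OF assms(2), of "space M"]
    by (simp add: emeasure_add_measure[OF assms(3)] ennreal_add_eq_top)
qed

text \<open>Both summands are dominated by the sum, so integrability passes to them, and additivity
  follows by induction over integrable functions.\<close>

lemma integral_add_measure:
  fixes f :: "'a \<Rightarrow> 'b::{banach, second_countable_topology}"
  assumes M: "finite_measure M" and N: "finite_measure N" and sets: "sets N = sets M"
    and f: "integrable (add_measure M N) f"
  shows "integral\<^sup>L (add_measure M N) f = integral\<^sup>L M f + integral\<^sup>L N f"
proof -
  interpret M: finite_measure M by (rule M)
  interpret N: finite_measure N by (rule N)
  interpret S: finite_measure "add_measure M N" by (rule finite_measure_add[OF M N sets])
  have sp: "space N = space M" using sets_eq_imp_space_eq[OF sets] .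
  have le: "M \<le> add_measure M N" "N \<le> add_measure M N"
    using emeasure_add_measure[OF sets]
    by (auto simp: le_measure sets)
  have int: "integrable M g" "integrable N g" if "integrable (add_measure M N) g" for g :: "'a \<Rightarrow> 'b"
  proof -
    have m: "g \<in> borel_measurable (add_measure M N)"
      and b: "(\<integral>\<^sup>+x. ennreal (norm (g x)) \<partial>add_measure M N) < \<infinity>"
      using that by (auto simp: integrable_iff_bounded)
    have "g \<in> borel_measurable M" "g \<in> borel_measurable N"
      using m sets by (auto simp: measurable_def sp)
    moreover have "(\<integral>\<^sup>+x. ennreal (norm (g x)) \<partial>M) \<le> (\<integral>\<^sup>+x. ennreal (norm (g x)) \<partial>add_measure M N)"
      "(\<integral>\<^sup>+x. ennreal (norm (g x)) \<partial>N) \<le> (\<integral>\<^sup>+x. ennreal (norm (g x)) \<partial>add_measure M N)"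
      by (intro nn_integral_mono_measure le; simp add: sets)+
    ultimately show "integrable M g" "integrable N g"
      using b by (auto simp: integrable_iff_bounded)
  qed
  show ?thesis
    using f
  proof (induction rule: integrable_induct)
    case (base A c)
    then have A: "A \<in> sets M" "A \<in> sets N" by (simp_all add: sets)
    have "ennreal (measure (add_measure M N) A) = ennreal (measure M A + measure N A)"
      using emeasure_add_measure[OF sets A(1)]
      by (simp add: S.emeasure_eq_measure M.emeasure_eq_measure N.emeasure_eq_measure)
    then have "measure (add_measure M N) A = measure M A + measure N A"
      by (subst (asm) ennreal_inj) auto
    moreover have "(\<integral>x. indicator A x *\<^sub>R c \<partial>L) = measure L A *\<^sub>R c"
      if "finite_measure L" "A \<in> sets L" for L
      using finite_measure.emeasure_finite[OF that(1), of A] that(2)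
      by (intro has_bochner_integral_integral_eq[OF has_bochner_integral_scaleR_left]
          has_bochner_integral_real_indicator) (simp_all add: less_top)
    ultimately show ?case
      using A M N S.finite_measure_axioms by (simp add: scaleR_add_left)
  next
    case (add f g)
    then show ?case using int[of f] int[of g] by (simp add: algebra_simps)
  next
    case (lim f s)
    have conv: "(\<lambda>i. integral\<^sup>L L (s i)) \<longlonglongrightarrow> integral\<^sup>L L f"
      if L: "space L = space M" "integrable L f" "\<And>i. integrable L (s i)" for L
    proof (rule integral_dominated_convergence[where w = "\<lambda>x. 2 * norm (f x)"])
      show "AE x in L. (\<lambda>i. s i x) \<longlonglongrightarrow> f x" "AE x in L. norm (s i x) \<le> 2 * norm (f x)" for i
        using lim L(1) by (auto intro!: AE_I2)
    qed (use L in auto)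
    have "(\<lambda>i. integral\<^sup>L (add_measure M N) (s i)) \<longlonglongrightarrow> integral\<^sup>L (add_measure M N) f"
      using lim by (intro conv) auto
    moreover have "(\<lambda>i. integral\<^sup>L (add_measure M N) (s i)) \<longlonglongrightarrow> integral\<^sup>L M f + integral\<^sup>L N f"
    proof -
      have "integral\<^sup>L (add_measure M N) (s i) = integral\<^sup>L M (s i) + integral\<^sup>L N (s i)" for i
        using lim by blast
      moreover have "(\<lambda>i. integral\<^sup>L M (s i) + integral\<^sup>L N (s i)) \<longlonglongrightarrow> integral\<^sup>L M f + integral\<^sup>L N f"
        using lim sp by (intro tendsto_add conv int) auto
      ultimately show ?thesis by (simp only:)
    qed
    ultimately show ?case by (rule LIMSEQ_unique)
  qed
qed

lemma emeasure_indicator_density: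
  assumes "Y \<in> sets M" "A \<in> sets M"
  shows "emeasure (density M (indicator Y)) A = emeasure M (A \<inter> Y)"
proof -
  have "indicator Y x * indicator A x = (indicator (A \<inter> Y) x :: ennreal)" for x
    by (simp split: split_indicator)
  then show ?thesis
    using assms by (subst emeasure_density) (simp_all only: nn_integral_indicator sets.Int borel_measurable_indicator)
qed

text \<open>Isolates what the simplex property needs: an additive injective image of the finite
  measures inherits their lattice order. The base set of the cone does not enter.\<close>

locale measure_cone =
  fixes B :: "'a measure" and \<Phi> :: "'a measure \<Rightarrow> 'v::real_vector"
  assumes add: "\<And>\<mu> \<nu>. finite_measure \<mu> \<Longrightarrow> sets \<mu> = sets B \<Longrightarrow> finite_measure \<nu> \<Longrightarrow> sets \<nu> = sets B \<Longrightarrow>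
      \<Phi> (add_measure \<mu> \<nu>) = \<Phi> \<mu> + \<Phi> \<nu>"
    and inj: "\<And>\<mu> \<nu>. finite_measure \<mu> \<Longrightarrow> sets \<mu> = sets B \<Longrightarrow> finite_measure \<nu> \<Longrightarrow> sets \<nu> = sets B \<Longrightarrow>
      \<Phi> \<mu> = \<Phi> \<nu> \<Longrightarrow> \<mu> = \<nu>"
begin

definition fin :: "'a measure set" where
  "fin = {\<mu>. finite_measure \<mu> \<and> sets \<mu> = sets B}"

lemma finD: "\<mu> \<in> fin \<Longrightarrow> finite_measure \<mu>" "\<mu> \<in> fin \<Longrightarrow> sets \<mu> = sets B"
  by (simp_all add: fin_def)

lemma fin_add: "\<mu> \<in> fin \<Longrightarrow> \<nu> \<in> fin \<Longrightarrow> add_measure \<mu> \<nu> \<in> fin"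
  by (simp add: fin_def finite_measure_add)

lemma Phi_add: "\<mu> \<in> fin \<Longrightarrow> \<nu> \<in> fin \<Longrightarrow> \<Phi> (add_measure \<mu> \<nu>) = \<Phi> \<mu> + \<Phi> \<nu>"
  by (simp add: fin_def add)

lemma emeasure_add:
  "\<mu> \<in> fin \<Longrightarrow> \<nu> \<in> fin \<Longrightarrow> A \<in> sets B \<Longrightarrow> emeasure (add_measure \<mu> \<nu>) A = emeasure \<mu> A + emeasure \<nu> A"
  by (simp add: fin_def emeasure_add_measure)

lemma fin_restrict:
  assumes "\<mu> \<in> fin" "Y \<in> sets B"
  shows "density \<mu> (indicator Y) \<in> fin"
proof -
  interpret finite_measure \<mu> by (rule finD(1)[OF assms(1)])
  have "space \<mu> \<in> sets B" using sets.top[of \<mu>] finD(2)[OF assms(1)] by simp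
  then have "emeasure (density \<mu> (indicator Y)) (space \<mu>) \<noteq> \<infinity>"
    using assms by (subst emeasure_indicator_density) (simp_all add: finD)
  then show ?thesis
    using assms by (auto simp: fin_def intro!: finite_measureI)
qed

lemma emeasure_restrict:
  "\<mu> \<in> fin \<Longrightarrow> Y \<in> sets B \<Longrightarrow> A \<in> sets B \<Longrightarrow> emeasure (density \<mu> (indicator Y)) A = emeasure \<mu> (A \<inter> Y)"
  by (simp add: emeasure_indicator_density finD)

lemma emeasure_split:
  assumes "\<mu> \<in> fin" "Y \<in> sets B" "A \<in> sets B"
  shows "emeasure \<mu> (A \<inter> Y) + emeasure \<mu> (A - Y) = emeasure \<mu> A"
  using assms by (subst plus_emeasure) (auto simp: finD intro!: arg_cong[where f = "emeasure \<mu>"])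

lemma Phi_diff:
  assumes \<mu>: "\<mu> \<in> fin" and \<nu>: "\<nu> \<in> fin" and le: "\<And>A. A \<in> sets B \<Longrightarrow> emeasure \<mu> A \<le> emeasure \<nu> A"
  shows "\<Phi> \<nu> - \<Phi> \<mu> \<in> \<Phi> ` fin"
proof -
  interpret nu: finite_measure \<nu> by (rule finD(1)[OF \<nu>])
  define \<delta> where "\<delta> = diff_measure \<nu> \<mu>"
  have e: "emeasure \<delta> A = emeasure \<nu> A - emeasure \<mu> A" if "A \<in> sets B" for A
    unfolding \<delta>_def using \<mu> \<nu> le that by (intro emeasure_diff_measure) (auto simp: finD)
  have "sets \<delta> = sets B" by (simp add: \<delta>_def finD[OF \<nu>])
  moreover have "emeasure \<delta> (space \<delta>) \<noteq> \<infinity>"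
    using e[of "space B"] sets_eq_imp_space_eq[OF \<open>sets \<delta> = sets B\<close>] by simp
  ultimately have \<delta>: "\<delta> \<in> fin" by (simp add: fin_def finite_measureI)
  have "add_measure \<mu> \<delta> = \<nu>"
  proof (rule measure_eqI)
    fix A assume "A \<in> sets (add_measure \<mu> \<delta>)"
    then have A: "A \<in> sets B" using finD[OF \<mu>] by simp
    then show "emeasure (add_measure \<mu> \<delta>) A = emeasure \<nu> A"
      using le[OF A] by (simp add: emeasure_add[OF \<mu> \<delta> A] e[OF A] add_diff_inverse_ennreal)
  qed (simp add: finD[OF \<mu>] finD[OF \<nu>])
  then have "\<Phi> \<nu> - \<Phi> \<mu> = \<Phi> \<delta>" using Phi_add[OF \<mu> \<delta>] by simp
  then show ?thesis using \<delta> by blast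
qed

definition diffs :: "'v set" where
  "diffs = {p - q |p q. p \<in> \<Phi> ` fin \<and> q \<in> \<Phi> ` fin}"

text \<open>With a common subtrahend, u = \<Phi> \<alpha> - \<Phi> \<gamma> and v = \<Phi> \<beta> -
  \<Phi> \<gamma>, the supremum is the maximum of \<alpha> and \<beta> minus \<gamma>. The maximum
  is \<alpha> on a Hahn set Y and \<beta> off it, and the excess of an upper bound is glued along
  the same set.\<close>

lemma exists_sup:
  assumes "u \<in> diffs" "v \<in> diffs"
  shows "\<exists>w\<in>diffs. w - u \<in> \<Phi> ` fin \<and> w - v \<in> \<Phi> ` fin \<and>
    (\<forall>z\<in>diffs. z - u \<in> \<Phi> ` fin \<and> z - v \<in> \<Phi> ` fin \<longrightarrow> z - w \<in> \<Phi> ` fin)"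
proof -
  obtain \<mu>1 \<mu>2 \<mu>3 \<mu>4 where \<mu>: "\<mu>1 \<in> fin" "\<mu>2 \<in> fin" "\<mu>3 \<in> fin" "\<mu>4 \<in> fin"
    and u: "u = \<Phi> \<mu>1 - \<Phi> \<mu>2" and v: "v = \<Phi> \<mu>3 - \<Phi> \<mu>4"
    using assms by (auto simp: diffs_def)
  define \<alpha> \<beta> \<gamma> where "\<alpha> = add_measure \<mu>1 \<mu>4" and "\<beta> = add_measure \<mu>3 \<mu>2" and "\<gamma> = add_measure \<mu>2 \<mu>4"
  have f: "\<alpha> \<in> fin" "\<beta> \<in> fin" "\<gamma> \<in> fin" by (simp_all add: \<alpha>_def \<beta>_def \<gamma>_def fin_add \<mu>)
  have u': "u = \<Phi> \<alpha> - \<Phi> \<gamma>" and v': "v = \<Phi> \<beta> - \<Phi> \<gamma>"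
    by (simp_all add: u v \<alpha>_def \<beta>_def \<gamma>_def Phi_add \<mu>)
  interpret a: finite_measure \<alpha> by (rule finD(1)[OF f(1)])
  interpret b: finite_measure \<beta> by (rule finD(1)[OF f(2)])
  have "\<exists>Y\<in>sets \<alpha>. Y \<subseteq> space B \<and> (\<forall>X\<in>sets \<alpha>. X \<subseteq> Y \<longrightarrow> \<beta> X \<le> \<alpha> X) \<and>
      (\<forall>X\<in>sets \<alpha>. X \<subseteq> space B \<longrightarrow> X \<inter> Y = {} \<longrightarrow> \<alpha> X \<le> \<beta> X)"
    by (rule unsigned_Hahn_decomposition) (simp_all add: finD[OF f(1)] finD[OF f(2)])
  then obtain Y where Y0: "Y \<in> sets \<alpha>" and Y1: "Y \<subseteq> space B \<and> (\<forall>X\<in>sets \<alpha>. X \<subseteq> Y \<longrightarrow> \<beta> X \<le> \<alpha> X) \<and>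
      (\<forall>X\<in>sets \<alpha>. X \<subseteq> space B \<longrightarrow> X \<inter> Y = {} \<longrightarrow> \<alpha> X \<le> \<beta> X)" by (rule bexE)
  have Y: "Y \<in> sets B" "\<And>X. X \<in> sets B \<Longrightarrow> X \<subseteq> Y \<Longrightarrow> emeasure \<beta> X \<le> emeasure \<alpha> X"
    "\<And>X. X \<in> sets B \<Longrightarrow> X \<subseteq> space B \<Longrightarrow> X \<inter> Y = {} \<Longrightarrow> emeasure \<alpha> X \<le> emeasure \<beta> X"
    using Y0 Y1 by (simp_all add: finD(2)[OF f(1)])
  define Z where "Z = space B - Y"
  have Z: "Z \<in> sets B" using Y(1) by (simp add: Z_def)
  have AZ: "A \<inter> Z = A - Y" if "A \<in> sets B" for A
    using sets.sets_into_space[OF that] by (auto simp: Z_def)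
  define glue where "glue \<pi> \<pi>' = add_measure (density \<pi> (indicator Y)) (density \<pi>' (indicator Z))" for \<pi> \<pi>'
  have glue: "glue \<pi> \<pi>' \<in> fin" if "\<pi> \<in> fin" "\<pi>' \<in> fin" for \<pi> \<pi>'
    unfolding glue_def using that Y Z by (intro fin_add fin_restrict)
  have glue_e: "emeasure (glue \<pi> \<pi>') A = emeasure \<pi> (A \<inter> Y) + emeasure \<pi>' (A - Y)"
    if "\<pi> \<in> fin" "\<pi>' \<in> fin" "A \<in> sets B" for \<pi> \<pi>' A
    unfolding glue_def using that Y Z
    by (simp add: emeasure_add fin_restrict emeasure_restrict AZ)
  have m: "A \<inter> Y \<in> sets B" "A - Y \<in> sets B" if "A \<in> sets B" for A using that Y(1) by auto
  have le: "emeasure \<beta> (A \<inter> Y) \<le> emeasure \<alpha> (A \<inter> Y)" "emeasure \<alpha> (A - Y) \<le> emeasure \<beta> (A - Y)" if "A \<in> sets B" for A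
    using Y(2)[OF m(1)[OF that]] Y(3)[OF m(2)[OF that]] sets.sets_into_space[OF that] by auto
  define w where "w = \<Phi> (glue \<alpha> \<beta>) - \<Phi> \<gamma>"
  have "w \<in> diffs" unfolding w_def diffs_def using glue[OF f(1,2)] f(3) by blast
  moreover have "w - u \<in> \<Phi> ` fin"
  proof -
    have "\<Phi> (glue \<alpha> \<beta>) - \<Phi> \<alpha> \<in> \<Phi> ` fin"
    proof (rule Phi_diff[OF f(1) glue[OF f(1,2)]])
      fix A assume A: "A \<in> sets B"
      show "emeasure \<alpha> A \<le> emeasure (glue \<alpha> \<beta>) A"
        unfolding glue_e[OF f(1,2) A] emeasure_split[OF f(1) Y(1) A, symmetric]
        by (rule add_left_mono[OF le(2)[OF A]])
    qed
    then show ?thesis by (simp add: w_def u')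
  qed
  moreover have "w - v \<in> \<Phi> ` fin"
  proof -
    have "\<Phi> (glue \<alpha> \<beta>) - \<Phi> \<beta> \<in> \<Phi> ` fin"
    proof (rule Phi_diff[OF f(2) glue[OF f(1,2)]])
      fix A assume A: "A \<in> sets B"
      show "emeasure \<beta> A \<le> emeasure (glue \<alpha> \<beta>) A"
        unfolding glue_e[OF f(1,2) A] emeasure_split[OF f(2) Y(1) A, symmetric]
        by (rule add_right_mono[OF le(1)[OF A]])
    qed
    then show ?thesis by (simp add: w_def v')
  qed
  moreover have "z - w \<in> \<Phi> ` fin" if z: "z \<in> diffs" "z - u \<in> \<Phi> ` fin" "z - v \<in> \<Phi> ` fin" for z
  proof -
    obtain \<zeta> \<zeta>' where \<zeta>: "\<zeta> \<in> fin" "\<zeta>' \<in> fin" "z = \<Phi> \<zeta> - \<Phi> \<zeta>'" using z(1) by (auto simp: diffs_def)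
    obtain \<pi> where \<pi>: "\<pi> \<in> fin" "z - u = \<Phi> \<pi>" using z(2) by auto
    obtain \<pi>' where \<pi>': "\<pi>' \<in> fin" "z - v = \<Phi> \<pi>'" using z(3) by auto
    \<comment> \<open>Injectivity turns an identity between differences of images into one between
      sums of measures, where no subtraction of extended values occurs.\<close>
    have eq: "emeasure \<zeta> A + emeasure \<gamma> A = emeasure \<kappa> A + (emeasure \<zeta>' A + emeasure \<rho> A)"
      if "\<kappa> \<in> fin" "\<rho> \<in> fin" "z - (\<Phi> \<kappa> - \<Phi> \<gamma>) = \<Phi> \<rho>" "A \<in> sets B" for \<kappa> \<rho> A
    proof -
      have "\<Phi> (add_measure \<zeta> \<gamma>) = \<Phi> (add_measure \<kappa> (add_measure \<zeta>' \<rho>))"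
        using that(3) \<zeta> by (simp add: Phi_add fin_add that(1,2) f algebra_simps)
      then have "add_measure \<zeta> \<gamma> = add_measure \<kappa> (add_measure \<zeta>' \<rho>)"
        using fin_add[OF \<zeta>(1) f(3)] fin_add[OF that(1) fin_add[OF \<zeta>(2) that(2)]]
        by (intro inj) (simp_all only: finD)
      then have "emeasure (add_measure \<zeta> \<gamma>) A = emeasure (add_measure \<kappa> (add_measure \<zeta>' \<rho>)) A" by simp
      then show ?thesis by (simp add: emeasure_add fin_add that \<zeta> f)
    qed
    note eqs = eq[OF f(1) \<pi>(1) \<pi>(2)[unfolded u']] eq[OF f(2) \<pi>'(1) \<pi>'(2)[unfolded v']]
    define \<rho> where "\<rho> = glue \<pi> \<pi>'"
    have \<rho>: "\<rho> \<in> fin" unfolding \<rho>_def by (rule glue[OF \<pi>(1) \<pi>'(1)])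
    have "add_measure \<zeta> \<gamma> = add_measure (glue \<alpha> \<beta>) (add_measure \<zeta>' \<rho>)"
    proof (rule measure_eqI)
      show "sets (add_measure \<zeta> \<gamma>) = sets (add_measure (glue \<alpha> \<beta>) (add_measure \<zeta>' \<rho>))"
        by (simp add: finD[OF \<zeta>(1)] finD[OF glue[OF f(1,2)]])
      fix A assume "A \<in> sets (add_measure \<zeta> \<gamma>)"
      then have A: "A \<in> sets B" by (simp add: finD[OF \<zeta>(1)])
      have "emeasure (add_measure \<zeta> \<gamma>) A
          = (emeasure \<zeta> (A \<inter> Y) + emeasure \<gamma> (A \<inter> Y)) + (emeasure \<zeta> (A - Y) + emeasure \<gamma> (A - Y))"
        unfolding emeasure_add[OF \<zeta>(1) f(3) A] emeasure_split[OF \<zeta>(1) Y(1) A, symmetric]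
          emeasure_split[OF f(3) Y(1) A, symmetric] by (simp only: add_ac)
      also have "\<dots> = (emeasure \<alpha> (A \<inter> Y) + emeasure \<beta> (A - Y)) +
          ((emeasure \<zeta>' (A \<inter> Y) + emeasure \<zeta>' (A - Y)) + (emeasure \<pi> (A \<inter> Y) + emeasure \<pi>' (A - Y)))"
        unfolding eqs(1)[OF m(1)[OF A]] eqs(2)[OF m(2)[OF A]] by (simp only: add_ac)
      also have "\<dots> = emeasure (add_measure (glue \<alpha> \<beta>) (add_measure \<zeta>' \<rho>)) A"
        unfolding emeasure_add[OF glue[OF f(1,2)] fin_add[OF \<zeta>(2) \<rho>] A] emeasure_add[OF \<zeta>(2) \<rho> A]
          glue_e[OF f(1,2) A]
        unfolding \<rho>_def glue_e[OF \<pi>(1) \<pi>'(1) A] emeasure_split[OF \<zeta>(2) Y(1) A] ..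
      finally show "emeasure (add_measure \<zeta> \<gamma>) A
          = emeasure (add_measure (glue \<alpha> \<beta>) (add_measure \<zeta>' \<rho>)) A" .
    qed
    then have "\<Phi> \<zeta> + \<Phi> \<gamma> = \<Phi> (glue \<alpha> \<beta>) + (\<Phi> \<zeta>' + \<Phi> \<rho>)"
      using Phi_add[OF \<zeta>(1) f(3)] Phi_add[OF glue[OF f(1,2)] fin_add[OF \<zeta>(2) \<rho>]] Phi_add[OF \<zeta>(2) \<rho>]
      by simp
    then have "z - w = \<Phi> \<rho>" by (simp add: \<zeta>(3) w_def algebra_simps)
    then show ?thesis using \<rho> by blast
  qed
  ultimately show ?thesis by blast
qed

lemma uminus_diffs: "u \<in> diffs \<Longrightarrow> - u \<in> diffs"
  unfolding diffs_def by force

text \<open>Negation reverses the order on \<open>diffs\<close>, so infima are negatives of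
  suprema.\<close>

lemma lattice_cone: "lattice_cone (\<Phi> ` fin)"
proof -
  have inf: "\<exists>w\<in>diffs. u - w \<in> \<Phi> ` fin \<and> v - w \<in> \<Phi> ` fin \<and>
    (\<forall>z\<in>diffs. u - z \<in> \<Phi> ` fin \<and> v - z \<in> \<Phi> ` fin \<longrightarrow> w - z \<in> \<Phi> ` fin)"
    if "u \<in> diffs" "v \<in> diffs" for u v
  proof -
    note neg = uminus_diffs[OF that(1)] uminus_diffs[OF that(2)]
    obtain w where w: "w \<in> diffs" "w - (- u) \<in> \<Phi> ` fin" "w - (- v) \<in> \<Phi> ` fin"
      "\<And>z. z \<in> diffs \<Longrightarrow> z - (- u) \<in> \<Phi> ` fin \<Longrightarrow> z - (- v) \<in> \<Phi> ` fin \<Longrightarrow> z - w \<in> \<Phi> ` fin"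
      using exists_sup[OF neg] by blast
    show ?thesis
    proof (rule bexI[of _ "- w"], intro conjI ballI impI)
      show "u - - w \<in> \<Phi> ` fin" "v - - w \<in> \<Phi> ` fin" using w(2,3) by (simp_all add: add.commute)
      fix z assume z: "z \<in> diffs" "u - z \<in> \<Phi> ` fin \<and> v - z \<in> \<Phi> ` fin"
      then have "- z - w \<in> \<Phi> ` fin"
        by (intro w(4) uminus_diffs) simp_all
      then show "- w - z \<in> \<Phi> ` fin" by (simp only: minus_diff_commute)
    qed (rule uminus_diffs[OF w(1)])
  qed
  show ?thesis
    unfolding lattice_cone_def Let_def diffs_def[symmetric] using exists_sup inf by simp
qed

end

section \<open>Topology of the invariant states\<close>

text \<open>The topology is induced by \<open>cdual_apply\<close>, so an open cover of S consists of
  preimages of open sets covering the image.\<close>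

lemma compact_cdualI:
  fixes S :: "'a::complex_normed_vector cdual set"
  assumes "compact (cdual_apply ` S)"
  shows "compact S"
  unfolding compact_eq_Heine_Borel
proof (intro allI impI)
  fix C :: "'a cdual set set" assume "(\<forall>T\<in>C. open T) \<and> S \<subseteq> \<Union>C"
  then have C: "\<forall>T\<in>C. open T" "S \<subseteq> \<Union>C" by auto
  then have "\<forall>T\<in>C. \<exists>V. open V \<and> T = cdual_apply -` V" by (auto simp: open_cdual_def)
  then obtain V where V: "\<And>T. T \<in> C \<Longrightarrow> open (V T)" "\<And>T. T \<in> C \<Longrightarrow> T = cdual_apply -` V T" by metis
  have "cdual_apply ` S \<subseteq> (\<Union>T\<in>C. V T)" using C(2) V(2) by blast
  with assms V(1) obtain C' where "C' \<subseteq> C" "finite C'" "cdual_apply ` S \<subseteq> (\<Union>T\<in>C'. V T)"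
    by (rule compactE_image)
  moreover from this have "S \<subseteq> \<Union>C'" using V(2) by blast
  ultimately show "\<exists>C'\<subseteq>C. finite C' \<and> S \<subseteq> \<Union>C'" by blast
qed

lemma continuous_on_cdualI:
  fixes F :: "'a::topological_space \<Rightarrow> 'b::complex_normed_vector cdual"
  assumes "\<And>a. continuous_on S (\<lambda>y. cdual_apply (F y) a)"
  shows "continuous_on S F"
  unfolding continuous_on_open_invariant
proof (intro allI impI)
  fix U :: "'b cdual set" assume "open U"
  then obtain V where V: "open V" "U = cdual_apply -` V" by (auto simp: open_cdual_def)
  have "continuous_on S (\<lambda>y. cdual_apply (F y))"
    by (rule continuous_on_coordinatewise_then_product) (rule assms)
  then have "\<exists>A. open A \<and> A \<inter> S = (\<lambda>y. cdual_apply (F y)) -` V \<inter> S"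
    using V(1) unfolding continuous_on_open_invariant by blast
  then show "\<exists>A. open A \<and> A \<inter> S = F -` U \<inter> S" using V(2) by (simp add: vimage_def)
qed

text \<open>The Banach-Alaoglu argument: the states lie in a product of discs of radius
  \<open>norm a\<close>, compact by Tychonoff, and each defining condition involves finitely many
  coordinates, hence is closed. Boundedness of a limit comes from the box.\<close>

lemma compact_invariant_states: "compact (invariant_states :: 'h::complex_inner ccr cdual set)"
proof (rule compact_cdualI)
  define Q :: "('h ccr \<Rightarrow> complex) set" where
    "Q = {f. (\<forall>a b. f (a + b) = f a + f b) \<and> (\<forall>c a. f (c *\<^sub>C a) = c * f a) \<and>
      (\<forall>a. f (star a * a) \<in> \<real>\<^sub>\<ge>\<^sub>0) \<and> f 1 = 1 \<and> (\<forall>U\<in>unitary_group. \<forall>a. f (ccr_rho U a) = f a)}"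
  define Box :: "('h ccr \<Rightarrow> complex) set" where "Box = (\<Pi>\<^sub>E a\<in>UNIV. cball 0 (norm a))"
  have c: "continuous_on UNIV (\<lambda>f :: 'h ccr \<Rightarrow> complex. f a)" for a
    by (rule continuous_on_product_coordinates)
  have pos: "closed {f :: 'h ccr \<Rightarrow> complex. f a \<in> \<real>\<^sub>\<ge>\<^sub>0}" for a
    using closed_vimage[OF closed_nonneg_Reals_complex c[of a]] by (simp add: vimage_def)
  have "closed {f :: 'h ccr \<Rightarrow> complex. \<forall>U. U \<in> unitary_group \<longrightarrow> (\<forall>a. f (ccr_rho U a) = f a)}"
    by (intro closed_Collect_all closed_Collect_imp closed_Collect_eq c) simp
  then have inv: "closed {f :: 'h ccr \<Rightarrow> complex. \<forall>U\<in>unitary_group. \<forall>a. f (ccr_rho U a) = f a}"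
    by (simp only: Ball_def)
  have "closed Q"
    unfolding Q_def
    by (intro closed_Collect_conj closed_Collect_all closed_Collect_eq pos inv c continuous_intros)
  moreover have "compact Box"
    using compactin_PiE[of "\<lambda>_ :: 'h ccr. euclidean :: complex topology" UNIV "\<lambda>a. cball 0 (norm a)"]
    by (simp add: euclidean_product_topology Box_def)
  ultimately have "compact (Box \<inter> Q)" by (intro compact_Int_closed)
  also have "Box \<inter> Q = cdual_apply ` invariant_states"
  proof (intro equalityI subsetI)
    fix f assume f: "f \<in> Box \<inter> Q"
    then have lin: "clinear f" by (auto simp: Q_def clinear_def scaleC_complex_def)
    have "norm (f a) \<le> norm a" for a
    proof -
      have "f a \<in> cball 0 (norm a)" using f by (auto simp: Box_def)
      then show ?thesis by simp
    qed
    then have "bounded_linear f"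
      using lin by (intro bounded_linear_intro[of f 1]) (auto simp: clinear_def scaleR_scaleC)
    with lin have e: "cdual_apply (Abs_cdual f) = f" by (intro Abs_cdual_inverse) simp
    have "Abs_cdual f \<in> invariant_states"
      using f by (auto simp: invariant_states_def states_def e Q_def fun_eq_iff)
    then show "f \<in> cdual_apply ` invariant_states" by (metis e imageI)
  next
    fix f assume "f \<in> cdual_apply ` (invariant_states :: 'h ccr cdual set)"
    then obtain \<omega> where \<omega>: "f = cdual_apply \<omega>" "\<omega> \<in> invariant_states" by blast
    then have "norm (f a) \<le> norm a" for a
      using state_bound[of \<omega> a] by (simp add: invariant_states_def)
    then have "f \<in> Box" by (auto simp: Box_def)
    moreover have "f \<in> Q"
      using \<omega> by (auto simp: Q_def invariant_states_def states_def cdual_apply_simps fun_eq_iff)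
    ultimately show "f \<in> Box \<inter> Q" by blast
  qed
  finally show "compact (cdual_apply ` (invariant_states :: 'h ccr cdual set))" .
qed

lemma convex_invariant_states: "convex (invariant_states :: 'h::complex_inner ccr cdual set)"
proof (rule convexI)
  fix \<omega> \<psi> :: "'h ccr cdual" and u v :: real
  assume h: "\<omega> \<in> invariant_states" "\<psi> \<in> invariant_states" "0 \<le> u" "0 \<le> v" "u + v = 1"
  have ap: "cdual_apply (u *\<^sub>R \<omega> + v *\<^sub>R \<psi>) a = complex_of_real u * cdual_apply \<omega> a + complex_of_real v * cdual_apply \<psi> a" for a
    by (simp add: plus_cdual.rep_eq scaleR_cdual.rep_eq scaleR_conv_of_real)
  have "complex_of_real u + complex_of_real v = 1" using h(5) by (metis of_real_1 of_real_add)
  then show "u *\<^sub>R \<omega> + v *\<^sub>R \<psi> \<in> invariant_states"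
    using h(1-4)
    by (auto simp: invariant_states_def states_def fun_eq_iff ap
        intro!: nonneg_Reals_add_I nonneg_Reals_mult_I)
qed

text \<open>On the dense algebra the values are finite combinations of powers of y, continuous at 0
  because the exponents are positive. The bound \<open>norm a\<close>, the same for all states,
  makes the approximation uniform in y.\<close>

lemma continuous_on_gauss_state:
  "continuous_on {0..1} (\<lambda>y. gauss_state (from_unit y) :: 'h::complex_inner ccr cdual)"
proof (rule continuous_on_cdualI)
  fix a :: "'h ccr"
  note gs = gauss_state[OF from_unit_range]
  obtain X where X: "(\<lambda>n. completion_embed (X n)) \<longlonglongrightarrow> a" by (rule completion_cases)
  have val: "continuous_on {0..1} (\<lambda>y. gauss_value (from_unit y) x)" for x :: 'h
  proof (cases "x = 0")
    case False
    have "continuous_on {0..1} (\<lambda>y. complex_of_real (exp (- (norm x)\<^sup>2 / 2) * y powr ((norm x)\<^sup>2 / 2)))"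
      using False by (intro continuous_intros continuous_on_powr') auto
    then show ?thesis
      by (rule continuous_on_eq) (simp add: gauss_value_from_unit[OF False])
  next
    case True
    have "gauss_value s (0 :: 'h) = 1" for s by (simp add: gauss_value_def)
    then show ?thesis using True by simp
  qed
  show "continuous_on {0..1} (\<lambda>y. cdual_apply (gauss_state (from_unit y)) a)"
  proof (rule uniform_limit_theorem)
    show "\<forall>\<^sub>F n in sequentially. continuous_on {0..1} (\<lambda>y. cdual_apply (gauss_state (from_unit y)) (completion_embed (X n)))"
      by (intro always_eventually allI)
        (simp add: completion_embed_weyl cdual_apply_simps gs continuous_intros val)
    show "uniform_limit {0..1} (\<lambda>n y. cdual_apply (gauss_state (from_unit y)) (completion_embed (X n)))
        (\<lambda>y. cdual_apply (gauss_state (from_unit y)) a) sequentially"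
    proof (rule uniform_limitI)
      fix e :: real assume "0 < e"
      then have "\<forall>\<^sub>F n in sequentially. dist (completion_embed (X n)) a < e"
        using X by (simp add: tendsto_iff)
      then show "\<forall>\<^sub>F n in sequentially. \<forall>y\<in>{0..1}.
          dist (cdual_apply (gauss_state (from_unit y)) (completion_embed (X n))) (cdual_apply (gauss_state (from_unit y)) a) < e"
        by eventually_elim
          (auto simp: dist_norm cdual_apply_simps(3)[symmetric] intro: le_less_trans[OF state_bound[OF gs(1)]])
    qed
  qed simp
qed

lemma compact_gauss_states: "compact (gauss_state ` {1..\<infinity>} :: 'h::complex_inner ccr cdual set)"
proof -
  have "{1..\<infinity>} = from_unit ` {0..1}"
  proof (intro equalityI subsetI)
    fix s :: ereal assume s: "s \<in> {1..\<infinity>}"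
    from from_unit_to_unit[OF this] to_unit_range[OF this] show "s \<in> from_unit ` {0..1}"
      by (metis atLeastAtMost_iff imageI)
  qed (use from_unit_range in blast)
  then have "gauss_state ` {1..\<infinity>} = (\<lambda>y. gauss_state (from_unit y) :: 'h ccr cdual) ` {0..1}" by (simp add: image_image)
  then show ?thesis
    using compact_continuous_image[OF continuous_on_gauss_state] by simp
qed


section \<open>Extreme points\<close>

lemma measurable_gauss_state':
  "sets \<mu> = sets gauss_space \<Longrightarrow> (\<lambda>s. cdual_apply (gauss_state s) (a :: 'h::complex_inner ccr)) \<in> borel_measurable \<mu>"
  by (subst gauss_spaceD(2)) (auto intro: measurable_gauss_state)

lemma integrable_to_unit:
  assumes "finite_measure \<mu>" "sets \<mu> = sets gauss_space"
  shows "integrable \<mu> (\<lambda>s. to_unit s ^ k)"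
proof -
  interpret finite_measure \<mu> by (rule assms(1))
  show ?thesis
  proof (rule integrable_const_bound)
    show "AE s in \<mu>. norm (to_unit s ^ k) \<le> 1"
      by (rule AE_I2) (simp add: gauss_spaceD(1)[OF assms(2)] to_unit_range power_le_one)
  qed (use measurable_to_unit'[OF assms(2)] in simp)
qed

section \<open>Point masses detected by the variance of the coordinate\<close>

lemma to_unit_variance:
  assumes \<mu>: "prob_space \<mu>" "sets \<mu> = sets gauss_space"
  shows "integrable \<mu> (\<lambda>s. (to_unit s - y)\<^sup>2)"
    "(\<integral>s. (to_unit s - y)\<^sup>2 \<partial>\<mu>) = (\<integral>s. to_unit s ^ 2 \<partial>\<mu>) - 2 * y * (\<integral>s. to_unit s ^ 1 \<partial>\<mu>) + y\<^sup>2"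
proof -
  interpret prob_space \<mu> by (rule \<mu>(1))
  note int = integrable_to_unit[OF finite_measure_axioms \<mu>(2)]
  have sq: "(to_unit s - y)\<^sup>2 = to_unit s ^ 2 - 2 * y * to_unit s ^ 1 + y\<^sup>2" for s
    by (simp add: power2_eq_square algebra_simps)
  show "integrable \<mu> (\<lambda>s. (to_unit s - y)\<^sup>2)"
    unfolding sq by (intro Bochner_Integration.integrable_add Bochner_Integration.integrable_diff int
        integrable_mult_right) simp
  show "(\<integral>s. (to_unit s - y)\<^sup>2 \<partial>\<mu>) = (\<integral>s. to_unit s ^ 2 \<partial>\<mu>) - 2 * y * (\<integral>s. to_unit s ^ 1 \<partial>\<mu>) + y\<^sup>2"
    unfolding sq using int[of 2] int[of 1] by (simp add: prob_space)
qed

text \<open>The hypothesis says that the mean square deviation of \<open>to_unit\<close> from y is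
  0, so the coordinate is almost surely y and, being injective on [1, \<infinity>], fixes s.\<close>

lemma barycenter_dirac:
  assumes \<mu>: "prob_space \<mu>" "sets \<mu> = sets gauss_space"
    and var: "(\<integral>s. to_unit s ^ 2 \<partial>\<mu>) - 2 * y * (\<integral>s. to_unit s ^ 1 \<partial>\<mu>) + y\<^sup>2 = 0"
  shows "\<exists>s\<in>{1..\<infinity>}. to_unit s = y \<and> barycenter \<mu> = (gauss_state s :: 'h::complex_inner ccr cdual)"
proof -
  interpret prob_space \<mu> by (rule \<mu>(1))
  note sp = gauss_spaceD(1)[OF \<mu>(2)]
  note V = to_unit_variance[OF \<mu>, of y]
  have "AE s in \<mu>. (to_unit s - y)\<^sup>2 = 0"
    using V(2)[unfolded var] integral_nonneg_eq_0_iff_AE[OF V(1)] by simp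
  then have AE: "AE s in \<mu>. to_unit s = y" by simp
  with AE_space have "AE s in \<mu>. s \<in> space \<mu> \<and> to_unit s = y" by eventually_elim simp
  from eventually_happens'[OF ae_filter_bot this] obtain s where s: "s \<in> {1..\<infinity>}" "to_unit s = y" by (auto simp: sp)
  have "barycenter \<mu> = (gauss_state s :: 'h ccr cdual)"
  proof (rule cdual_eqI)
    fix a :: "'h ccr"
    have "cdual_apply (barycenter \<mu>) a = (\<integral>r. cdual_apply (gauss_state s) a \<partial>\<mu>)"
      unfolding barycenter_apply[OF finite_measure_axioms \<mu>(2)]
    proof (rule integral_cong_AE)
      show "AE r in \<mu>. cdual_apply (gauss_state r) a = cdual_apply (gauss_state s) a"
        using AE AE_space
      proof eventually_elim
        case (elim r)
        then have "r = from_unit y" "s = from_unit y"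
          using from_unit_to_unit[of r] from_unit_to_unit[OF s(1)] s(2) by (auto simp: sp)
        then show ?case by simp
      qed
    qed (simp_all add: measurable_gauss_state'[OF \<mu>(2)])
    then show "cdual_apply (barycenter \<mu>) a = cdual_apply (gauss_state s) a" by (simp add: prob_space)
  qed
  then show ?thesis using s by blast
qed

text \<open>Serves both to split a measure into weighted pieces and, with a constant density, to
  rescale it.\<close>

lemma barycenter_density:
  assumes \<mu>: "finite_measure \<mu>" "sets \<mu> = sets gauss_space"
    and h: "h \<in> borel_measurable \<mu>" "\<And>s. s \<in> space \<mu> \<Longrightarrow> 0 \<le> h s" "integrable \<mu> h"
  shows "finite_measure (density \<mu> (\<lambda>s. ennreal (h s)))" "sets (density \<mu> (\<lambda>s. ennreal (h s))) = sets gauss_space"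
    "measure (density \<mu> (\<lambda>s. ennreal (h s))) (space (density \<mu> (\<lambda>s. ennreal (h s)))) = (\<integral>s. h s \<partial>\<mu>)"
    "cdual_apply (barycenter (density \<mu> (\<lambda>s. ennreal (h s))) :: 'h::complex_inner ccr cdual) a
      = (\<integral>s. h s *\<^sub>R cdual_apply (gauss_state s) a \<partial>\<mu>)"
    "integrable \<mu> (\<lambda>s. h s *\<^sub>R cdual_apply (gauss_state s) (a :: 'h ccr))"
proof -
  let ?D = "density \<mu> (\<lambda>s. ennreal (h s))"
  have AE: "AE s in \<mu>. 0 \<le> h s" by (rule AE_I2) (rule h(2))
  have e: "emeasure ?D (space ?D) = ennreal (\<integral>s. h s \<partial>\<mu>)"
    using h(1) by (subst emeasure_density) (simp_all add: nn_integral_eq_integral[OF h(3) AE] cong: nn_integral_cong)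
  show fin: "finite_measure ?D" by (rule finite_measureI) (use e in simp)
  show sets: "sets ?D = sets gauss_space" by (simp add: \<mu>(2))
  show "measure ?D (space ?D) = (\<integral>s. h s \<partial>\<mu>)"
    unfolding measure_def e by (simp add: integral_nonneg_AE[OF AE])
  show "cdual_apply (barycenter ?D :: 'h ccr cdual) a = (\<integral>s. h s *\<^sub>R cdual_apply (gauss_state s) a \<partial>\<mu>)"
    unfolding barycenter_apply[OF fin sets]
    by (rule integral_density) (use h(1) AE in \<open>simp_all add: measurable_gauss_state'[OF \<mu>(2)]\<close>)
  show "integrable \<mu> (\<lambda>s. h s *\<^sub>R cdual_apply (gauss_state s) (a :: 'h ccr))"
    using integrable_gauss_state[OF fin sets, of a]
    by (subst (asm) integrable_density) (use h(1) AE in \<open>simp_all add: measurable_gauss_state'[OF \<mu>(2)]\<close>)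
qed

lemma barycenter_density_invariant:
  assumes \<mu>: "prob_space \<mu>" "sets \<mu> = sets gauss_space"
    and h: "h \<in> borel_measurable \<mu>" "\<And>s. s \<in> space \<mu> \<Longrightarrow> 0 \<le> h s" "integrable \<mu> h" "(\<integral>s. h s \<partial>\<mu>) = 1"
  shows "barycenter (density \<mu> (\<lambda>s. ennreal (h s))) \<in> (invariant_states :: 'h::complex_inner ccr cdual set)"
proof (rule barycenter_invariant)
  interpret prob_space \<mu> by (rule \<mu>(1))
  note D = barycenter_density[OF finite_measure_axioms \<mu>(2) h(1-3)]
  show "prob_space (density \<mu> (\<lambda>s. ennreal (h s)))"
    by (rule prob_spaceI) (simp add: finite_measure.emeasure_eq_measure[OF D(1)] D(3)[simplified] h(4))
qed (simp add: \<mu>(2))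

lemma extreme_point_imp_gauss:
  fixes \<omega> :: "'h::complex_inner ccr cdual"
  assumes ext: "\<omega> extreme_point_of invariant_states"
    and dim: "\<not> (\<exists>B :: 'h set. finite B \<and> cspan B = UNIV)"
  shows "\<omega> \<in> gauss_state ` {1..\<infinity>}"
proof -
  have K: "\<omega> \<in> invariant_states" using ext by (simp add: extreme_point_of_def)
  obtain \<mu> where \<mu>: "prob_space \<mu>" "sets \<mu> = sets gauss_space" and \<omega>: "\<omega> = barycenter \<mu>"
    using exists_measure[OF K dim] .
  obtain e :: 'h where e: "norm e = 1" using exists_unit_vector[OF dim] .
  interpret prob_space \<mu> by (rule \<mu>(1))
  note sp = gauss_spaceD(1)[OF \<mu>(2)]
  have int: "integrable \<mu> to_unit" "integrable \<mu> (\<lambda>s. (to_unit s)\<^sup>2)"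
    using integrable_to_unit[OF finite_measure_axioms \<mu>(2), of 1]
      integrable_to_unit[OF finite_measure_axioms \<mu>(2), of 2] by simp_all
  have meas [measurable]: "to_unit \<in> borel_measurable \<mu>" by (rule measurable_to_unit'[OF \<mu>(2)])
  define m where "m = (\<integral>s. to_unit s \<partial>\<mu>)"
  have m: "0 \<le> m" "m \<le> 1"
  proof -
    show "0 \<le> m" unfolding m_def
      by (rule Bochner_Integration.integral_nonneg) (simp add: sp to_unit_range)
    have "m \<le> (\<integral>s. 1 \<partial>\<mu>)" unfolding m_def
      by (rule integral_mono) (simp_all add: int sp to_unit_range)
    then show "m \<le> 1" by (simp add: prob_space)
  qed
  \<comment> \<open>Splitting \<open>\<mu>\<close> with the weight \<open>(1 + to_unit s) / 3\<close>, which stays away from 0 and 1, gives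
    two invariant states equal to \<open>\<omega>\<close> by extremality; the first moment of the pieces then says that \<open>to_unit\<close> has variance 0.\<close>
  define c where "c = (1 + m) / 3"
  have c: "0 < c" "c < 1" using m by (simp_all add: c_def)
  define h1 h2 where "h1 s = (1 + to_unit s) / 3 / c" and "h2 s = (1 - (1 + to_unit s) / 3) / (1 - c)" for s
  have h1: "h1 \<in> borel_measurable \<mu>" "\<And>s. s \<in> space \<mu> \<Longrightarrow> 0 \<le> h1 s" "integrable \<mu> h1" "(\<integral>s. h1 s \<partial>\<mu>) = 1"
    and h2: "h2 \<in> borel_measurable \<mu>" "\<And>s. s \<in> space \<mu> \<Longrightarrow> 0 \<le> h2 s" "integrable \<mu> h2" "(\<integral>s. h2 s \<partial>\<mu>) = 1"
  proof -
    show "h1 \<in> borel_measurable \<mu>" "h2 \<in> borel_measurable \<mu>" by (simp_all add: h1_def[abs_def] h2_def[abs_def])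
    show "0 \<le> h1 s" "0 \<le> h2 s" if "s \<in> space \<mu>" for s
      using to_unit_range[of s] that c by (auto simp: h1_def h2_def sp intro!: divide_nonneg_pos)
    show "integrable \<mu> h1" "integrable \<mu> h2" using int(1) by (simp_all add: h1_def[abs_def] h2_def[abs_def])
    show "(\<integral>s. h1 s \<partial>\<mu>) = 1" "(\<integral>s. h2 s \<partial>\<mu>) = 1"
      using int(1) c by (simp_all add: h1_def h2_def prob_space m_def[symmetric]) (simp_all add: c_def)
  qed
  define D1 where "D1 = density \<mu> (\<lambda>s. ennreal (h1 s))"
  define D2 where "D2 = density \<mu> (\<lambda>s. ennreal (h2 s))"
  note B1 = barycenter_density[OF finite_measure_axioms \<mu>(2) h1(1-3), folded D1_def]
  note B2 = barycenter_density[OF finite_measure_axioms \<mu>(2) h2(1-3), folded D2_def]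
  have K1: "(barycenter D1 :: 'h ccr cdual) \<in> invariant_states" "(barycenter D2 :: 'h ccr cdual) \<in> invariant_states"
    unfolding D1_def D2_def using h1 h2 by (auto intro!: barycenter_density_invariant \<mu>)
  have mix: "\<omega> = (1 - c) *\<^sub>R barycenter D2 + c *\<^sub>R barycenter D1"
  proof (rule cdual_eqI)
    fix a :: "'h ccr"
    let ?g = "\<lambda>s. cdual_apply (gauss_state s) a"
    have hc: "(1 - c) * h2 s + c * h1 s = 1" for s using c by (simp add: h1_def h2_def)
    have "cdual_apply ((1 - c) *\<^sub>R barycenter D2 + c *\<^sub>R barycenter D1) a
        = (1 - c) *\<^sub>R (\<integral>s. h2 s *\<^sub>R ?g s \<partial>\<mu>) + c *\<^sub>R (\<integral>s. h1 s *\<^sub>R ?g s \<partial>\<mu>)"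
      by (simp only: plus_cdual.rep_eq scaleR_cdual.rep_eq B1(4) B2(4))
    also have "\<dots> = (\<integral>s. (1 - c) *\<^sub>R h2 s *\<^sub>R ?g s + c *\<^sub>R h1 s *\<^sub>R ?g s \<partial>\<mu>)"
    proof -
      have "integrable \<mu> (\<lambda>s. (1 - c) *\<^sub>R h2 s *\<^sub>R ?g s)"
        by (rule Bochner_Integration.integrable_scaleR_right[OF B2(5)])
      moreover have "integrable \<mu> (\<lambda>s. c *\<^sub>R h1 s *\<^sub>R ?g s)"
        by (rule Bochner_Integration.integrable_scaleR_right[OF B1(5)])
      ultimately show ?thesis
        by (simp only: Bochner_Integration.integral_add Bochner_Integration.integral_scaleR_right)
    qed
    also have "\<dots> = (\<integral>s. ?g s \<partial>\<mu>)"
      by (simp only: scaleR_scaleR scaleR_add_left[symmetric] hc scaleR_one)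
    also have "\<dots> = cdual_apply \<omega> a" unfolding \<omega> by (rule barycenter_apply[OF finite_measure_axioms \<mu>(2), symmetric])
    finally show "cdual_apply \<omega> a = cdual_apply ((1 - c) *\<^sub>R barycenter D2 + c *\<^sub>R barycenter D1) a" ..
  qed
  have "barycenter D1 = (barycenter D2 :: 'h ccr cdual)"
  proof (rule ccontr)
    assume "barycenter D1 \<noteq> (barycenter D2 :: 'h ccr cdual)"
    then have "\<omega> \<in> open_segment (barycenter D2) (barycenter D1)"
      using mix c by (auto simp: in_segment)
    then show False using ext K1 by (auto simp: extreme_point_of_def)
  qed
  with mix have "\<omega> = barycenter D1" by (simp add: scaleR_left_diff_distrib)
  then have "barycenter D1 = (barycenter \<mu> :: 'h ccr cdual)" using \<omega> by simp
  then have "complex_of_real (\<integral>s. to_unit s ^ 1 \<partial>D1) = complex_of_real (\<integral>s. to_unit s ^ 1 \<partial>\<mu>)"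
    by (simp only: barycenter_moment[OF B1(1,2) e] barycenter_moment[OF finite_measure_axioms \<mu>(2) e])
  then have "(\<integral>s. to_unit s \<partial>D1) = m" by (simp add: m_def)
  also have "(\<integral>s. to_unit s \<partial>D1) = (\<integral>s. h1 s *\<^sub>R to_unit s \<partial>\<mu>)"
    unfolding D1_def by (rule integral_density) (use h1 in \<open>auto intro: AE_I2\<close>)
  \<comment> \<open>The reweighted mean is (m + second moment) / (1 + m); equating it with m makes
    the second moment m squared.\<close>
  also have "\<dots> = (\<integral>s. (to_unit s + (to_unit s)\<^sup>2) / (1 + m) \<partial>\<mu>)"
    using c by (intro Bochner_Integration.integral_cong refl) (simp add: h1_def c_def field_simps power2_eq_square)
  also have "\<dots> = (m + (\<integral>s. (to_unit s)\<^sup>2 \<partial>\<mu>)) / (1 + m)"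
    using int by (simp add: m_def)
  finally have "(\<integral>s. (to_unit s)\<^sup>2 \<partial>\<mu>) = m * m" using m by (simp add: field_simps)
  then have "(\<integral>s. to_unit s ^ 2 \<partial>\<mu>) - 2 * m * (\<integral>s. to_unit s ^ 1 \<partial>\<mu>) + m\<^sup>2 = 0"
    by (simp add: m_def[symmetric] power2_eq_square)
  from barycenter_dirac[OF \<mu> this] \<omega> show ?thesis by blast
qed

text \<open>The mean square deviations of the coordinate from y under the two components are
  nonnegative, and their convex combination is y^2 - 2 y y + y^2 = 0. Both vanish, so both
  components are Gaussian states with the coordinate y.\<close>

lemma gauss_extreme_point:
  assumes s: "s \<in> {1..\<infinity>}"
    and dim: "\<not> (\<exists>B :: 'h::complex_inner set. finite B \<and> cspan B = UNIV)"
  shows "gauss_state s extreme_point_of (invariant_states :: 'h ccr cdual set)"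
  unfolding extreme_point_of_def
proof (intro conjI ballI notI)
  show "gauss_state s \<in> (invariant_states :: 'h ccr cdual set)" by (rule gauss_state_invariant[OF s])
  fix a b :: "'h ccr cdual"
  assume ab: "a \<in> invariant_states" "b \<in> invariant_states" and "gauss_state s \<in> open_segment a b"
  then obtain u where ne: "a \<noteq> b" and u: "0 < u" "u < 1" and mix: "gauss_state s = (1 - u) *\<^sub>R a + u *\<^sub>R b"
    by (auto simp: in_segment)
  obtain \<mu> where \<mu>: "prob_space \<mu>" "sets \<mu> = sets gauss_space" "a = barycenter \<mu>"
    using exists_measure[OF ab(1) dim] .
  obtain \<nu> where \<nu>: "prob_space \<nu>" "sets \<nu> = sets gauss_space" "b = barycenter \<nu>"
    using exists_measure[OF ab(2) dim] .
  obtain e :: 'h where e: "norm e = 1" using exists_unit_vector[OF dim] .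
  have fin: "finite_measure \<mu>" "finite_measure \<nu>" using \<mu>(1) \<nu>(1) by (simp_all add: prob_space_def)
  define y where "y = to_unit s"
  have mom: "y ^ k = (1 - u) * (\<integral>s. to_unit s ^ k \<partial>\<mu>) + u * (\<integral>s. to_unit s ^ k \<partial>\<nu>)" for k
  proof -
    let ?w = "ccr_W (sqrt (2 * real k) *\<^sub>R e)"
    have "complex_of_real (y ^ k) = complex_of_real (exp (real k)) * cdual_apply (gauss_state s) ?w"
      unfolding y_def gauss_state(2)[OF s] by (rule to_unit_power[OF e s])
    also have "\<dots> = complex_of_real (1 - u) * (complex_of_real (exp (real k)) * cdual_apply a ?w)
        + complex_of_real u * (complex_of_real (exp (real k)) * cdual_apply b ?w)"
      unfolding mix plus_cdual.rep_eq scaleR_cdual.rep_eq scaleR_conv_of_real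
      by (simp only: distrib_left mult.left_commute)
    also have "\<dots> = complex_of_real ((1 - u) * (\<integral>s. to_unit s ^ k \<partial>\<mu>) + u * (\<integral>s. to_unit s ^ k \<partial>\<nu>))"
      unfolding \<mu>(3) \<nu>(3) barycenter_moment[OF fin(1) \<mu>(2) e, symmetric] barycenter_moment[OF fin(2) \<nu>(2) e, symmetric]
      by (simp only: of_real_add of_real_mult)
    finally show ?thesis by (simp only: of_real_eq_iff)
  qed
  let ?V = "\<lambda>\<kappa>. (\<integral>s. to_unit s ^ 2 \<partial>\<kappa>) - 2 * y * (\<integral>s. to_unit s ^ 1 \<partial>\<kappa>) + y\<^sup>2"
  have pos: "0 \<le> ?V \<mu>" "0 \<le> ?V \<nu>"
    unfolding to_unit_variance(2)[OF \<mu>(1,2), symmetric] to_unit_variance(2)[OF \<nu>(1,2), symmetric] by simp_all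
  have "(1 - u) * ?V \<mu> + u * ?V \<nu>
      = ((1 - u) * (\<integral>s. to_unit s ^ 2 \<partial>\<mu>) + u * (\<integral>s. to_unit s ^ 2 \<partial>\<nu>))
        - 2 * y * ((1 - u) * (\<integral>s. to_unit s ^ 1 \<partial>\<mu>) + u * (\<integral>s. to_unit s ^ 1 \<partial>\<nu>)) + y\<^sup>2"
    by (simp add: algebra_simps)
  also have "\<dots> = 0" unfolding mom[symmetric] by (simp add: power2_eq_square)
  finally have "(1 - u) * ?V \<mu> + u * ?V \<nu> = 0" .
  moreover have "0 \<le> (1 - u) * ?V \<mu>" "0 \<le> u * ?V \<nu>" using pos u by simp_all
  ultimately have "(1 - u) * ?V \<mu> = 0" "u * ?V \<nu> = 0" by linarith+
  then have "?V \<mu> = 0" "?V \<nu> = 0" using u by simp_all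
  then obtain r r' where "r \<in> {1..\<infinity>}" "to_unit r = y" "a = gauss_state r"
    and "r' \<in> {1..\<infinity>}" "to_unit r' = y" "b = gauss_state r'"
    using barycenter_dirac[OF \<mu>(1,2), where 'h = 'h] barycenter_dirac[OF \<nu>(1,2), where 'h = 'h]
    unfolding \<mu>(3) \<nu>(3) by blast
  then have "a = b" by (metis from_unit_to_unit)
  then show False using ne by simp
qed


section \<open>The simplex of invariant states\<close>

lemma barycenter_scale:
  assumes \<mu>: "finite_measure \<mu>" "sets \<mu> = sets gauss_space" and r: "0 \<le> r"
  defines "D \<equiv> density \<mu> (\<lambda>s. ennreal r)"
  shows "finite_measure D" "sets D = sets gauss_space" "measure D (space D) = r * measure \<mu> (space \<mu>)"
    "barycenter D = r *\<^sub>R (barycenter \<mu> :: 'h::complex_inner ccr cdual)"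
proof -
  interpret finite_measure \<mu> by (rule \<mu>(1))
  note B = barycenter_density[OF \<mu>, of "\<lambda>_. r", OF _ r, folded D_def]
  show "finite_measure D" "sets D = sets gauss_space" "measure D (space D) = r * measure \<mu> (space \<mu>)"
    using B(1-3) by simp_all
  show "barycenter D = r *\<^sub>R (barycenter \<mu> :: 'h ccr cdual)"
    by (rule cdual_eqI) (simp add: B(4) scaleR_cdual.rep_eq barycenter_apply[OF \<mu>])
qed

text \<open>The second component is the height in the cone over
  \<open>invariant_states \<times> {1}\<close>.\<close>

definition barycenter_pair :: "ereal measure \<Rightarrow> 'h::complex_inner ccr cdual \<times> real" where
  "barycenter_pair \<mu> = (barycenter \<mu>, measure \<mu> (space \<mu>))"

text \<open>For injectivity the second component provides a common mass c; dividing by c reduces to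
  probability measures, and c = 0 leaves only the zero measure.\<close>

lemma measure_cone_barycenter:
  assumes dim: "\<not> (\<exists>B :: 'h::complex_inner set. finite B \<and> cspan B = UNIV)"
  shows "measure_cone gauss_space (barycenter_pair :: ereal measure \<Rightarrow> 'h ccr cdual \<times> real)"
proof
  fix \<mu> \<nu> :: "ereal measure"
  assume \<mu>: "finite_measure \<mu>" "sets \<mu> = sets gauss_space" and \<nu>: "finite_measure \<nu>" "sets \<nu> = sets gauss_space"
  have eq: "sets \<nu> = sets \<mu>" by (simp only: \<mu> \<nu>)
  have S: "finite_measure (add_measure \<mu> \<nu>)" "sets (add_measure \<mu> \<nu>) = sets gauss_space"
    using finite_measure_add[OF \<mu>(1) \<nu>(1) eq] \<mu>(2) by simp_all
  have bary: "barycenter (add_measure \<mu> \<nu>) = barycenter \<mu> + (barycenter \<nu> :: 'h ccr cdual)"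
    by (rule cdual_eqI)
      (simp only: plus_cdual.rep_eq barycenter_apply[OF \<mu>] barycenter_apply[OF \<nu>] barycenter_apply[OF S]
        integral_add_measure[OF \<mu>(1) \<nu>(1) eq integrable_gauss_state[OF S]])
  have "complex_of_real (measure (add_measure \<mu> \<nu>) (space (add_measure \<mu> \<nu>)))
      = complex_of_real (measure \<mu> (space \<mu>) + measure \<nu> (space \<nu>))"
    using arg_cong[OF bary, of "\<lambda>\<omega>. cdual_apply \<omega> 1"]
    unfolding plus_cdual.rep_eq barycenter_one[OF \<mu>] barycenter_one[OF \<nu>] barycenter_one[OF S] of_real_add .
  then show "barycenter_pair (add_measure \<mu> \<nu>) = barycenter_pair \<mu> + (barycenter_pair \<nu> :: 'h ccr cdual \<times> real)"
    unfolding barycenter_pair_def bary by (simp only: of_real_eq_iff add_Pair)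
  obtain e :: 'h where e: "norm e = 1" using exists_unit_vector[OF dim] .
  assume eqp: "barycenter_pair \<mu> = (barycenter_pair \<nu> :: 'h ccr cdual \<times> real)"
  define c where "c = measure \<mu> (space \<mu>)"
  have c': "c = measure \<nu> (space \<nu>)" and b: "barycenter \<mu> = (barycenter \<nu> :: 'h ccr cdual)"
    using eqp by (simp_all add: barycenter_pair_def c_def)
  show "\<mu> = \<nu>"
  proof (rule measure_eqI)
    fix A assume A: "A \<in> sets \<mu>"
    show "emeasure \<mu> A = emeasure \<nu> A"
    proof (cases "c = 0")
      case True
      have "emeasure \<kappa> A = 0" if "finite_measure \<kappa>" "measure \<kappa> (space \<kappa>) = 0" for \<kappa>
        using emeasure_space[of \<kappa> A] that(2) finite_measure.emeasure_eq_measure[OF that(1), of "space \<kappa>"] by simp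
      then show ?thesis using True \<mu>(1) \<nu>(1) c' c_def by metis
    next
      case False
      then have c: "0 < c" using measure_nonneg[of \<mu>] by (simp add: c_def less_le)
      have prob: "prob_space (density \<kappa> (\<lambda>s. ennreal (1 / c)))"
        if "finite_measure \<kappa>" "sets \<kappa> = sets gauss_space" "c = measure \<kappa> (space \<kappa>)" for \<kappa>
      proof (rule prob_spaceI)
        have r: "0 \<le> 1 / c" using c by simp
        show "emeasure (density \<kappa> (\<lambda>s. ennreal (1 / c))) (space (density \<kappa> (\<lambda>s. ennreal (1 / c)))) = 1"
          unfolding finite_measure.emeasure_eq_measure[OF barycenter_scale(1)[OF that(1,2) r]]
            barycenter_scale(3)[OF that(1,2) r] that(3)[symmetric] using c by simp
      qed
      have r: "0 \<le> 1 / c" using c by simp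
      have "density \<mu> (\<lambda>s. ennreal (1 / c)) = density \<nu> (\<lambda>s. ennreal (1 / c))"
        by (rule barycenter_prob_inj[OF prob[OF \<mu> c_def] barycenter_scale(2)[OF \<mu> r] prob[OF \<nu> c'] barycenter_scale(2)[OF \<nu> r] e])
          (simp only: barycenter_scale(4)[OF \<mu> r] barycenter_scale(4)[OF \<nu> r] b)
      from arg_cong[OF this, of "\<lambda>\<kappa>. emeasure \<kappa> A"]
      have "ennreal (1 / c) * emeasure \<mu> A = ennreal (1 / c) * emeasure \<nu> A"
        using A eq by (simp add: emeasure_density_const)
      then show ?thesis using c by (simp add: ennreal_mult_cancel_left ennreal_eq_0_iff)
    qed
  qed (simp only: \<mu> \<nu>)
qed

lemma cone_hull_invariant_states:
  assumes dim: "\<not> (\<exists>B :: 'h::complex_inner set. finite B \<and> cspan B = UNIV)"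
  shows "cone hull (invariant_states \<times> {1}) = (barycenter_pair :: ereal measure \<Rightarrow> 'h ccr cdual \<times> real) `
    {\<mu>. finite_measure \<mu> \<and> sets \<mu> = sets gauss_space}"
proof (intro equalityI subsetI)
  fix p :: "'h ccr cdual \<times> real"
  assume "p \<in> cone hull (invariant_states \<times> {1})"
  then obtain c \<omega> where c: "0 \<le> c" "\<omega> \<in> invariant_states" and p: "p = c *\<^sub>R (\<omega>, 1)"
    by (auto simp: cone_hull_expl)
  obtain \<mu> where \<mu>: "prob_space \<mu>" "sets \<mu> = sets gauss_space" "\<omega> = barycenter \<mu>"
    using exists_measure[OF c(2) dim] .
  have fin: "finite_measure \<mu>" using \<mu>(1) by (simp add: prob_space_def)
  note B = barycenter_scale[OF fin \<mu>(2) c(1)]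
  have "p = barycenter_pair (density \<mu> (\<lambda>s. ennreal c))"
    unfolding barycenter_pair_def B p by (simp add: \<mu>(3) prob_space.prob_space[OF \<mu>(1)])
  then show "p \<in> barycenter_pair ` {\<mu>. finite_measure \<mu> \<and> sets \<mu> = sets gauss_space}"
    using B(1,2) by blast
next
  fix p :: "'h ccr cdual \<times> real"
  assume "p \<in> barycenter_pair ` {\<mu>. finite_measure \<mu> \<and> sets \<mu> = sets gauss_space}"
  then obtain \<mu> where \<mu>: "finite_measure \<mu>" "sets \<mu> = sets gauss_space" and p: "p = barycenter_pair \<mu>" by blast
  interpret finite_measure \<mu> by (rule \<mu>(1))
  define c where "c = measure \<mu> (space \<mu>)"
  show "p \<in> cone hull (invariant_states \<times> {1})"
  proof (cases "c = 0")
    case True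
    have "emeasure \<mu> (space \<mu>) = 0" using True by (simp add: emeasure_eq_measure c_def)
    then have "AE s in \<mu>. P s" for P by (intro AE_I[of _ _ "space \<mu>"]) auto
    then have "barycenter \<mu> = (0 :: 'h ccr cdual)"
      by (intro cdual_eqI) (simp add: barycenter_apply[OF \<mu>] zero_cdual.rep_eq integral_eq_zero_AE)
    \<comment> \<open>The apex of the cone must appear as a multiple of some point of the base; the
      trace is a concrete one.\<close>
    then have p0: "p = 0 *\<^sub>R (gauss_state \<infinity>, 1)" using True by (simp add: p barycenter_pair_def c_def zero_prod_def)
    show ?thesis
      unfolding p0 by (rule mem_cone_hull) (auto intro: gauss_state_invariant)
  next
    case False
    then have c: "0 < c" using measure_nonneg[of \<mu>] by (simp add: c_def less_le)
    then have r: "0 \<le> 1 / c" by simp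
    note B = barycenter_scale[OF \<mu> r]
    have "prob_space (density \<mu> (\<lambda>s. ennreal (1 / c)))"
      by (rule prob_spaceI) (simp only: finite_measure.emeasure_eq_measure[OF B(1)] B(3), use c in \<open>simp add: c_def\<close>)
    then have "(1 / c) *\<^sub>R barycenter \<mu> \<in> (invariant_states :: 'h ccr cdual set)"
      using barycenter_invariant[OF _ B(2), where 'h = 'h] unfolding B(4) by blast
    moreover have pc: "p = c *\<^sub>R ((1 / c) *\<^sub>R barycenter \<mu>, 1)"
      using c by (simp add: p barycenter_pair_def c_def)
    ultimately show ?thesis unfolding pc using c by (intro mem_cone_hull) auto
  qed
qed

theorem theorem3p18:
  assumes separable: "separable_space (euclidean :: 'h::chilbert_space topology)"
    and infinite_dim: "\<not> (\<exists>B :: 'h set. finite B \<and> cspan B = UNIV)"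
  shows "bauer_simplex (invariant_states :: 'h ccr cdual set)
    \<and> {\<omega>. \<omega> extreme_point_of (invariant_states :: 'h ccr cdual set)} = gauss_state ` {1..\<infinity>}
    \<and> (\<forall>\<omega> \<in> (invariant_states :: 'h ccr cdual set).
         \<exists>!\<mu>. prob_space \<mu> \<and> sets \<mu> = sets (restrict_space borel {1..\<infinity>::ereal})
           \<and> (\<forall>a. has_bochner_integral \<mu> (\<lambda>s. cdual_apply (gauss_state s) a) (cdual_apply \<omega> a)))"
proof (intro conjI ballI)
  interpret measure_cone gauss_space "barycenter_pair :: ereal measure \<Rightarrow> 'h ccr cdual \<times> real"
    by (rule measure_cone_barycenter[OF infinite_dim])
  show ext: "{\<omega>. \<omega> extreme_point_of (invariant_states :: 'h ccr cdual set)} = gauss_state ` {1..\<infinity>}"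
    using extreme_point_imp_gauss[OF _ infinite_dim] gauss_extreme_point[OF _ infinite_dim] by blast
  have "lattice_cone (cone hull (invariant_states \<times> {1}) :: ('h ccr cdual \<times> real) set)"
    using lattice_cone unfolding cone_hull_invariant_states[OF infinite_dim] fin_def .
  then show "bauer_simplex (invariant_states :: 'h ccr cdual set)"
    unfolding bauer_simplex_def choquet_simplex_def ext
    by (intro conjI compact_invariant_states convex_invariant_states compact_gauss_states)
  fix \<omega> :: "'h ccr cdual"
  assume "\<omega> \<in> invariant_states"
  then obtain \<mu> where \<mu>: "prob_space \<mu>" "sets \<mu> = sets gauss_space" "\<omega> = barycenter \<mu>"
    using exists_measure[OF _ infinite_dim] by blast
  obtain e :: 'h where e: "norm e = 1" using exists_unit_vector[OF infinite_dim] .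
  have fin: "finite_measure \<kappa>" if "prob_space \<kappa>" for \<kappa> :: "ereal measure"
    using that by (simp add: prob_space_def)
  show "\<exists>!\<mu>. prob_space \<mu> \<and> sets \<mu> = sets gauss_space
      \<and> (\<forall>a. has_bochner_integral \<mu> (\<lambda>s. cdual_apply (gauss_state s) a) (cdual_apply \<omega> a))"
  proof (intro ex1I[of _ \<mu>] conjI allI)
    fix a :: "'h ccr"
    show "has_bochner_integral \<mu> (\<lambda>s. cdual_apply (gauss_state s) a) (cdual_apply \<omega> a)"
      unfolding \<mu>(3) barycenter_apply[OF fin[OF \<mu>(1)] \<mu>(2)]
      by (rule has_bochner_integral_integrable[OF integrable_gauss_state[OF fin[OF \<mu>(1)] \<mu>(2)]])
  next
    fix \<nu>
    assume \<nu>: "prob_space \<nu> \<and> sets \<nu> = sets gauss_space \<and>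
      (\<forall>a. has_bochner_integral \<nu> (\<lambda>s. cdual_apply (gauss_state s) a) (cdual_apply \<omega> a))"
    then have "cdual_apply (barycenter \<nu>) a = cdual_apply \<omega> a" for a
      using barycenter_apply[OF fin, of \<nu> a] has_bochner_integral_integral_eq by metis
    then have "barycenter \<nu> = \<omega>" by (rule cdual_eqI)
    then show "\<nu> = \<mu>"
      using \<nu> \<mu> by (intro barycenter_prob_inj[OF _ _ _ _ e]) auto
  qed (fact \<mu>)+
qed

end
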